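(* Let $J_n$ ($n\ge 1$) and $J$ be bounded Jacobi matrices on $\ell^2(\mathbb Z)$ and suppose that $J_n\to J$ in the weak operator topology (equivalently, the coefficients $a,b$ converge pointwise). Suppose that for every $n\ge 1$, $J_{n+1}$ is obtained from $J_n$ by either (1) a shift, or (2) a (time $t$ map of a) flow from the Toda hierarchy (where the shift, respectively the flow and the time, may depend on $n$). Then $\Sigma_{ac}(J)\supset\Sigma_{ac}(J_1)$ (up to a set of Lebesgue measure zero).
   Context: A Jacobi matrix on $\ell^2(\mathbb Z)$ acts by $(Ju)_n=a_nu_{n+1}+a_{n-1}u_{n-1}+b_nu_n$, with $a_n>0$, $b_n\in\mathbb R$; bounded means that $a,b$ are bounded sequences. A shift is a map $(a_n,b_n)\mapsto(a_{n-k},b_{n-k})$ for some $k\in\mathbb Z$. Flows of the Toda hierarchy: for a real polynomial $p$, the associated flow on bounded Jacobi matrices is given by $\frac{d}{dt}J(t)=[p(J(t))_a,J(t)]$, where for a bounded self-adjoint operator $X$ on $\ell^2(\mathbb Z)$ with real banded matrix $X_{jk}$, $X_a$ denotes the antisymmetric operator with $(X_a)_{jk}=X_{jk}$ for $j<k$, $(X_a)_{jk}=-X_{jk}$ for $j>k$, and $(X_a)_{jj}=0$. It has a unique global solution for every bounded initial Jacobi matrix $J(0)$; the time $t$ map ($t\in\mathbb R$) is $J(0)\mapsto J(t)$. For $z\in\mathbb C^+=\{z\in\mathbb C:\operatorname{Im} z>0\}$ let $f_{\pm}(\cdot,z)$ be the (unique up to a factor) nonzero solution of $a_nf(n+1)+a_{n-1}f(n-1)+b_nf(n)=zf(n)$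 that is square summable near $\pm\infty$. The half line $m$ functions of $J$ are $m_{\pm}(z)=\mp a_0f_{\pm}(1,z)/f_{\pm}(0,z)$; these are holomorphic maps $\mathbb C^+\to\mathbb C^+$ and have boundary values $m_\pm(x)=\lim_{y\to0+}m_\pm(x+iy)$ for almost every $x\in\mathbb R$. Finally, $\Sigma_{ac}(J)=\{x\in\mathbb R:\operatorname{Im}m_+(x)>0\text{ and }\operatorname{Im}m_-(x)>0\}$, defined up to sets of Lebesgue measure zero. *)

theory Defs
  imports "HOL-Analysis.Analysis" "HOL-Computational_Algebra.Polynomial"
begin

section \<open>Bounded Jacobi matrices on \<open>\<ell>\<^sup>2(\<int>)\<close>\<close>

datatype jacobi = Jacobi (coeff_a: "int \<Rightarrow> real") (coeff_b: "int \<Rightarrow> real")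

definition bounded_jacobi :: "jacobi \<Rightarrow> bool" where
  "bounded_jacobi J \<longleftrightarrow>
     (\<forall>n. coeff_a J n > 0) \<and> bounded (range (coeff_a J)) \<and> bounded (range (coeff_b J))"

text \<open>The difference expression acts on arbitrary two-sided sequences, because it is also needed
  for solutions that are square summable at one end only; for a bounded Jacobi matrix its
  restriction to \<open>ell2\<close> below is the operator on \<open>\<ell>\<^sup>2(\<int>)\<close>.\<close>

definition jacobi_op :: "jacobi \<Rightarrow> (int \<Rightarrow> complex) \<Rightarrow> int \<Rightarrow> complex" where
  "jacobi_op J u n =
     of_real (coeff_a J n) * u (n + 1) + of_real (coeff_a J (n - 1)) * u (n - 1)
       + of_real (coeff_b J n) * u n"

definition ell2 :: "(int \<Rightarrow> complex) set" where
  "ell2 = {u. (\<lambda>n. (cmod (u n))\<^sup>2) summable_on UNIV}"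

definition ell2_norm :: "(int \<Rightarrow> complex) \<Rightarrow> real" where
  "ell2_norm u = sqrt (\<Sum>\<^sub>\<infinity>n. (cmod (u n))\<^sup>2)"

definition ell2_inner :: "(int \<Rightarrow> complex) \<Rightarrow> (int \<Rightarrow> complex) \<Rightarrow> complex" where
  "ell2_inner u v = (\<Sum>\<^sub>\<infinity>n. cnj (u n) * v n)"

definition wot_tendsto :: "(nat \<Rightarrow> jacobi) \<Rightarrow> jacobi \<Rightarrow> bool" where
  "wot_tendsto Js J \<longleftrightarrow>
     (\<forall>u\<in>ell2. \<forall>v\<in>ell2.
        (\<lambda>n. ell2_inner u (jacobi_op (Js n) v)) \<longlonglongrightarrow> ell2_inner u (jacobi_op J v))"

definition shift :: "int \<Rightarrow> jacobi \<Rightarrow> jacobi" where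
  "shift k J = Jacobi (\<lambda>n. coeff_a J (n - k)) (\<lambda>n. coeff_b J (n - k))"


section \<open>The Toda hierarchy\<close>

definition poly_op :: "real poly \<Rightarrow> jacobi \<Rightarrow> (int \<Rightarrow> complex) \<Rightarrow> int \<Rightarrow> complex" where
  "poly_op p J u n = (\<Sum>i\<le>degree p. of_real (coeff p i) * (jacobi_op J ^^ i) u n)"

definition unit_seq :: "int \<Rightarrow> int \<Rightarrow> complex" where
  "unit_seq k n = (if n = k then 1 else 0)"

definition mat_entry :: "((int \<Rightarrow> complex) \<Rightarrow> int \<Rightarrow> complex) \<Rightarrow> int \<Rightarrow> int \<Rightarrow> complex" where
  "mat_entry X j k = X (unit_seq k) j"

definition antisym_entry :: "((int \<Rightarrow> complex) \<Rightarrow> int \<Rightarrow> complex) \<Rightarrow> int \<Rightarrow> int \<Rightarrow> complex" where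
  "antisym_entry X j k =
     (if j < k then mat_entry X j k else if j > k then - mat_entry X j k else 0)"

text \<open>For a banded operator \<open>X\<close>, the only case used, the following sum has finitely many
  nonzero terms.\<close>

definition antisym_part :: "((int \<Rightarrow> complex) \<Rightarrow> int \<Rightarrow> complex) \<Rightarrow> (int \<Rightarrow> complex) \<Rightarrow> int \<Rightarrow> complex" where
  "antisym_part X u j = (\<Sum>\<^sub>\<infinity>k. antisym_entry X j k * u k)"

definition commutator ::
  "((int \<Rightarrow> complex) \<Rightarrow> int \<Rightarrow> complex) \<Rightarrow> ((int \<Rightarrow> complex) \<Rightarrow> int \<Rightarrow> complex) \<Rightarrow>
     (int \<Rightarrow> complex) \<Rightarrow> int \<Rightarrow> complex" where
  "commutator X Y u n = X (Y u) n - Y (X u) n"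

definition op_norm_le :: "((int \<Rightarrow> complex) \<Rightarrow> int \<Rightarrow> complex) \<Rightarrow> real \<Rightarrow> bool" where
  "op_norm_le X c \<longleftrightarrow> (\<forall>u\<in>ell2. X u \<in> ell2 \<and> ell2_norm (X u) \<le> c * ell2_norm u)"

text \<open>A global solution of \<open>dJ/dt = [p(J)\<^sub>a, J]\<close> in the space of bounded Jacobi matrices; the
  derivative is the limit of the difference quotients in operator norm.\<close>

definition toda_solution :: "real poly \<Rightarrow> (real \<Rightarrow> jacobi) \<Rightarrow> bool" where
  "toda_solution p F \<longleftrightarrow>
     (\<forall>t. bounded_jacobi (F t)) \<and>
     (\<forall>t. \<forall>\<epsilon>>0. \<forall>\<^sub>F h in at 0.
        op_norm_le
          (\<lambda>u n. (jacobi_op (F (t + h)) u n - jacobi_op (F t) u n) / of_real h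
                  - commutator (antisym_part (poly_op p (F t))) (jacobi_op (F t)) u n) \<epsilon>)"

text \<open>The graph of the time \<open>t\<close> map. Global solutions exist and are unique for every bounded
  initial Jacobi matrix, so this relation is a total function.\<close>

definition toda_map :: "real poly \<Rightarrow> real \<Rightarrow> jacobi \<Rightarrow> jacobi \<Rightarrow> bool" where
  "toda_map p t J J' \<longleftrightarrow> (\<exists>F. toda_solution p F \<and> F 0 = J \<and> F t = J')"


section \<open>Half line \<open>m\<close> functions and absolutely continuous spectrum\<close>

definition eigen_solution :: "jacobi \<Rightarrow> complex \<Rightarrow> (int \<Rightarrow> complex) \<Rightarrow> bool" where
  "eigen_solution J z f \<longleftrightarrow> (\<exists>n. f n \<noteq> 0) \<and> (\<forall>n. jacobi_op J f n = z * f n)"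

text \<open>For \<open>Im z > 0\<close> and bounded \<open>J\<close> the solutions chosen below exist and are unique up to a
  factor, so that the quotients in \<open>m_plus\<close> and \<open>m_minus\<close> do not depend on the choice.\<close>

definition f_plus :: "jacobi \<Rightarrow> complex \<Rightarrow> int \<Rightarrow> complex" where
  "f_plus J z = (SOME f. eigen_solution J z f \<and> (\<lambda>n. (cmod (f n))\<^sup>2) summable_on {0..})"

definition f_minus :: "jacobi \<Rightarrow> complex \<Rightarrow> int \<Rightarrow> complex" where
  "f_minus J z = (SOME f. eigen_solution J z f \<and> (\<lambda>n. (cmod (f n))\<^sup>2) summable_on {..0})"

definition m_plus :: "jacobi \<Rightarrow> complex \<Rightarrow> complex" where
  "m_plus J z = - of_real (coeff_a J 0) * f_plus J z 1 / f_plus J z 0"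

definition m_minus :: "jacobi \<Rightarrow> complex \<Rightarrow> complex" where
  "m_minus J z = of_real (coeff_a J 0) * f_minus J z 1 / f_minus J z 0"

definition has_boundary_value :: "(complex \<Rightarrow> complex) \<Rightarrow> real \<Rightarrow> complex \<Rightarrow> bool" where
  "has_boundary_value m x w \<longleftrightarrow> ((\<lambda>y. m (Complex x y)) \<longlongrightarrow> w) (at_right 0)"

text \<open>Points at which one of the two limits does not exist form a null set; they are left out.\<close>

definition Sigma_ac :: "jacobi \<Rightarrow> real set" where
  "Sigma_ac J = {x. \<exists>wp wm. has_boundary_value (m_plus J) x wp \<and>
                      has_boundary_value (m_minus J) x wm \<and> Im wp > 0 \<and> Im wm > 0}"

end

theory Submission
  imports Defs "HOL-Complex_Analysis.Complex_Analysis" "HOL-Probability.Sinc_Integral" "HOL-Real_Asymp.Real_Asymp"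
begin

text \<open>At a boundary point \<open>x\<close> where both \<open>m\<close> functions have limits in the upper half plane,
  the determinant \<open>Im m_plus * Im m_minus / |m_plus + m_minus|^2\<close> of the imaginary part of the
  matrix \<open>m\<close> function is invariant under shifts and Toda flows: both change the vectors
  \<open>(f 1, f 0)\<close> of the Weyl solutions by a matrix that is real at \<open>z = x\<close>, and so the Wronskian of
  the two solutions and the Wronskian of each of them with its conjugate are multiplied by the same
  positive number. For the Toda flow the evolution of these vectors is read off from
  \<open>d/dt (J - z)^(-1) = [p(J)_a, (J - z)^(-1)]\<close>.

  The square root of the determinant of a positive \<open>2 \<times> 2\<close> matrix \<open>A\<close> is the infimum of
  \<open>tr (A B) / 2\<close> over the positive matrices \<open>B\<close> with determinant one. For fixed \<open>B\<close> the trace is a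
  positive harmonic function of \<open>z\<close>, hence at least the Poisson integral of its boundary values, and
  this lower bound survives pointwise limits of the \<open>m\<close> functions. So the points of the
  original set at which the determinant of the limit operator tends to zero form a null set. Fatou's theorem provides the
  boundary values of its \<open>m\<close> functions, and they are finite because \<open>log |m + i|\<close> is positive
  and harmonic.\<close>

text \<open>The limit argument needs one lower bound for all \<open>n\<close>, so at each
  \<open>x\<close> the invariant is followed with a fixed value \<open>c\<close>, and no null set is
  discarded at any step. An obstacle is that \<open>f_plus\<close> and \<open>f_minus\<close> are
  arbitrary choices at every \<open>z\<close> and every time, hence not differentiable. Resolvent
  columns are, and a column with far index is a multiple of a Weyl solution near the origin. The
  term \<open>p(J)_a G\<close> of the commutator then acts on \<open>(f 1, f 0)\<close> by a matrix
  that is polynomial in \<open>z\<close> and real for real \<open>z\<close>. The term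
  \<open>G p(J)_a\<close> becomes a scalar without known boundary behaviour, which the freedom of
  normalisation removes. Near the boundary the coefficients are only nearly real, so the Wronskians
  pick up their common factor up to null sequences. For this reason the vectors are kept bounded and
  their determinant is kept away from 0. Since \<open>m_minus\<close> grows like \<open>z\<close>,
  bounds on \<open>{z. Im z \<ge> e}\<close> exist for \<open>m_plus\<close>,
  \<open>1 / (m_plus + m_minus)\<close> and \<open>trace_m\<close>, while \<open>m_minus\<close> is
  reached through \<open>1 / (m_minus + \<i>)\<close>.\<close>

section \<open>Differentiation of Lipschitz functions\<close>

text \<open>The spheres of countably many balls form a null set, so the open balls cover as well.
  The open version matters in \<open>Dini_gap_null\<close>, where a second covering is placed inside
  the union of the first.\<close>

lemma Vitali_covering_fine_intervals:
  fixes E U :: "real set"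
  assumes fine: "\<And>x d. x \<in> E \<Longrightarrow> 0 < d \<Longrightarrow>
       \<exists>c r. 0 < r \<and> r < d \<and> x \<in> cball c r \<and> cball c r \<subseteq> U \<and> R c r"
  obtains C :: "(real \<times> real) set" where "countable C" "\<And>c r. (c, r) \<in> C \<Longrightarrow> 0 < r \<and> cball c r \<subseteq> U \<and> R c r"
    "disjoint_family_on (\<lambda>i. cball (fst i) (snd i)) C"
    "negligible (E - (\<Union>i\<in>C. cball (fst i) (snd i)))"
    "negligible (E - (\<Union>i\<in>C. ball (fst i) (snd i)))"
proof -
  define K where "K = {(c, r). 0 < r \<and> cball c r \<subseteq> U \<and> R c r}"
  obtain C where C: "countable C" "C \<subseteq> K"
    "pairwise (\<lambda>i j. disjnt (cball (fst i) (snd i)) (cball (fst j) (snd j))) C"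
    "negligible (E - (\<Union>i\<in>C. cball (fst i) (snd i)))"
  proof (rule Vitali_covering_theorem_cballs[of K snd E fst])
    show "\<And>i. i \<in> K \<Longrightarrow> 0 < snd i" by (auto simp: K_def)
    show "\<exists>i. i \<in> K \<and> x \<in> cball (fst i) (snd i) \<and> snd i < d" if "x \<in> E" "0 < d" for x d
      using fine[OF that] by (auto simp: K_def)
  qed blast
  have "negligible (\<Union>i\<in>C. sphere (fst i) (snd i))"
    using C(1) by (intro negligible_countable_Union) (auto simp: negligible_sphere)
  then have "negligible ((E - (\<Union>i\<in>C. cball (fst i) (snd i))) \<union> (\<Union>i\<in>C. sphere (fst i) (snd i)))"
    using C(4) by (rule negligible_Un[rotated])
  moreover have "E - (\<Union>i\<in>C. ball (fst i) (snd i)) \<subseteq>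
      (E - (\<Union>i\<in>C. cball (fst i) (snd i))) \<union> (\<Union>i\<in>C. sphere (fst i) (snd i))"
  proof
    fix x assume x: "x \<in> E - (\<Union>i\<in>C. ball (fst i) (snd i))"
    show "x \<in> (E - (\<Union>i\<in>C. cball (fst i) (snd i))) \<union> (\<Union>i\<in>C. sphere (fst i) (snd i))"
    proof (cases "\<exists>i\<in>C. x \<in> cball (fst i) (snd i)")
      case True
      then obtain i where "i \<in> C" "x \<in> cball (fst i) (snd i)" by blast
      with x have "x \<in> sphere (fst i) (snd i)" by (auto simp: not_less)
      with \<open>i \<in> C\<close> show ?thesis by blast
    next
      case False with x show ?thesis by blast
    qed
  qed
  ultimately have "negligible (E - (\<Union>i\<in>C. ball (fst i) (snd i)))"
    by (rule negligible_subset)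
  with C show thesis
    by (intro that[of C]) (auto simp: K_def disjoint_family_on_def pairwise_def disjnt_def)
qed

lemma negligible_emeasure_lborel_le:
  assumes "negligible (E - V)" "E \<in> sets borel" "V \<in> sets borel"
  shows "emeasure lborel E \<le> emeasure lborel (V :: real set)"
proof -
  have "emeasure lborel (E - V) = 0"
    using assms by (simp add: negligible_iff_emeasure0 emeasure_completion)
  have "emeasure lborel E \<le> emeasure lborel (V \<union> (E - V))"
    using assms by (intro emeasure_mono) auto
  also have "\<dots> \<le> emeasure lborel V + emeasure lborel (E - V)"
    using assms by (intro emeasure_subadditive) auto
  finally show ?thesis using \<open>emeasure lborel (E - V) = 0\<close> by simp
qed

text \<open>For fixed \<open>h\<close> the quotient is continuous in \<open>x\<close>, so each set
  is a union of open sets. This makes the Dini sets Borel although \<open>h\<close> ranges over an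
  uncountable set.\<close>

lemma open_difference_quotient:
  fixes f :: "real \<Rightarrow> real"
  assumes "continuous_on UNIV f"
  shows "open {x. \<exists>h. h \<noteq> 0 \<and> \<bar>h\<bar> < d \<and> (f (x + h) - f x) / h > q}"
    and "open {x. \<exists>h. h \<noteq> 0 \<and> \<bar>h\<bar> < d \<and> (f (x + h) - f x) / h < q}"
proof -
  have c: "continuous_on UNIV (\<lambda>x. (f (x + h) - f x) / h)" if "h \<noteq> 0" for h
    using that by (intro continuous_intros continuous_on_compose2[OF assms]) auto
  have "{x. \<exists>h. h \<noteq> 0 \<and> \<bar>h\<bar> < d \<and> (f (x + h) - f x) / h > q} =
      (\<Union>h\<in>{h. h \<noteq> 0 \<and> \<bar>h\<bar> < d}. {x. (f (x + h) - f x) / h > q})" by auto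
  then show "open {x. \<exists>h. h \<noteq> 0 \<and> \<bar>h\<bar> < d \<and> (f (x + h) - f x) / h > q}"
    using c by (auto intro!: open_UN open_Collect_less simp: continuous_on_const)
  have "{x. \<exists>h. h \<noteq> 0 \<and> \<bar>h\<bar> < d \<and> (f (x + h) - f x) / h < q} =
      (\<Union>h\<in>{h. h \<noteq> 0 \<and> \<bar>h\<bar> < d}. {x. (f (x + h) - f x) / h < q})" by auto
  then show "open {x. \<exists>h. h \<noteq> 0 \<and> \<bar>h\<bar> < d \<and> (f (x + h) - f x) / h < q}"
    using c by (auto intro!: open_UN open_Collect_less simp: continuous_on_const)
qed

text \<open>\<open>c\<close> is the midpoint of \<open>x\<close> and \<open>x + h\<close>, and
  \<open>r\<close> is half of \<open>|h|\<close>. Since \<open>x\<close> is an endpoint of this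
  interval, the covering lemma asks for \<open>x \<in> cball c r\<close> and not for balls centred
  at \<open>x\<close>.\<close>

lemma interval_with_difference_quotient:
  fixes f :: "real \<Rightarrow> real"
  assumes "h \<noteq> 0" "\<bar>h\<bar> < d" "\<bar>h\<bar> < d'" "cball x d' \<subseteq> U"
  obtains c r where "0 < r" "r < d" "x \<in> cball c r" "cball c r \<subseteq> U"
    "(f (c + r) - f (c - r)) / (2 * r) = (f (x + h) - f x) / h"
proof
  show "(f ((x + h/2) + \<bar>h\<bar>/2) - f ((x + h/2) - \<bar>h\<bar>/2)) / (2 * (\<bar>h\<bar>/2)) = (f (x + h) - f x) / h"
  proof (cases "h > 0")
    case True
    then have "(x + h/2) + \<bar>h\<bar>/2 = x + h" "(x + h/2) - \<bar>h\<bar>/2 = x" "2 * (\<bar>h\<bar>/2) = h" by (auto simp: field_simps)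
    then show ?thesis by metis
  next
    case False
    then have "(x + h/2) + \<bar>h\<bar>/2 = x" "(x + h/2) - \<bar>h\<bar>/2 = x + h" "2 * (\<bar>h\<bar>/2) = - h" 
      using assms by (auto simp: field_simps)
    then show ?thesis
      by (metis minus_diff_eq minus_divide_left minus_divide_right)
  qed
  show "x \<in> cball (x + h/2) (\<bar>h\<bar>/2)" by (auto simp: dist_real_def)
  have "cball (x + h/2) (\<bar>h\<bar>/2) \<subseteq> cball x d'"
    using assms by (auto simp: dist_real_def abs_if field_simps split: if_splits)
  then show "cball (x + h/2) (\<bar>h\<bar>/2) \<subseteq> U" using assms by blast
qed (use assms in auto)

text \<open>Lebesgue's argument with the Stieltjes measure \<open>\<mu>\<close> of \<open>f\<close>.
  Intervals of slope below \<open>p\<close>, inside an open set of measure at most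
  \<open>|E| + e\<close>, have a union \<open>V\<close> with
  \<open>\<mu> V \<le> p (|E| + e)\<close> that covers almost all of \<open>E\<close>. Intervals of
  slope above \<open>q\<close> inside \<open>V\<close> cover almost all of \<open>E\<close> again,
  so \<open>q |E| \<le> \<mu> V\<close>. As \<open>e\<close> tends to 0, only \<open>|E| = 0\<close>
  is left.\<close>

lemma Dini_gap_null:
  fixes f :: "real \<Rightarrow> real"
  assumes mono: "\<And>x y. x \<le> y \<Longrightarrow> f x \<le> f y" and cont: "continuous_on UNIV f"
    and pq: "0 \<le> p" "p < q"
    and E: "E \<in> sets borel" "bounded E"
    and up: "\<And>x d. x \<in> E \<Longrightarrow> 0 < d \<Longrightarrow> \<exists>h. h \<noteq> 0 \<and> \<bar>h\<bar> < d \<and> (f (x + h) - f x) / h > q"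
    and lo: "\<And>x d. x \<in> E \<Longrightarrow> 0 < d \<Longrightarrow> \<exists>h. h \<noteq> 0 \<and> \<bar>h\<bar> < d \<and> (f (x + h) - f x) / h < p"
  shows "emeasure lborel E = 0"
proof -
  define \<mu> where "\<mu> = interval_measure f"
  have rc: "continuous (at_right a) f" for a
    using cont by (simp add: continuous_on_eq_continuous_within continuous_at_imp_continuous_within)
  have muI: "emeasure \<mu> {a<..b} = ennreal (f b - f a)" if "a \<le> b" for a b
    unfolding \<mu>_def using that mono rc by (rule emeasure_interval_measure_Ioc) 
  have sm[measurable_cong, simp]: "sets \<mu> = sets borel" by (simp add: \<mu>_def)
  have fin: "emeasure lborel E < \<infinity>"
    using emeasure_bounded_finite[OF E(2)] by simp
  have key: "ennreal q * emeasure lborel E \<le> ennreal p * (emeasure lborel E + ennreal e)" if "e > 0" for e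
  proof -
    have El: "E \<in> sets lebesgue" using E by simp
    obtain U where U: "open U" "E \<subseteq> U" "(U - E) \<in> lmeasurable" "emeasure lebesgue (U - E) < ennreal e"
      using sets_lebesgue_outer_open[OF El \<open>e > 0\<close>] by blast
    have lU: "emeasure lborel U \<le> emeasure lborel E + ennreal e"
    proof -
      have "emeasure lborel U = emeasure lborel (E \<union> (U - E))" using U(2) by (simp add: Un_absorb1)
      also have "\<dots> \<le> emeasure lborel E + emeasure lborel (U - E)"
        using E U(1) by (intro emeasure_subadditive) auto
      also have "emeasure lborel (U - E) = emeasure lebesgue (U - E)"
        using E U(1) by (simp add: emeasure_completion)
      finally show ?thesis using U(4) by (meson add_left_mono less_imp_le order_trans)
    qed
    obtain C where C: "countable C" "\<And>c r. (c, r) \<in> C \<Longrightarrow> 0 < r \<and> cball c r \<subseteq> U \<and> (f (c + r) - f (c - r)) / (2*r) < p"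
      "disjoint_family_on (\<lambda>i. cball (fst i) (snd i)) C"
      "negligible (E - (\<Union>i\<in>C. ball (fst i) (snd i)))"
    proof (rule Vitali_covering_fine_intervals[of E U "\<lambda>c r. (f (c + r) - f (c - r)) / (2*r) < p"])
      fix x d :: real assume x: "x \<in> E" "0 < d"
      then obtain d' where d': "d' > 0" "cball x d' \<subseteq> U" using U open_contains_cball by blast
      obtain h where h: "h \<noteq> 0" "\<bar>h\<bar> < min d d'" "(f (x + h) - f x) / h < p"
        using lo[of x "min d d'"] x d' by auto
      have hd: "\<bar>h\<bar> < d" "\<bar>h\<bar> < d'" using h(2) by auto
      obtain c r where "0 < r" "r < d" "x \<in> cball c r" "cball c r \<subseteq> U"
        "(f (c + r) - f (c - r)) / (2 * r) = (f (x + h) - f x) / h"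
        using interval_with_difference_quotient[OF h(1) hd d'(2), of f] by blast
      with h show "\<exists>c r. 0 < r \<and> r < d \<and> x \<in> cball c r \<and> cball c r \<subseteq> U \<and> (f (c + r) - f (c - r)) / (2*r) < p"
        by (intro exI[of _ c] exI[of _ r]) simp
    qed (rule that; blast)
    define V where "V = (\<Union>i\<in>C. ball (fst i) (snd i))"
    have dB: "disjoint_family_on (\<lambda>i. ball (fst i) (snd i)) C"
      unfolding disjoint_family_on_def
    proof (intro ballI impI)
      fix i j assume "i \<in> C" "j \<in> C" "i \<noteq> j"
      then have "cball (fst i) (snd i) \<inter> cball (fst j) (snd j) = {}"
        using C(3) unfolding disjoint_family_on_def by blast
      then show "ball (fst i) (snd i) \<inter> ball (fst j) (snd j) = {}"
        using ball_subset_cball by blast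
    qed
    have oV: "open V" unfolding V_def by auto
    have VU: "V \<subseteq> U" unfolding V_def
    proof (rule UN_least)
      fix i assume "i \<in> C"
      then show "ball (fst i) (snd i) \<subseteq> U"
        using C(2)[of "fst i" "snd i"] ball_subset_cball[of "fst i" "snd i"] by auto
    qed
    have "emeasure \<mu> V = (\<integral>\<^sup>+i. emeasure \<mu> (ball (fst i) (snd i)) \<partial>count_space C)"
      unfolding V_def by (intro emeasure_UN_countable dB C(1)) auto
    also have "\<dots> \<le> (\<integral>\<^sup>+i. ennreal p * emeasure lborel (ball (fst i) (snd i)) \<partial>count_space C)"
    proof (rule nn_integral_mono)
      fix i assume "i \<in> space (count_space C)"
      then obtain c r where i: "i = (c, r)" "(c, r) \<in> C" by (cases i) auto
      note c = C(2)[OF i(2)]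
      \<comment> \<open>The half-open interval, whose measure is an increment of \<open>f\<close>,
        lies between the open and the closed ball. Hence open balls serve the upper estimate and
        closed balls the lower one.\<close>
      have "emeasure \<mu> (ball c r) \<le> emeasure \<mu> {c - r<..c + r}"
        by (intro emeasure_mono) (auto simp: dist_real_def)
      also have "\<dots> = ennreal (f (c + r) - f (c - r))" using c by (intro muI) auto
      also have "\<dots> \<le> ennreal (p * (2 * r))"
        using c by (intro ennreal_leI) (auto simp: field_simps)
      also have "\<dots> = ennreal p * emeasure lborel (ball c r)"
        using c pq by (simp add: ball_eq_greaterThanLessThan ennreal_mult)
      finally show "emeasure \<mu> (ball (fst i) (snd i)) \<le> ennreal p * emeasure lborel (ball (fst i) (snd i))"
        using i by simp
    qed
    also have "\<dots> = ennreal p * (\<integral>\<^sup>+i. emeasure lborel (ball (fst i) (snd i)) \<partial>count_space C)"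
      by (rule nn_integral_cmult) simp
    also have "(\<integral>\<^sup>+i. emeasure lborel (ball (fst i) (snd i)) \<partial>count_space C) = emeasure lborel V"
      unfolding V_def by (intro emeasure_UN_countable[symmetric] dB C(1)) auto
    also have "ennreal p * emeasure lborel V \<le> ennreal p * (emeasure lborel E + ennreal e)"
      using emeasure_mono[OF VU, of lborel] U(1) lU by (intro mult_left_mono) auto
    finally have mV: "emeasure \<mu> V \<le> ennreal p * (emeasure lborel E + ennreal e)" .
    obtain C2 where C2: "countable C2" "\<And>c r. (c, r) \<in> C2 \<Longrightarrow> 0 < r \<and> cball c r \<subseteq> V \<and> (f (c + r) - f (c - r)) / (2*r) > q"
      "disjoint_family_on (\<lambda>i. cball (fst i) (snd i)) C2"
      "negligible (E \<inter> V - (\<Union>i\<in>C2. cball (fst i) (snd i)))"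
    proof (rule Vitali_covering_fine_intervals[of "E \<inter> V" V "\<lambda>c r. (f (c + r) - f (c - r)) / (2*r) > q"])
      fix x d :: real assume x: "x \<in> E \<inter> V" "0 < d"
      then obtain d' where d': "d' > 0" "cball x d' \<subseteq> V" using oV open_contains_cball by blast
      obtain h where h: "h \<noteq> 0" "\<bar>h\<bar> < min d d'" "(f (x + h) - f x) / h > q"
        using up[of x "min d d'"] x d' by auto
      have hd: "\<bar>h\<bar> < d" "\<bar>h\<bar> < d'" using h(2) by auto
      obtain c r where "0 < r" "r < d" "x \<in> cball c r" "cball c r \<subseteq> V"
        "(f (c + r) - f (c - r)) / (2 * r) = (f (x + h) - f x) / h"
        using interval_with_difference_quotient[OF h(1) hd d'(2), of f] by blast
      with h show "\<exists>c r. 0 < r \<and> r < d \<and> x \<in> cball c r \<and> cball c r \<subseteq> V \<and> (f (c + r) - f (c - r)) / (2*r) > q"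
        by (intro exI[of _ c] exI[of _ r]) simp
    qed (rule that; blast)
    define W where "W = (\<Union>i\<in>C2. cball (fst i) (snd i))"
    have bW: "W \<in> sets borel" unfolding W_def using C2(1) by (intro sets.countable_UN') auto
    have "negligible ((E - V) \<union> (E \<inter> V - W))" using C(4) C2(4) unfolding V_def W_def by (rule negligible_Un)
    then have "negligible (E - W)" by (rule negligible_subset) auto
    then have "emeasure lborel E \<le> emeasure lborel W" using E bW by (intro negligible_emeasure_lborel_le)
    also have "\<dots> = (\<integral>\<^sup>+i. emeasure lborel (cball (fst i) (snd i)) \<partial>count_space C2)"
      unfolding W_def using C2(1,3) by (intro emeasure_UN_countable) auto
    finally have "ennreal q * emeasure lborel E \<le> ennreal q * (\<integral>\<^sup>+i. emeasure lborel (cball (fst i) (snd i)) \<partial>count_space C2)"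
      by (rule mult_left_mono) simp
    also have "\<dots> = (\<integral>\<^sup>+i. ennreal q * emeasure lborel (cball (fst i) (snd i)) \<partial>count_space C2)"
      by (rule nn_integral_cmult[symmetric]) simp
    also have "\<dots> \<le> (\<integral>\<^sup>+i. emeasure \<mu> (cball (fst i) (snd i)) \<partial>count_space C2)"
    proof (rule nn_integral_mono)
      fix i assume "i \<in> space (count_space C2)"
      then obtain c r where i: "i = (c, r)" "(c, r) \<in> C2" by (cases i) auto
      note c = C2(2)[OF i(2)]
      have "ennreal q * emeasure lborel (cball c r) = ennreal (q * (2 * r))"
        using c pq by (simp add: cball_eq_atLeastAtMost ennreal_mult)
      also have "\<dots> \<le> ennreal (f (c + r) - f (c - r))"
        using c by (intro ennreal_leI) (auto simp: field_simps)
      also have "\<dots> = emeasure \<mu> {c - r<..c + r}" using c by (intro muI[symmetric]) auto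
      also have "\<dots> \<le> emeasure \<mu> (cball c r)"
        by (intro emeasure_mono) (auto simp: dist_real_def)
      finally show "ennreal q * emeasure lborel (cball (fst i) (snd i)) \<le> emeasure \<mu> (cball (fst i) (snd i))"
        using i by simp
    qed
    also have "\<dots> = emeasure \<mu> W"
      unfolding W_def using C2(1,3) by (intro emeasure_UN_countable[symmetric]) auto
    finally have qE: "ennreal q * emeasure lborel E \<le> emeasure \<mu> W" .
    have "W \<subseteq> V" unfolding W_def
    proof (rule UN_least)
      fix i assume "i \<in> C2"
      then show "cball (fst i) (snd i) \<subseteq> V" using C2(2)[of "fst i" "snd i"] by auto
    qed
    then have "emeasure \<mu> W \<le> emeasure \<mu> V"
      using oV by (intro emeasure_mono) auto
    with qE mV show ?thesis by (meson order_trans)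
  qed
  obtain s where s: "emeasure lborel E = ennreal s" "s \<ge> 0"
    using fin by (cases "emeasure lborel E") auto
  have "q * s \<le> p * (s + e)" if "e > 0" for e
    using key[OF that] that pq s by (simp add: ennreal_mult[symmetric] ennreal_plus[symmetric] del: ennreal_plus)
  then have *: "q * s \<le> p * s + p * e" if "e > 0" for e using that by (simp add: algebra_simps)
  have "q * s \<le> p * s"
  proof (cases "p = 0")
    case True then show ?thesis using *[of 1] by simp
  next
    case False
    then have "p > 0" using pq by simp
    show ?thesis
    proof (rule field_le_epsilon)
      fix e :: real assume "e > 0"
      then show "q * s \<le> p * s + e" using *[of "e/p"] \<open>p > 0\<close> by simp
    qed
  qed
  then have "s = 0" using pq s by (metis antisym_conv3 mult_strict_right_mono not_le order_le_less)
  then show ?thesis using s by simp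
qed

text \<open>If the lower and the upper limit of the difference quotient differ, two rationals lie
  strictly between them and put \<open>x\<close> into one of countably many sets covered by
  \<open>Dini_gap_null\<close>. The Lipschitz bound keeps both limits finite.\<close>

lemma mono_Lipschitz_differentiable_AE:
  fixes f :: "real \<Rightarrow> real"
  assumes mono: "\<And>x y. x \<le> y \<Longrightarrow> f x \<le> f y" and lip: "\<And>x y. x \<le> y \<Longrightarrow> f y - f x \<le> C * (y - x)"
  shows "AE x in lborel. \<exists>D. (f has_real_derivative D) (at x)"
proof -
  have "\<bar>f x - f y\<bar> \<le> C * \<bar>x - y\<bar>" for x y
    using mono[of x y] mono[of y x] lip[of x y] lip[of y x] by (cases "x \<le> y") (auto simp: abs_if)
  moreover have "0 \<le> C" using mono[of 0 1] lip[of 0 1] by simp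
  ultimately have "C-lipschitz_on UNIV f" by (intro lipschitz_onI) (auto simp: dist_real_def)
  then have cont: "continuous_on UNIV f" by (rule lipschitz_on_continuous_on)
  have slope: "0 \<le> (f (x + h) - f x) / h \<and> (f (x + h) - f x) / h \<le> C" if "h \<noteq> 0" for x h
    using that mono[of x "x+h"] mono[of "x+h" x] lip[of x "x+h"] lip[of "x+h" x]
    by (cases "h > 0") (auto simp: field_simps)
  define U where "U q d = {x. \<exists>h. h \<noteq> 0 \<and> \<bar>h\<bar> < d \<and> (f (x + h) - f x) / h > q}" for q d
  define L where "L q d = {x. \<exists>h. h \<noteq> 0 \<and> \<bar>h\<bar> < d \<and> (f (x + h) - f x) / h < q}" for q d
  have op: "open (U q d)" "open (L q d)" for q d
    unfolding U_def L_def using open_difference_quotient[OF cont] by auto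
  define E where "E p q N = (\<Inter>k. U q (1 / real (Suc k)) \<inter> L p (1 / real (Suc k))) \<inter> {- real N..real N}" for p q N
  have null: "E p q N \<in> null_sets lborel" if "0 \<le> p" "p < q" for p q N
  proof -
    have "E p q N \<in> sets borel" unfolding E_def using op by (intro sets.Int sets.countable_INT) auto
    moreover have "emeasure lborel (E p q N) = 0"
    proof (rule Dini_gap_null[OF mono cont that])
      show "E p q N \<in> sets borel" by fact
      show "bounded (E p q N)" unfolding E_def by (meson bounded_Int bounded_closed_interval)
      show "\<exists>h. h \<noteq> 0 \<and> \<bar>h\<bar> < d \<and> (f (x + h) - f x) / h > q" if "x \<in> E p q N" "0 < d" for x d
      proof -
        obtain k where "1 / real (Suc k) < d" using nat_approx_posE[OF \<open>0 < d\<close>] by blast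
        moreover have "x \<in> U q (1 / real (Suc k))" using that unfolding E_def by blast
        ultimately show ?thesis unfolding U_def by force
      qed
      show "\<exists>h. h \<noteq> 0 \<and> \<bar>h\<bar> < d \<and> (f (x + h) - f x) / h < p" if "x \<in> E p q N" "0 < d" for x d
      proof -
        obtain k where "1 / real (Suc k) < d" using nat_approx_posE[OF \<open>0 < d\<close>] by blast
        moreover have "x \<in> L p (1 / real (Suc k))" using that unfolding E_def by blast
        ultimately show ?thesis unfolding L_def by force
      qed
    qed
    ultimately show ?thesis by auto
  qed
  have "AE x in lborel. \<forall>N. \<forall>p\<in>\<rat>. \<forall>q\<in>\<rat>. 0 \<le> p \<and> p < q \<longrightarrow> x \<notin> E p q N"
    unfolding AE_all_countable AE_ball_countable[OF countable_rat]
    using null by (auto intro!: AE_not_in)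
  then show ?thesis
  proof (rule AE_mp, intro AE_I2 impI)
    fix x assume x: "\<forall>N. \<forall>p\<in>\<rat>. \<forall>q\<in>\<rat>. 0 \<le> p \<and> p < q \<longrightarrow> x \<notin> E p q N"
    define g where "g h = ereal ((f (x + h) - f x) / h)" for h
    have ne: "at (0::real) \<noteq> bot" by simp
    have ev0: "\<forall>\<^sub>F h in at (0::real). h \<noteq> 0" by (simp add: eventually_at_filter)
    have gb: "\<forall>\<^sub>F h in at 0. 0 \<le> g h \<and> g h \<le> ereal C"
      using ev0 by eventually_elim (use slope in \<open>auto simp: g_def\<close>)
    have l0: "0 \<le> Liminf (at 0) g"
      by (rule Liminf_bounded) (use gb in \<open>auto elim: eventually_mono\<close>)
    have lC: "Limsup (at 0) g \<le> ereal C"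
      by (rule Limsup_bounded) (use gb in \<open>auto elim: eventually_mono\<close>)
    have ll: "Liminf (at 0) g \<le> Limsup (at 0) g" by (rule Liminf_le_Limsup[OF ne])
    have "Liminf (at 0) g = Limsup (at 0) g"
    proof (rule ccontr)
      assume "Liminf (at 0) g \<noteq> Limsup (at 0) g"
      with ll have lt: "Liminf (at 0) g < Limsup (at 0) g" by simp
      have f1: "\<bar>Liminf (at 0) g\<bar> \<noteq> \<infinity>" "\<bar>Limsup (at 0) g\<bar> \<noteq> \<infinity>"
        using l0 lC ll by (auto simp: abs_eq_infinity_cases)
      obtain l u where lu: "Liminf (at 0) g = ereal l" "Limsup (at 0) g = ereal u"
        using f1 by (metis ereal_real)
      with lt have "l < u" "0 \<le> l" using l0 by auto
      obtain p where p: "p \<in> \<rat>" "l < p" "p < u" using Rats_dense_in_real[OF \<open>l < u\<close>] by blast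
      obtain q where q: "q \<in> \<rat>" "p < q" "q < u" using Rats_dense_in_real[OF \<open>p < u\<close>] by blast
      have a: "\<exists>h. h \<noteq> 0 \<and> \<bar>h\<bar> < d \<and> (f (x + h) - f x) / h > q" if "d > 0" for d
      proof (rule ccontr)
        assume n: "\<not> ?thesis"
        have "\<forall>\<^sub>F h in at 0. g h \<le> ereal q"
          unfolding eventually_at using n \<open>d > 0\<close> by (intro exI[of _ d]) (auto simp: g_def dist_real_def not_less)
        then have "Limsup (at 0) g \<le> ereal q" by (rule Limsup_bounded)
        with lu q show False by simp
      qed
      have b: "\<exists>h. h \<noteq> 0 \<and> \<bar>h\<bar> < d \<and> (f (x + h) - f x) / h < p" if "d > 0" for d
      proof (rule ccontr)
        assume n: "\<not> ?thesis"
        have "\<forall>\<^sub>F h in at 0. ereal p \<le> g h"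
          unfolding eventually_at using n \<open>d > 0\<close> by (intro exI[of _ d]) (auto simp: g_def dist_real_def not_less)
        then have "ereal p \<le> Liminf (at 0) g" by (rule Liminf_bounded)
        with lu p show False by simp
      qed
      obtain N where "\<bar>x\<bar> \<le> real N" using real_arch_simple by blast
      then have "x \<in> E p q N" unfolding E_def U_def L_def using a b by auto
      then show False using x p q \<open>0 \<le> l\<close> by force
    qed
    then have lim: "(g \<longlongrightarrow> Liminf (at 0) g) (at 0)" using ne by (intro Liminf_eq_Limsup) auto
    have "\<bar>Liminf (at 0) g\<bar> \<noteq> \<infinity>" using l0 lC ll by (auto simp: abs_eq_infinity_cases)
    then obtain D where "Liminf (at 0) g = ereal D" by (metis ereal_real)
    with lim have "((\<lambda>h. (f (x + h) - f x) / h) \<longlongrightarrow> D) (at 0)" unfolding g_def by simp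
    then show "\<exists>D. (f has_real_derivative D) (at x)" unfolding DERIV_def by blast
  qed
qed

text \<open>Adding \<open>C * x\<close> makes the real and the imaginary part increasing, at the
  price of the Lipschitz constant \<open>2 * C\<close>.\<close>

lemma Lipschitz_differentiable_AE:
  fixes G :: "real \<Rightarrow> complex"
  assumes lip: "\<And>x y. norm (G x - G y) \<le> C * \<bar>x - y\<bar>"
  shows "AE x in lborel. \<exists>D. (G has_vector_derivative D) (at x)"
proof -
  have real: "AE x in lborel. \<exists>D. (f has_real_derivative D) (at x)"
    if f: "\<And>x y. \<bar>f x - f y\<bar> \<le> C * \<bar>x - y\<bar>" for f :: "real \<Rightarrow> real"
  proof -
    have "AE x in lborel. \<exists>D. ((\<lambda>x. f x + C * x) has_real_derivative D) (at x)"
    proof (rule mono_Lipschitz_differentiable_AE[where C = "2*C"])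
      fix x y :: real assume "x \<le> y"
      then show "f x + C * x \<le> f y + C * y" "f y + C * y - (f x + C * x) \<le> 2 * C * (y - x)"
        using f[of x y] by (auto simp: abs_if algebra_simps split: if_splits)
    qed
    then show ?thesis
    proof (rule AE_mp, intro AE_I2 impI)
      fix x assume "\<exists>D. ((\<lambda>x. f x + C * x) has_real_derivative D) (at x)"
      then obtain D where D: "((\<lambda>x. f x + C * x) has_real_derivative D) (at x)" by blast
      have "((\<lambda>x. (f x + C * x) - C * x) has_real_derivative D - C) (at x)"
        by (rule DERIV_diff[OF D]) (auto intro!: derivative_eq_intros)
      then show "\<exists>D. (f has_real_derivative D) (at x)" by auto
    qed
  qed
  have "AE x in lborel. \<exists>D. ((\<lambda>x. Re (G x)) has_real_derivative D) (at x)"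
    by (rule real) (metis abs_Re_le_cmod lip minus_complex.simps(1) order_trans)
  moreover have "AE x in lborel. \<exists>D. ((\<lambda>x. Im (G x)) has_real_derivative D) (at x)"
    by (rule real) (metis abs_Im_le_cmod lip minus_complex.simps(2) order_trans)
  ultimately show ?thesis
  proof eventually_elim
    case (elim x)
    then obtain D1 D2 where "((\<lambda>x. Re (G x)) has_real_derivative D1) (at x)"
      "((\<lambda>x. Im (G x)) has_real_derivative D2) (at x)" by blast
    then have "(G has_vector_derivative Complex D1 D2) (at x)"
      by (simp add: has_vector_derivative_complex_iff)
    then show ?case by blast
  qed
qed

section \<open>The Poisson kernel of the upper half plane\<close>

definition poisson :: "real \<Rightarrow> real \<Rightarrow> real" where
  "poisson y s = y / (pi * (s\<^sup>2 + y\<^sup>2))"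

lemma poisson_pos: "0 < y \<Longrightarrow> 0 < poisson y s"
  unfolding poisson_def by (intro divide_pos_pos mult_pos_pos add_nonneg_pos) auto

lemma poisson_measurable [measurable]: "poisson y \<in> borel_measurable borel"
  unfolding poisson_def by measurable

lemma poisson_scale: "0 < y \<Longrightarrow> poisson y (y * v) = poisson 1 v / y"
proof -
  assume y: "0 < y"
  have "pi * ((y * v)\<^sup>2 + y\<^sup>2) = y * (y * (pi * (v\<^sup>2 + 1\<^sup>2)))"
    by (simp add: power2_eq_square algebra_simps)
  then show ?thesis unfolding poisson_def using y by simp
qed

lemma has_bochner_integral_poisson_1: "has_bochner_integral lborel (poisson 1) 1"
proof -
  have 1: "integrable lborel (\<lambda>x::real. inverse (1 + x\<^sup>2))"
    using integrable_inverse_1_plus_square by (simp add: set_integrable_def einterval_def)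
  have 2: "(\<integral>x. inverse (1 + x\<^sup>2) \<partial>lborel) = pi"
    using LBINT_inverse_1_plus_square by (simp add: interval_lebesgue_integral_def set_lebesgue_integral_def einterval_def)
  have "has_bochner_integral lborel (\<lambda>x::real. (1/pi) * inverse (1 + x\<^sup>2)) ((1/pi) * pi)"
    using 1 2 by (intro has_bochner_integral_mult_right) (auto simp: has_bochner_integral_iff)
  then show ?thesis unfolding poisson_def by (simp add: field_simps)
qed

lemma has_bochner_integral_poisson:
  assumes "0 < y" shows "has_bochner_integral lborel (\<lambda>s. poisson y (s - x)) 1"
proof -
  have "has_bochner_integral lborel (\<lambda>s. poisson y (s - x)) (y *\<^sub>R (1 / y))
     \<longleftrightarrow> has_bochner_integral lborel (\<lambda>v. poisson y ((x + y * v) - x)) ((y *\<^sub>R (1/y)) /\<^sub>R \<bar>y\<bar>)"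
    using assms by (intro lborel_has_bochner_integral_real_affine_iff) auto
  moreover have "has_bochner_integral lborel (\<lambda>v. poisson 1 v * (1/y)) (1 * (1/y))"
    using has_bochner_integral_poisson_1 by (intro has_bochner_integral_mult_left)
  ultimately show ?thesis using assms by (simp add: poisson_scale inverse_eq_divide)
qed

lemma integrable_poisson: "0 < y \<Longrightarrow> integrable lborel (\<lambda>s. poisson y (s - x))"
  using has_bochner_integral_poisson has_bochner_integral_iff by blast

text \<open>As \<open>f\<close> is integrable, its integral is the limit over the symmetric
  intervals. So the boundary terms enter only through one difference, and \<open>F\<close> may lack
  limits at the two ends.\<close>

lemma integral_total_derivative_eq_0:
  fixes f F :: "real \<Rightarrow> complex"
  assumes int: "integrable lborel f" and cont: "continuous_on UNIV f"
    and der: "\<And>s. (F has_vector_derivative f s) (at s)"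
    and lim: "(\<lambda>n. F (real n) - F (- real n)) \<longlonglongrightarrow> 0"
  shows "(\<integral>s. f s \<partial>lborel) = 0"
proof -
  have "(\<lambda>n. \<integral>s. indicator {- real n..real n} s *\<^sub>R f s \<partial>lborel) \<longlonglongrightarrow> (\<integral>s. f s \<partial>lborel)"
  proof (rule integral_dominated_convergence[where w = "\<lambda>s. norm (f s)"])
    show "f \<in> borel_measurable lborel" using int by auto
    show "\<And>n. (\<lambda>s. indicator {- real n..real n} s *\<^sub>R f s) \<in> borel_measurable lborel"
      using int by auto
    show "integrable lborel (\<lambda>s. norm (f s))" using int by simp
    show "AE x in lborel. (\<lambda>n. indicator {- real n..real n} x *\<^sub>R f x) \<longlonglongrightarrow> f x"
    proof (rule AE_I2)
      fix x :: real
      obtain N where "\<bar>x\<bar> \<le> real N" using real_arch_simple by blast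
      then have "eventually (\<lambda>n. indicator {- real n..real n} x *\<^sub>R f x = f x) sequentially"
        unfolding eventually_sequentially by (intro exI[of _ N]) (auto simp: indicator_def)
      then show "(\<lambda>n. indicator {- real n..real n} x *\<^sub>R f x) \<longlonglongrightarrow> f x"
        by (rule tendsto_eventually)
    qed
    show "\<And>n. AE x in lborel. norm (indicator {- real n..real n} x *\<^sub>R f x) \<le> norm (f x)"
      by (auto simp: indicator_def)
  qed
  moreover have "(\<integral>s. indicator {- real n..real n} s *\<^sub>R f s \<partial>lborel) = F (real n) - F (- real n)" for n
    using cont der by (intro integral_FTC_Icc)
      (auto intro: continuous_on_subset has_vector_derivative_at_within)
  ultimately show ?thesis using lim LIMSEQ_unique by force
qed

text \<open>Three sides of a rectangle, of total length \<open>4 * R\<close>, on which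
  \<open>|w| \<ge> R\<close>. With a primitive at hand, the mean value inequality on each side
  replaces a contour integral; for quadratically decaying \<open>g\<close> the bound tends to
  0.\<close>

lemma three_segment_bound:
  assumes der: "\<And>w. Im w \<ge> 0 \<Longrightarrow> (\<Gamma> has_field_derivative g w) (at w)"
    and bound: "\<And>w. Im w \<ge> 0 \<Longrightarrow> R \<le> norm w \<Longrightarrow> norm (g w) \<le> B" and "R > 0"
  shows "norm (\<Gamma> (of_real R) - \<Gamma> (- of_real R)) \<le> 4 * R * B"
proof -
  have seg: "norm (\<Gamma> b - \<Gamma> a) \<le> B * norm (b - a)" if "\<And>w. w \<in> closed_segment a b \<Longrightarrow> Im w \<ge> 0 \<and> R \<le> norm w" for a b
    using that der bound
    by (intro field_differentiable_bound[where S = "closed_segment a b" and f' = g])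
       (auto intro: has_field_derivative_at_within)
  have s1: "Im w \<ge> 0 \<and> R \<le> norm w" if "w \<in> closed_segment (of_real R) (Complex R R)" for w
  proof -
    have "Re w = R" "0 \<le> Im w" using that \<open>R > 0\<close>
      by (auto simp: closed_segment_same_Re closed_segment_eq_real_ivl)
    then show ?thesis using abs_Re_le_cmod[of w] by auto
  qed
  have s2: "Im w \<ge> 0 \<and> R \<le> norm w" if "w \<in> closed_segment (Complex R R) (Complex (-R) R)" for w
  proof -
    have "Im w = R" using that \<open>R > 0\<close>
      by (auto simp: closed_segment_same_Im)
    then show ?thesis using abs_Im_le_cmod[of w] \<open>R > 0\<close> by auto
  qed
  have s3: "Im w \<ge> 0 \<and> R \<le> norm w" if "w \<in> closed_segment (Complex (-R) R) (- of_real R)" for w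
  proof -
    have "Re w = -R" "0 \<le> Im w" using that \<open>R > 0\<close>
      by (auto simp: closed_segment_same_Re closed_segment_eq_real_ivl)
    then show ?thesis using abs_Re_le_cmod[of w] by auto
  qed
  have n: "norm (Complex R R - of_real R) = R" "norm (Complex (-R) R - Complex R R) = 2 * R"
    "norm (- of_real R - Complex (-R) R) = R"
    using \<open>R > 0\<close> by (auto simp: cmod_def real_sqrt_mult)
  have "norm (\<Gamma> (of_real R) - \<Gamma> (- of_real R)) = norm ((\<Gamma> (Complex R R) - \<Gamma> (of_real R)) +
      (\<Gamma> (Complex (-R) R) - \<Gamma> (Complex R R)) + (\<Gamma> (- of_real R) - \<Gamma> (Complex (-R) R)))"
    by (simp add: norm_minus_commute)
  also have "\<dots> \<le> B * R + B * (2 * R) + B * R"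
    using seg[of "of_real R" "Complex R R", OF s1] seg[of "Complex R R" "Complex (-R) R", OF s2]
      seg[of "Complex (-R) R" "- of_real R", OF s3] unfolding n
    by (intro norm_triangle_mono)
  finally show ?thesis by (simp add: algebra_simps)
qed

lemma poisson_kernel_complex:
  assumes "Im z > 0"
  shows "(of_real s - z) * (of_real s - cnj z) = of_real ((s - Re z)\<^sup>2 + (Im z)\<^sup>2)"
  by (simp add: complex_eq_iff power2_eq_square algebra_simps)

text \<open>The function \<open>(K w - K z) / ((w - z) (w - cnj z))\<close> is holomorphic near the closed upper half
  plane and decays quadratically there, so its integral over the real line vanishes.\<close>

lemma poisson_formula:
  fixes K :: "complex \<Rightarrow> complex"
  assumes hol: "K holomorphic_on {w. Im w > - d}" and "d > 0" and z: "Im z > 0"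
    and bound: "\<And>w. Im w \<ge> 0 \<Longrightarrow> norm (K w) \<le> B"
  shows "has_bochner_integral lborel (\<lambda>s. poisson (Im z) (s - Re z) *\<^sub>R K (of_real s)) (K z)"
proof -
  \<comment> \<open>The half plane \<open>S\<close> must stay above \<open>cnj z\<close>, the pole
    of \<open>g\<close>.\<close>
  define e where "e = min d (Im z)"
  define S where "S = {w. Im w > - e}"
  have S: "open S" "convex S" unfolding S_def
    by (auto simp: open_halfspace_Im_gt convex_halfspace_Im_gt)
  have "e > 0" using assms by (simp add: e_def)
  have zS: "z \<in> S" using z \<open>e > 0\<close> by (simp add: S_def)
  have KS: "K holomorphic_on S" using hol by (rule holomorphic_on_subset) (auto simp: S_def e_def)
  define Q where "Q w = (if w = z then deriv K z else (K w - K z) / (w - z))" for w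
  have QS: "Q holomorphic_on S" unfolding Q_def
    using KS zS S by (intro pole_lemma) (auto simp: interior_open)
  define g where "g w = Q w / (w - cnj z)" for w
  have gS: "g holomorphic_on S" unfolding g_def
    using QS by (intro holomorphic_intros) (auto simp: S_def e_def)
  obtain \<Gamma> where \<Gamma>: "\<And>w. w \<in> S \<Longrightarrow> (\<Gamma> has_field_derivative g w) (at w within S)"
    using holomorphic_convex_primitive'[OF S(2,1) gS] by blast
  have \<Gamma>': "(\<Gamma> has_field_derivative g w) (at w)" if "Im w \<ge> 0" for w
  proof -
    have "w \<in> S" using that \<open>e > 0\<close> by (simp add: S_def)
    then show ?thesis using \<Gamma>[of w] S at_within_open[of w S] by simp
  qed
  have B0: "B \<ge> 0" using order_trans[OF norm_ge_zero bound[of 0]] by simp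
  have gb: "norm (g w) \<le> 2 * B / (R - norm z)\<^sup>2" if "Im w \<ge> 0" "R \<le> norm w" "norm z < R" for w R
  proof -
    have wz: "R - norm z \<le> norm (w - z)" "R - norm z \<le> norm (w - cnj z)"
      using that norm_triangle_ineq2[of w z] norm_triangle_ineq2[of w "cnj z"] by auto
    have "norm (g w) = norm (K w - K z) / (norm (w - z) * norm (w - cnj z))"
      using that by (auto simp: g_def Q_def norm_divide)
    also have "\<dots> \<le> (B + B) / ((R - norm z) * (R - norm z))"
      using wz that bound[of w] bound[of z] z B0
      by (intro frac_le mult_mono order_trans[OF norm_triangle_ineq4] add_mono) auto
    finally show ?thesis by (simp add: power2_eq_square)
  qed
  define f where "f s = g (of_real s)" for s :: real
  have f: "f s = (pi / Im z) *\<^sub>R (poisson (Im z) (s - Re z) *\<^sub>R (K (of_real s) - K z))" for s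
  proof -
    have "of_real s \<noteq> z" using z by auto
    then have "f s = (K (of_real s) - K z) / ((of_real s - z) * (of_real s - cnj z))"
      by (simp add: f_def g_def Q_def)
    also have "\<dots> = (1 / ((s - Re z)\<^sup>2 + (Im z)\<^sup>2)) *\<^sub>R (K (of_real s) - K z)"
      unfolding poisson_kernel_complex[OF z] by (simp add: scaleR_conv_of_real)
    also have "1 / ((s - Re z)\<^sup>2 + (Im z)\<^sup>2) = (pi / Im z) * poisson (Im z) (s - Re z)"
      using z by (simp add: poisson_def)
    finally show ?thesis by simp
  qed
  have cK: "continuous_on UNIV (\<lambda>s::real. K (of_real s))"
    by (rule continuous_on_compose2[OF holomorphic_on_imp_continuous_on[OF KS]])
      (use \<open>e > 0\<close> in \<open>auto intro!: continuous_intros simp: S_def\<close>)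
  then have mK [measurable]: "(\<lambda>s::real. K (of_real s)) \<in> borel_measurable borel"
    by (rule borel_measurable_continuous_onI)
  have cf: "continuous_on UNIV f" unfolding f_def
    by (rule continuous_on_compose2[OF holomorphic_on_imp_continuous_on[OF gS]])
      (use \<open>e > 0\<close> in \<open>auto intro!: continuous_intros simp: S_def\<close>)
  have iK: "integrable lborel (\<lambda>s. poisson (Im z) (s - Re z) *\<^sub>R K (of_real s))"
  proof (rule Bochner_Integration.integrable_bound)
    show "integrable lborel (\<lambda>s. poisson (Im z) (s - Re z) * B)"
      using integrable_poisson[OF z] by simp
    show "AE s in lborel. norm (poisson (Im z) (s - Re z) *\<^sub>R K (of_real s)) \<le> norm (poisson (Im z) (s - Re z) * B)"
      using bound poisson_pos[OF z] B0 by (auto simp: abs_mult less_imp_le intro!: mult_left_mono AE_I2)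
  qed measurable
  have ic: "has_bochner_integral lborel (\<lambda>s. poisson (Im z) (s - Re z) *\<^sub>R K z) (1 *\<^sub>R K z)"
    using has_bochner_integral_poisson[OF z] by (rule has_bochner_integral_scaleR_left)
  have idf: "integrable lborel (\<lambda>s. poisson (Im z) (s - Re z) *\<^sub>R (K (of_real s) - K z))"
    unfolding scaleR_diff_right using iK ic by (auto simp: has_bochner_integral_iff)
  have "(\<integral>s. f s \<partial>lborel) = 0"
  proof (rule integral_total_derivative_eq_0[where F = "\<lambda>s. \<Gamma> (of_real s)"])
    show "integrable lborel f" unfolding f[abs_def] using idf by (intro integrable_scaleR_right)
    show "((\<lambda>s. \<Gamma> (of_real s)) has_vector_derivative f s) (at s)" for s
      unfolding f_def using \<Gamma>'[of "of_real s"] by (intro has_vector_derivative_real_field) auto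
    show "(\<lambda>n. \<Gamma> (of_real (real n)) - \<Gamma> (of_real (- real n))) \<longlonglongrightarrow> 0"
    proof (rule Lim_null_comparison[where g = "\<lambda>n. 4 * real n * (2 * B / (real n - norm z)\<^sup>2)"])
      obtain N where N: "norm z < real N" using reals_Archimedean2 by blast
      show "\<forall>\<^sub>F n in sequentially. norm (\<Gamma> (of_real (real n)) - \<Gamma> (of_real (- real n))) \<le> 4 * real n * (2 * B / (real n - norm z)\<^sup>2)"
        unfolding eventually_sequentially
      proof (intro exI[of _ N] allI impI)
        fix n assume "N \<le> n"
        with N have n: "norm z < real n" by linarith
        then have "0 < real n" by (meson norm_ge_zero le_less_trans)
        show "norm (\<Gamma> (of_real (real n)) - \<Gamma> (of_real (- real n))) \<le> 4 * real n * (2 * B / (real n - norm z)\<^sup>2)"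
          using three_segment_bound[of \<Gamma> g "real n", OF \<Gamma>' gb \<open>0 < real n\<close>] n by simp
      qed
      show "(\<lambda>n. 4 * real n * (2 * B / (real n - norm z)\<^sup>2)) \<longlonglongrightarrow> 0" by real_asymp
    qed
  qed (fact cf)
  then have "(\<integral>s. poisson (Im z) (s - Re z) *\<^sub>R (K (of_real s) - K z) \<partial>lborel) = 0"
    unfolding f[abs_def] integral_scaleR_right using z by simp
  then have "(\<integral>s. poisson (Im z) (s - Re z) *\<^sub>R K (of_real s) \<partial>lborel) = K z"
    unfolding scaleR_diff_right using iK ic by (simp add: has_bochner_integral_iff)
  with iK show ?thesis by (simp add: has_bochner_integral_iff)
qed

lemma inverse_Suc_LIMSEQ: "(\<lambda>k. 1 / real (Suc k)) \<longlonglongrightarrow> 0"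
  using LIMSEQ_inverse_real_of_nat by (simp add: inverse_eq_divide)

text \<open>The harmonic measure of \<open>E\<close> seen from \<open>Complex x y\<close>. Its
  values are in \<open>ennreal\<close> so that it can be compared directly with lower limits of
  nonnegative integrals.\<close>

definition pmass :: "real set \<Rightarrow> real \<Rightarrow> real \<Rightarrow> ennreal" where
  "pmass E x y = (\<integral>\<^sup>+s. ennreal (poisson y (s - x)) * indicator E s \<partial>lborel)"

text \<open>\<open>poisson_formula\<close> applies to \<open>K\<close> translated upwards by
  \<open>d k\<close>, and Fatou's lemma lets \<open>d k\<close> tend to 0. An inequality is all that
  can remain, because the boundary measure of \<open>Im K\<close> may have a singular part.\<close>

lemma poisson_lower_bound:
  fixes K :: "complex \<Rightarrow> complex"
  assumes hol: "K holomorphic_on {w. Im w > 0}" and pos: "\<And>w. Im w > 0 \<Longrightarrow> Im (K w) \<ge> 0"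
    and bound: "\<And>e. e > 0 \<Longrightarrow> \<exists>B. \<forall>w. Im w \<ge> e \<longrightarrow> norm (K w) \<le> B"
    and E: "E \<in> sets borel" and y: "y > 0"
    and lower: "\<And>x. x \<in> E \<Longrightarrow> \<forall>\<^sub>F k in sequentially. c \<le> Im (K (Complex x (1 / real (Suc k))))"
  shows "ennreal c * pmass E x y \<le> ennreal (Im (K (Complex x y)))"
proof -
  define d where "d k = 1 / real (Suc k)" for k
  have d: "d k > 0" for k by (simp add: d_def)
  have eq: "(\<integral>\<^sup>+s. ennreal (poisson y (s - x) * Im (K (Complex s (d k)))) \<partial>lborel) =
      ennreal (Im (K (Complex x (y + d k))))" for k
  proof -
    obtain B where B: "\<And>w. Im w \<ge> d k \<Longrightarrow> norm (K w) \<le> B" using bound[OF d] by blast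
    have "has_bochner_integral lborel (\<lambda>s. poisson (Im (Complex x y)) (s - Re (Complex x y)) *\<^sub>R
        (\<lambda>w. K (w + \<i> * d k)) (of_real s)) ((\<lambda>w. K (w + \<i> * d k)) (Complex x y))"
    proof (rule poisson_formula[where d = "d k" and B = B])
      show "(\<lambda>w. K (w + \<i> * d k)) holomorphic_on {w. - d k < Im w}"
        by (rule holomorphic_on_compose_gen[of "\<lambda>w. w + \<i> * d k" _ K, unfolded o_def, OF _ hol])
          (auto intro!: holomorphic_intros)
    qed (use y d B in auto)
    moreover have "Complex x y + \<i> * d k = Complex x (y + d k)" "of_real s + \<i> * d k = Complex s (d k)" for s
      by (auto simp: complex_eq_iff)
    ultimately have "has_bochner_integral lborel (\<lambda>s. poisson y (s - x) *\<^sub>R K (Complex s (d k))) (K (Complex x (y + d k)))"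
      by simp
    then have "has_bochner_integral lborel (\<lambda>s. Im (poisson y (s - x) *\<^sub>R K (Complex s (d k)))) (Im (K (Complex x (y + d k))))"
      by (rule has_bochner_integral_Im)
    then have "has_bochner_integral lborel (\<lambda>s. poisson y (s - x) * Im (K (Complex s (d k)))) (Im (K (Complex x (y + d k))))"
      by simp
    moreover have "AE s in lborel. 0 \<le> poisson y (s - x) * Im (K (Complex s (d k)))"
      using poisson_pos[OF y] pos d by (auto intro!: AE_I2 mult_nonneg_nonneg simp: less_imp_le)
    ultimately show ?thesis by (simp add: has_bochner_integral_iff nn_integral_eq_integral)
  qed
  have cont: "continuous_on UNIV (\<lambda>s. K (Complex s (d k)))" for k
    by (rule continuous_on_compose2[OF holomorphic_on_imp_continuous_on[OF hol]])
      (use d in \<open>auto intro!: continuous_intros simp: Complex_eq\<close>)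
  have m [measurable]: "(\<lambda>s. K (Complex s (d k))) \<in> borel_measurable borel" for k
    using cont by (rule borel_measurable_continuous_onI)
  have [measurable]: "(\<lambda>s. Im (K (Complex s (d k)))) \<in> borel_measurable borel" for k
    using cont by (intro borel_measurable_continuous_onI continuous_intros)
  have "ennreal c * pmass E x y = (\<integral>\<^sup>+s. ennreal c * (ennreal (poisson y (s - x)) * indicator E s) \<partial>lborel)"
    unfolding pmass_def using E by (intro nn_integral_cmult[symmetric]) auto
  also have "\<dots> \<le> (\<integral>\<^sup>+s. liminf (\<lambda>k. ennreal (poisson y (s - x) * Im (K (Complex s (d k))))) \<partial>lborel)"
  proof (rule nn_integral_mono)
    fix s
    show "ennreal c * (ennreal (poisson y (s - x)) * indicator E s) \<le> liminf (\<lambda>k. ennreal (poisson y (s - x) * Im (K (Complex s (d k)))))"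
    proof (cases "s \<in> E")
      case True
      have "ennreal c * ennreal (poisson y (s - x)) \<le> liminf (\<lambda>k. ennreal (poisson y (s - x) * Im (K (Complex s (d k)))))"
      proof (rule Liminf_bounded)
        show "\<forall>\<^sub>F k in sequentially. ennreal c * ennreal (poisson y (s - x)) \<le> ennreal (poisson y (s - x) * Im (K (Complex s (d k))))"
          using lower[OF True]
        proof eventually_elim
          case (elim k)
          show ?case
          proof (cases "c \<ge> 0")
            case True
            then have "ennreal c * ennreal (poisson y (s - x)) = ennreal (poisson y (s - x) * c)"
              using poisson_pos[OF y, of "s - x"] by (simp add: ennreal_mult[symmetric] mult.commute)
            then show ?thesis using elim poisson_pos[OF y, of "s - x"]
              by (auto intro!: ennreal_leI mult_left_mono simp: d_def)
          qed (auto simp: ennreal_neg)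
        qed
      qed
      then show ?thesis using True by simp
    qed auto
  qed
  also have "\<dots> \<le> liminf (\<lambda>k. \<integral>\<^sup>+s. ennreal (poisson y (s - x) * Im (K (Complex s (d k)))) \<partial>lborel)"
    by (rule nn_integral_liminf) measurable
  also have "\<dots> = liminf (\<lambda>k. ennreal (Im (K (Complex x (y + d k)))))" by (simp add: eq)
  also have "\<dots> = ennreal (Im (K (Complex x y)))"
  proof (rule lim_imp_Liminf)
    have "isCont K (Complex x y)"
      using hol y by (intro holomorphic_on_imp_continuous_on[THEN continuous_on_interior])
        (auto simp: interior_open open_halfspace_Im_gt)
    moreover have "(\<lambda>k. Complex x (y + d k)) \<longlonglongrightarrow> Complex x (y + 0)"
      unfolding d_def by (intro tendsto_Complex tendsto_add tendsto_const inverse_Suc_LIMSEQ)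
    ultimately have "(\<lambda>k. K (Complex x (y + d k))) \<longlonglongrightarrow> K (Complex x y)"
      using isCont_tendsto_compose[of "Complex x y" K] by simp
    then show "(\<lambda>k. ennreal (Im (K (Complex x (y + d k))))) \<longlonglongrightarrow> ennreal (Im (K (Complex x y)))"
      by (intro tendsto_ennrealI tendsto_Im)
  qed simp
  finally show ?thesis .
qed

section \<open>Boundary values of holomorphic functions\<close>

lemma poisson_has_real_derivative:
  assumes "0 < y"
  shows "((\<lambda>s. poisson y (s - x)) has_real_derivative - (2 * (s - x) / ((s - x)\<^sup>2 + y\<^sup>2)) * poisson y (s - x)) (at s)"
proof -
  define D where "D s = (s - x)\<^sup>2 + y\<^sup>2" for s
  have p: "D s > 0" using assms unfolding D_def by (intro add_nonneg_pos) auto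
  have "(D has_real_derivative 2 * (s - x)) (at s)"
    unfolding D_def[abs_def] by (auto intro!: derivative_eq_intros)
  then have "((\<lambda>s. inverse (D s)) has_real_derivative - (inverse (D s) * (2 * (s - x)) * inverse (D s))) (at s)"
    using p by (intro DERIV_inverse') auto
  then have "((\<lambda>s. (y / pi) * inverse (D s)) has_real_derivative (y / pi) * - (inverse (D s) * (2 * (s - x)) * inverse (D s))) (at s)"
    by (rule DERIV_cmult)
  moreover have "poisson y (s - x) = (y / pi) * inverse (D s)" for s
    by (simp add: poisson_def D_def divide_inverse)
  ultimately show ?thesis unfolding D_def[of s, symmetric] by (simp add: divide_inverse mult_ac)
qed

text \<open>The derivative of the kernel will be integrated against increments of a Lipschitz
  function. The factor \<open>|u|\<close> of such an increment brings the product back under the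
  kernel itself, which is integrable.\<close>

lemma poisson_derivative_bound:
  assumes "0 < y"
  shows "\<bar>2 * u / (u\<^sup>2 + y\<^sup>2) * poisson y u\<bar> * \<bar>u\<bar> \<le> 2 * poisson y u"
proof -
  have pos: "u\<^sup>2 + y\<^sup>2 > 0" using assms by (intro add_nonneg_pos) auto
  have p: "poisson y u > 0" using poisson_pos[OF assms] .
  have "\<bar>2 * u / (u\<^sup>2 + y\<^sup>2) * poisson y u\<bar> * \<bar>u\<bar> = (2 * poisson y u) * (\<bar>u\<bar> * \<bar>u\<bar> / (u\<^sup>2 + y\<^sup>2))"
    using pos p by (simp only: abs_mult abs_divide abs_of_pos) simp
  also have "\<dots> = (2 * poisson y u) * (u\<^sup>2 / (u\<^sup>2 + y\<^sup>2))" by (simp add: power2_eq_square)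
  also have "\<dots> \<le> (2 * poisson y u) * 1" using pos p by (intro mult_left_mono) auto
  finally show ?thesis by simp
qed

lemma has_vector_derivative_quotient:
  fixes f :: "real \<Rightarrow> 'a::real_normed_vector"
  assumes "(f has_vector_derivative D) (at x)"
  shows "((\<lambda>h. (f (x + h) - f x) /\<^sub>R h) \<longlongrightarrow> D) (at 0)"
proof -
  have 0: "((\<lambda>h. norm (f (x + h) - f x - h *\<^sub>R D) / norm h) \<longlongrightarrow> 0) (at 0)"
    using assms by (simp add: has_vector_derivative_def has_derivative_at)
  have "((\<lambda>h. norm ((f (x + h) - f x) /\<^sub>R h - D)) \<longlongrightarrow> 0) (at 0)"
  proof (rule Lim_transform_eventually[OF 0])
    show "\<forall>\<^sub>F h in at 0. norm (f (x + h) - f x - h *\<^sub>R D) / norm h = norm ((f (x + h) - f x) /\<^sub>R h - D)"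
      unfolding eventually_at_filter
    proof (rule always_eventually, intro allI impI)
      fix h :: real assume h: "h \<noteq> 0"
      then have "(f (x + h) - f x) /\<^sub>R h - D = (f (x + h) - f x - h *\<^sub>R D) /\<^sub>R h"
        by (simp add: scaleR_diff_right)
      then show "norm (f (x + h) - f x - h *\<^sub>R D) / norm h = norm ((f (x + h) - f x) /\<^sub>R h - D)"
        using h by (simp add: divide_inverse mult.commute)
    qed
  qed
  then have "((\<lambda>h. (f (x + h) - f x) /\<^sub>R h - D) \<longlongrightarrow> 0) (at 0)" by (rule tendsto_norm_zero_cancel)
  then show ?thesis by (rule LIM_zero_cancel)
qed

lemma bounded_primitive_Lipschitz:
  fixes F :: "complex \<Rightarrow> complex"
  assumes hol: "F holomorphic_on {w. Im w > 0}" and bound: "\<And>w. Im w > 0 \<Longrightarrow> norm (F w) \<le> B"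
  obtains G where "\<And>w. Im w > 0 \<Longrightarrow> (G has_field_derivative F w) (at w)"
    "\<And>w v. Im w > 0 \<Longrightarrow> Im v > 0 \<Longrightarrow> norm (G w - G v) \<le> B * norm (w - v)"
proof -
  let ?H = "{w. Im w > 0}"
  have H: "open ?H" "convex ?H" by (auto simp: open_halfspace_Im_gt convex_halfspace_Im_gt)
  obtain G where G: "\<And>w. w \<in> ?H \<Longrightarrow> (G has_field_derivative F w) (at w within ?H)"
    using holomorphic_convex_primitive'[OF H(2,1) hol] by blast
  show thesis
  proof
    show "(G has_field_derivative F w) (at w)" if "Im w > 0" for w
      using G[of w] that H at_within_open[of w ?H] by simp
    show "norm (G w - G v) \<le> B * norm (w - v)" if "Im w > 0" "Im v > 0" for w v
      using that by (intro field_differentiable_bound[OF H(2) G bound]) auto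
  qed
qed

text \<open>Integration by parts in \<open>poisson_formula\<close>. The primitive that vanishes at
  \<open>x\<close> is taken because it is bounded by \<open>B * |s - x|\<close>: this makes its
  product with the derivative of the kernel integrable and the boundary terms small.\<close>

lemma bounded_integral_formula:
  fixes F G :: "complex \<Rightarrow> complex"
  assumes hol: "F holomorphic_on {w. Im w > - d}" and "d > 0" and y: "y > 0"
    and bound: "\<And>w. Im w \<ge> 0 \<Longrightarrow> norm (F w) \<le> B"
    and G: "\<And>s. ((\<lambda>s. G (of_real s)) has_vector_derivative F (of_real s)) (at s)"
    and lip: "\<And>s t. norm (G (of_real s) - G (of_real t)) \<le> B * \<bar>s - t\<bar>"
  shows "(\<integral>s. (2 * (s - x) / ((s - x)\<^sup>2 + y\<^sup>2) * poisson y (s - x)) *\<^sub>R (G (of_real s) - G (of_real x)) \<partial>lborel) = F (Complex x y)"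
proof -
  define q where "q s = 2 * (s - x) / ((s - x)\<^sup>2 + y\<^sup>2) * poisson y (s - x)" for s
  define D where "D s = G (of_real s) - G (of_real x)" for s :: real
  have B0: "B \<ge> 0" using order_trans[OF norm_ge_zero bound[of 0]] by simp
  have pf: "has_bochner_integral lborel (\<lambda>s. poisson y (s - x) *\<^sub>R F (of_real s)) (F (Complex x y))"
    using poisson_formula[OF hol \<open>d > 0\<close>, of "Complex x y" B] y bound by simp
  have cG: "continuous_on UNIV (\<lambda>s::real. G (of_real s))"
    using G by (meson continuous_on_eq_continuous_within has_vector_derivative_continuous has_vector_derivative_at_within)
  then have [measurable]: "(\<lambda>s::real. G (of_real s)) \<in> borel_measurable borel"
    by (rule borel_measurable_continuous_onI)
  have pos: "(s - x)\<^sup>2 + y\<^sup>2 > 0" for s using y by (intro add_nonneg_pos) auto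
  have qD: "norm (q s *\<^sub>R D s) \<le> 2 * B * poisson y (s - x)" for s
  proof -
    have "norm (q s *\<^sub>R D s) \<le> \<bar>q s\<bar> * (B * \<bar>s - x\<bar>)"
      using lip[of s x] by (simp add: D_def mult_left_mono)
    also have "\<dots> = B * (\<bar>q s\<bar> * \<bar>s - x\<bar>)" by simp
    also have "\<dots> \<le> B * (2 * poisson y (s - x))"
      unfolding q_def by (intro mult_left_mono poisson_derivative_bound y B0)
    finally show ?thesis by simp
  qed
  have iq: "integrable lborel (\<lambda>s. q s *\<^sub>R D s)"
  proof (rule Bochner_Integration.integrable_bound)
    show "integrable lborel (\<lambda>s. 2 * B * poisson y (s - x))"
      using integrable_poisson[OF y] by simp
    show "AE s in lborel. norm (q s *\<^sub>R D s) \<le> norm (2 * B * poisson y (s - x))"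
    proof (rule AE_I2)
      fix s show "norm (q s *\<^sub>R D s) \<le> norm (2 * B * poisson y (s - x))"
        using qD[of s] B0 poisson_pos[OF y, of "s - x"] by (simp add: abs_mult)
    qed
    show "(\<lambda>s. q s *\<^sub>R D s) \<in> borel_measurable lborel" unfolding q_def D_def by measurable
  qed
  have "(\<integral>s. poisson y (s - x) *\<^sub>R F (of_real s) - q s *\<^sub>R D s \<partial>lborel) = 0"
  proof (rule integral_total_derivative_eq_0[where F = "\<lambda>s. poisson y (s - x) *\<^sub>R D s"])
    show "integrable lborel (\<lambda>s. poisson y (s - x) *\<^sub>R F (of_real s) - q s *\<^sub>R D s)"
      using pf iq by (auto simp: has_bochner_integral_iff)
    show "((\<lambda>s. poisson y (s - x) *\<^sub>R D s) has_vector_derivative poisson y (s - x) *\<^sub>R F (of_real s) - q s *\<^sub>R D s) (at s)" for s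
    proof -
      have "((\<lambda>s. poisson y (s - x) *\<^sub>R D s) has_vector_derivative
          (poisson y (s - x) *\<^sub>R F (of_real s) + (- (2 * (s - x) / ((s - x)\<^sup>2 + y\<^sup>2)) * poisson y (s - x)) *\<^sub>R D s)) (at s)"
      proof (rule has_vector_derivative_scaleR)
        show "(D has_vector_derivative F (of_real s)) (at s)"
          unfolding D_def[abs_def] using has_vector_derivative_diff[OF G has_vector_derivative_const] by simp
      qed (rule poisson_has_real_derivative[OF y])
      then show ?thesis by (simp add: q_def)
    qed
    have "continuous_on UNIV (\<lambda>s::real. F (of_real s))"
      by (rule continuous_on_compose2[OF holomorphic_on_imp_continuous_on[OF hol]])
        (use \<open>d > 0\<close> in \<open>auto intro!: continuous_intros\<close>)
    moreover have "continuous_on UNIV q" "continuous_on UNIV (\<lambda>s. poisson y (s - x))"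
      unfolding q_def poisson_def using pos y by (auto intro!: continuous_intros simp: less_imp_neq[symmetric])
    ultimately show "continuous_on UNIV (\<lambda>s. poisson y (s - x) *\<^sub>R F (of_real s) - q s *\<^sub>R D s)"
      unfolding D_def[abs_def] using cG by (intro continuous_intros)
    \<comment> \<open>Each boundary term is of order \<open>1 / n\<close>: the kernel decays like
      \<open>1 / u^2\<close>, and \<open>D\<close> grows at most like \<open>|u|\<close>.\<close>
    have lim1: "(\<lambda>n. poisson y (t n - x) *\<^sub>R D (t n)) \<longlonglongrightarrow> 0" if t: "t = real \<or> t = (\<lambda>n. - real n)" for t :: "nat \<Rightarrow> real"
    proof (rule Lim_null_comparison[where g = "\<lambda>n. (B * y / pi) / (real n - \<bar>x\<bar>)"])
      obtain N where N: "\<bar>x\<bar> < real N" using reals_Archimedean2 by blast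
      show "\<forall>\<^sub>F n in sequentially. norm (poisson y (t n - x) *\<^sub>R D (t n)) \<le> (B * y / pi) / (real n - \<bar>x\<bar>)"
        unfolding eventually_sequentially
      proof (intro exI[of _ N] allI impI)
        fix n assume "N \<le> n"
        then have n: "\<bar>x\<bar> < real n" using N by linarith
        define u where "u = t n - x"
        have u: "real n - \<bar>x\<bar> \<le> \<bar>u\<bar>" "0 < \<bar>u\<bar>" using t n by (auto simp: u_def)
        have p: "0 < u\<^sup>2" "0 < u\<^sup>2 + y\<^sup>2" using u by (auto simp: add_pos_nonneg)
        have "\<bar>u\<bar> / (u\<^sup>2 + y\<^sup>2) \<le> \<bar>u\<bar> / u\<^sup>2" using p by (intro divide_left_mono mult_pos_pos) auto
        also have "\<bar>u\<bar> / u\<^sup>2 = 1 / \<bar>u\<bar>" by (cases "u \<ge> 0") (auto simp: power2_eq_square)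
        also have "1 / \<bar>u\<bar> \<le> 1 / (real n - \<bar>x\<bar>)" using u n by (intro divide_left_mono mult_pos_pos) auto
        finally have le: "\<bar>u\<bar> / (u\<^sup>2 + y\<^sup>2) \<le> 1 / (real n - \<bar>x\<bar>)" .
        have "norm (poisson y u *\<^sub>R D (t n)) \<le> poisson y u * (B * \<bar>u\<bar>)"
          using lip[of "t n" x] poisson_pos[OF y, of u] by (simp add: D_def u_def mult_left_mono)
        also have "\<dots> = (B * y / pi) * (\<bar>u\<bar> / (u\<^sup>2 + y\<^sup>2))" by (simp add: poisson_def)
        also have "\<dots> \<le> (B * y / pi) * (1 / (real n - \<bar>x\<bar>))"
          using B0 y by (intro mult_left_mono[OF le]) auto
        finally show "norm (poisson y (t n - x) *\<^sub>R D (t n)) \<le> (B * y / pi) / (real n - \<bar>x\<bar>)"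
          by (simp add: u_def)
      qed
      have "filterlim (\<lambda>n. - \<bar>x\<bar> + real n) at_top sequentially"
        by (intro filterlim_tendsto_add_at_top[OF tendsto_const] filterlim_real_sequentially)
      then show "(\<lambda>n. (B * y / pi) / (real n - \<bar>x\<bar>)) \<longlonglongrightarrow> 0"
        by (intro tendsto_divide_0[OF tendsto_const] filterlim_at_top_imp_at_infinity) (simp add: algebra_simps)
    qed
    show "(\<lambda>n. poisson y (real n - x) *\<^sub>R D (real n) - poisson y (- real n - x) *\<^sub>R D (- real n)) \<longlonglongrightarrow> 0"
      using tendsto_diff[OF lim1[of real] lim1[of "\<lambda>n. - real n"]] by simp
  qed
  then have "(\<integral>s. q s *\<^sub>R D s \<partial>lborel) = F (Complex x y)"
    using pf iq by (simp add: has_bochner_integral_iff)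
  then show ?thesis by (simp add: q_def D_def)
qed

text \<open>Fatou's theorem. The primitive of \<open>F\<close> is Lipschitz, so its boundary function is differentiable
  almost everywhere; integrating the Poisson formula by parts and rescaling shows that \<open>F\<close> has a
  limit at every point of differentiability.\<close>

theorem Fatou_bounded:
  fixes F :: "complex \<Rightarrow> complex"
  assumes hol: "F holomorphic_on {w. Im w > 0}" and bound: "\<And>w. Im w > 0 \<Longrightarrow> norm (F w) \<le> B"
  shows "AE x in lborel. \<exists>L. ((\<lambda>y. F (Complex x y)) \<longlongrightarrow> L) (at_right 0)"
proof -
  have B0: "B \<ge> 0" using order_trans[OF norm_ge_zero bound[of \<i>]] by simp
  obtain G where G: "\<And>w. Im w > 0 \<Longrightarrow> (G has_field_derivative F w) (at w)"
    and lip: "\<And>w v. Im w > 0 \<Longrightarrow> Im v > 0 \<Longrightarrow> norm (G w - G v) \<le> B * norm (w - v)"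
    using bounded_primitive_Lipschitz[OF hol bound] by blast
  define d where "d k = 1 / real (Suc k)" for k
  have d: "d k > 0" for k by (simp add: d_def)
  have d0: "d \<longlonglongrightarrow> 0" unfolding d_def by (rule inverse_Suc_LIMSEQ)
  \<comment> \<open>The primitive is Lipschitz up to the real line, so its boundary function exists
    at every point, while the boundary function of \<open>F\<close> is what has to be found.\<close>
  define G0 where "G0 x = lim (\<lambda>k. G (Complex x (d k)))" for x
  have G0: "(\<lambda>k. G (Complex x (d k))) \<longlonglongrightarrow> G0 x" for x
  proof -
    have "Cauchy (\<lambda>k. G (Complex x (d k)))"
    proof (rule metric_CauchyI)
      fix e :: real assume "e > 0"
      have "Cauchy d" using d0 by (rule LIMSEQ_imp_Cauchy)
      then obtain M where M: "\<And>m n. m \<ge> M \<Longrightarrow> n \<ge> M \<Longrightarrow> dist (d m) (d n) < e / (B + 1)"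
        using metric_CauchyD[OF \<open>Cauchy d\<close>, of "e / (B + 1)"] \<open>e > 0\<close> B0 by auto
      show "\<exists>M. \<forall>m\<ge>M. \<forall>n\<ge>M. dist (G (Complex x (d m))) (G (Complex x (d n))) < e"
      proof (intro exI allI impI)
        fix m n assume mn: "m \<ge> M" "n \<ge> M"
        have "Complex x (d m) - Complex x (d n) = Complex 0 (d m - d n)" by (simp add: complex_eq_iff)
        then have "dist (G (Complex x (d m))) (G (Complex x (d n))) \<le> B * dist (d m) (d n)"
          using lip[of "Complex x (d m)" "Complex x (d n)"] d by (simp add: dist_norm cmod_def)
        also have "\<dots> \<le> (B + 1) * dist (d m) (d n)" by (intro mult_right_mono) auto
        also have "\<dots> < e" using M[OF mn] B0 by (simp add: pos_less_divide_eq mult.commute)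
        finally show "dist (G (Complex x (d m))) (G (Complex x (d n))) < e" .
      qed
    qed
    then show ?thesis unfolding G0_def
      by (simp add: Cauchy_convergent_iff convergent_LIMSEQ_iff)
  qed
  have lip0: "norm (G (Complex s (d k)) - G (Complex t (d k))) \<le> B * \<bar>s - t\<bar>" for s t k
  proof -
    have "Complex s (d k) - Complex t (d k) = Complex (s - t) 0" by (simp add: complex_eq_iff)
    then show ?thesis using lip[of "Complex s (d k)" "Complex t (d k)"] d by (simp add: cmod_def)
  qed
  have lipG0: "norm (G0 s - G0 t) \<le> B * \<bar>s - t\<bar>" for s t
    using tendsto_norm[OF tendsto_diff[OF G0[of s] G0[of t]]] lip0[of s _ t]
    by (intro tendsto_upperbound[of "\<lambda>k. norm (G (Complex s (d k)) - G (Complex t (d k)))"]) auto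
  have cG: "continuous_on UNIV (\<lambda>s. G (Complex s (d k)))" for k
  proof (rule continuous_on_compose2[of "{w. Im w > 0}" G])
    show "continuous_on {w. Im w > 0} G"
      by (rule DERIV_continuous_on[of _ G F], rule has_field_derivative_at_within) (simp add: G)
    show "continuous_on UNIV (\<lambda>s. Complex s (d k))" unfolding Complex_eq by (intro continuous_intros)
  qed (use d in auto)
  have [measurable]: "(\<lambda>s. G (Complex s (d k))) \<in> borel_measurable borel" for k
    using cG by (rule borel_measurable_continuous_onI)
  have [measurable]: "G0 \<in> borel_measurable borel"
    by (rule borel_measurable_LIMSEQ_metric[OF _ G0]) measurable
  \<comment> \<open>The substitution \<open>s = x + y v\<close> moves \<open>y\<close> into a
    difference quotient of \<open>G0\<close> at \<open>x\<close> with increment \<open>y v\<close>;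
    the remaining weight depends on \<open>v\<close> alone.\<close>
  have formula: "F (Complex x y) = (\<integral>v. (2 * v / (v\<^sup>2 + 1) * poisson 1 v / y) *\<^sub>R (G0 (x + y * v) - G0 x) \<partial>lborel)"
    if y: "y > 0" for x y
  proof -
    define q where "q s = 2 * (s - x) / ((s - x)\<^sup>2 + y\<^sup>2) * poisson y (s - x)" for s
    have [measurable]: "q \<in> borel_measurable borel" unfolding q_def by measurable
    have pos: "(s - x)\<^sup>2 + y\<^sup>2 > 0" for s using y by (intro add_nonneg_pos) auto
    have qD: "norm (q s *\<^sub>R D) \<le> 2 * B * poisson y (s - x)" if "norm D \<le> B * \<bar>s - x\<bar>" for s and D :: complex
    proof -
      have "norm (q s *\<^sub>R D) \<le> \<bar>q s\<bar> * (B * \<bar>s - x\<bar>)"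
        using that by (simp add: mult_left_mono)
      also have "\<dots> = B * (\<bar>q s\<bar> * \<bar>s - x\<bar>)" by simp
      also have "\<dots> \<le> B * (2 * poisson y (s - x))"
        unfolding q_def by (intro mult_left_mono poisson_derivative_bound y B0)
      finally show ?thesis by simp
    qed
    have eq: "(\<integral>s. q s *\<^sub>R (G (Complex s (d k)) - G (Complex x (d k))) \<partial>lborel) = F (Complex x (y + d k))" for k
    proof -
      have sh: "of_real s + \<i> * d k = Complex s (d k)" "Complex x y + \<i> * d k = Complex x (y + d k)" for s
        by (auto simp: complex_eq_iff)
      have "(\<integral>s. (2 * (s - x) / ((s - x)\<^sup>2 + y\<^sup>2) * poisson y (s - x)) *\<^sub>R
          ((\<lambda>w. G (w + \<i> * d k)) (of_real s) - (\<lambda>w. G (w + \<i> * d k)) (of_real x)) \<partial>lborel) = (\<lambda>w. F (w + \<i> * d k)) (Complex x y)"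
      proof (rule bounded_integral_formula[where d = "d k" and B = B])
        show "(\<lambda>w. F (w + \<i> * d k)) holomorphic_on {w. - d k < Im w}"
          by (rule holomorphic_on_compose_gen[of "\<lambda>w. w + \<i> * d k" _ F, unfolded o_def, OF _ hol])
            (auto intro!: holomorphic_intros)
        show "((\<lambda>s. G (of_real s + \<i> * d k)) has_vector_derivative F (of_real s + \<i> * d k)) (at s)" for s :: real
        proof -
          have "((\<lambda>w. G (w + \<i> * d k)) has_field_derivative F (of_real s + \<i> * d k) * 1) (at (of_real s))"
            using d by (intro DERIV_chain'[where g = G] G) (auto intro!: derivative_eq_intros)
          then show ?thesis using has_vector_derivative_real_field[of "\<lambda>w. G (w + \<i> * d k)"] by simp
        qed
        show "norm (G (of_real s + \<i> * d k) - G (of_real t + \<i> * d k)) \<le> B * \<bar>s - t\<bar>" for s t :: real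
          using lip0 by (simp add: sh)
      qed (use d y bound in \<open>auto simp: add_nonneg_pos\<close>)
      then show ?thesis by (simp add: sh q_def)
    qed
    have "(\<lambda>k. \<integral>s. q s *\<^sub>R (G (Complex s (d k)) - G (Complex x (d k))) \<partial>lborel) \<longlonglongrightarrow> (\<integral>s. q s *\<^sub>R (G0 s - G0 x) \<partial>lborel)"
    proof (rule integral_dominated_convergence[where w = "\<lambda>s. 2 * B * poisson y (s - x)"])
      show "integrable lborel (\<lambda>s. 2 * B * poisson y (s - x))" using integrable_poisson[OF y] by simp
      show "AE s in lborel. (\<lambda>k. q s *\<^sub>R (G (Complex s (d k)) - G (Complex x (d k)))) \<longlonglongrightarrow> q s *\<^sub>R (G0 s - G0 x)"
        by (intro AE_I2 tendsto_intros G0)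
      show "\<And>k. AE s in lborel. norm (q s *\<^sub>R (G (Complex s (d k)) - G (Complex x (d k)))) \<le> 2 * B * poisson y (s - x)"
        by (intro AE_I2 qD lip0)
    qed measurable
    moreover have "(\<lambda>k. F (Complex x (y + d k))) \<longlonglongrightarrow> F (Complex x y)"
    proof -
      have "isCont F (Complex x y)"
        using hol y by (intro holomorphic_on_imp_continuous_on[THEN continuous_on_interior])
          (auto simp: interior_open open_halfspace_Im_gt)
      moreover have "(\<lambda>k. Complex x (y + d k)) \<longlonglongrightarrow> Complex x (y + 0)"
        by (intro tendsto_Complex tendsto_add tendsto_const d0)
      ultimately show ?thesis using isCont_tendsto_compose[of "Complex x y" F] by simp
    qed
    ultimately have "F (Complex x y) = (\<integral>s. q s *\<^sub>R (G0 s - G0 x) \<partial>lborel)"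
      unfolding eq using LIMSEQ_unique by blast
    also have "\<dots> = \<bar>y\<bar> *\<^sub>R (\<integral>v. q (x + y * v) *\<^sub>R (G0 (x + y * v) - G0 x) \<partial>lborel)"
      using y by (intro lborel_integral_real_affine) auto
    also have "\<dots> = (\<integral>v. y *\<^sub>R (q (x + y * v) *\<^sub>R (G0 (x + y * v) - G0 x)) \<partial>lborel)"
      using y by (simp only: integral_scaleR_right abs_of_pos)
    also have "\<dots> = (\<integral>v. (2 * v / (v\<^sup>2 + 1) * poisson 1 v / y) *\<^sub>R (G0 (x + y * v) - G0 x) \<partial>lborel)"
    proof (rule Bochner_Integration.integral_cong[OF refl])
      fix v
      have "(y * v)\<^sup>2 + y\<^sup>2 = y * y * (v\<^sup>2 + 1)" by (simp add: power2_eq_square algebra_simps)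
      moreover have "q (x + y * v) = 2 * (y * v) / ((y * v)\<^sup>2 + y\<^sup>2) * (poisson 1 v / y)"
        using poisson_scale[OF y, of v] by (simp add: q_def)
      ultimately have "y * q (x + y * v) = 2 * v / (v\<^sup>2 + 1) * poisson 1 v / y"
        using y by simp
      then show "y *\<^sub>R (q (x + y * v) *\<^sub>R (G0 (x + y * v) - G0 x)) = (2 * v / (v\<^sup>2 + 1) * poisson 1 v / y) *\<^sub>R (G0 (x + y * v) - G0 x)"
        by (simp only: scaleR_scaleR)
    qed
    finally show ?thesis .
  qed
  have "AE x in lborel. \<exists>D. (G0 has_vector_derivative D) (at x)"
    using lipG0 by (rule Lipschitz_differentiable_AE)
  then show ?thesis
  proof (rule AE_mp, intro AE_I2 impI)
    fix x assume "\<exists>D. (G0 has_vector_derivative D) (at x)"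
    then obtain D where D: "(G0 has_vector_derivative D) (at x)" by blast
    define r where "r v = 2 * v / (v\<^sup>2 + 1) * poisson 1 v" for v
    have [measurable]: "r \<in> borel_measurable borel" unfolding r_def by measurable
    have rb: "\<bar>r v * v\<bar> \<le> 2 * poisson 1 v" for v
      using poisson_derivative_bound[of 1 v] by (simp add: r_def abs_mult)
    show "\<exists>L. ((\<lambda>y. F (Complex x y)) \<longlongrightarrow> L) (at_right 0)"
    \<comment> \<open>Dominated convergence speaks about sequences, so the limit at 0 is tested
      along an arbitrary sequence \<open>X\<close> of positive numbers.\<close>
    proof (rule exI[of _ "\<integral>v. (r v * v) *\<^sub>R D \<partial>lborel"], unfold tendsto_at_iff_sequentially, intro allI impI)
      fix X :: "nat \<Rightarrow> real" assume X: "\<forall>i. X i \<in> {0<..} - {0}" "X \<longlonglongrightarrow> 0"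
      then have Xp: "X i > 0" for i by auto
      then have X0: "X i \<noteq> 0" for i by (metis less_irrefl)
      have "(\<lambda>i. \<integral>v. (r v / X i) *\<^sub>R (G0 (x + X i * v) - G0 x) \<partial>lborel) \<longlonglongrightarrow> (\<integral>v. (r v * v) *\<^sub>R D \<partial>lborel)"
      proof (rule integral_dominated_convergence[where w = "\<lambda>v. B * (2 * poisson 1 v)"])
        show "integrable lborel (\<lambda>v. B * (2 * poisson 1 v))"
          using integrable_poisson[of 1 0] by simp
        show "AE v in lborel. norm ((r v / X i) *\<^sub>R (G0 (x + X i * v) - G0 x)) \<le> B * (2 * poisson 1 v)" for i
        proof (rule AE_I2)
          fix v
          have l: "norm (G0 (x + X i * v) - G0 x) \<le> B * \<bar>X i * v\<bar>"
            using lipG0[of "x + X i * v" x] by simp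
          have "norm ((r v / X i) *\<^sub>R (G0 (x + X i * v) - G0 x)) \<le> \<bar>r v / X i\<bar> * (B * \<bar>X i * v\<bar>)"
            unfolding norm_scaleR by (rule mult_left_mono[OF l]) simp
          also have "\<dots> = B * \<bar>r v * v\<bar>" using Xp[of i] by (simp add: abs_mult)
          also have "\<dots> \<le> B * (2 * poisson 1 v)" using rb B0 by (intro mult_left_mono) auto
          finally show "norm ((r v / X i) *\<^sub>R (G0 (x + X i * v) - G0 x)) \<le> B * (2 * poisson 1 v)" .
        qed
        show "AE v in lborel. (\<lambda>i. (r v / X i) *\<^sub>R (G0 (x + X i * v) - G0 x)) \<longlonglongrightarrow> (r v * v) *\<^sub>R D"
        proof (rule AE_I2)
          fix v
          show "(\<lambda>i. (r v / X i) *\<^sub>R (G0 (x + X i * v) - G0 x)) \<longlonglongrightarrow> (r v * v) *\<^sub>R D"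
          proof (cases "v = 0")
            case False
            have "((\<lambda>h. (G0 (x + h) - G0 x) /\<^sub>R h) \<longlongrightarrow> D) (at 0)"
              by (rule has_vector_derivative_quotient[OF D])
            moreover have "(\<lambda>i. X i * v) \<longlonglongrightarrow> 0" using X(2) tendsto_mult_left_zero by blast
            then have "filterlim (\<lambda>i. X i * v) (at 0) sequentially"
              by (rule filterlim_atI) (use X0 False in simp)
            ultimately have "(\<lambda>i. (G0 (x + X i * v) - G0 x) /\<^sub>R (X i * v)) \<longlonglongrightarrow> D"
              by (rule filterlim_compose)
            then have "(\<lambda>i. (r v * v) *\<^sub>R ((G0 (x + X i * v) - G0 x) /\<^sub>R (X i * v))) \<longlonglongrightarrow> (r v * v) *\<^sub>R D"
              by (intro tendsto_intros)
            moreover have "(r v * v) *\<^sub>R (w /\<^sub>R (X i * v)) = (r v / X i) *\<^sub>R w" for i and w :: complex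
            proof -
              have "(r v * v) * inverse (X i * v) = r v / X i" using False X0[of i] by (simp add: field_simps)
              then show ?thesis by (simp only: scaleR_scaleR)
            qed
            ultimately show ?thesis by (simp only:)
          qed simp
        qed
      qed measurable
      then show "((\<lambda>y. F (Complex x y)) \<circ> X) \<longlonglongrightarrow> (\<integral>v. (r v * v) *\<^sub>R D \<partial>lborel)"
        unfolding o_def formula[OF Xp] r_def .
    qed
  qed
qed


section \<open>Measurability of boundary sets and boundary values of Herglotz functions\<close>

lemma sets_Collect_tendsto:
  fixes f :: "nat \<Rightarrow> real \<Rightarrow> 'a::{second_countable_topology, metric_space}"
  assumes [measurable]: "\<And>k. f k \<in> borel_measurable borel" "g \<in> borel_measurable borel"
  shows "{x. (\<lambda>k. f k x) \<longlonglongrightarrow> g x} \<in> sets borel"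
proof -
  have "(\<lambda>k. f k x) \<longlonglongrightarrow> g x \<longleftrightarrow> (\<forall>j::nat. \<exists>N. \<forall>k\<ge>N. dist (f k x) (g x) < 1 / real (Suc j))" for x
  proof
    assume "(\<lambda>k. f k x) \<longlonglongrightarrow> g x"
    then show "\<forall>j::nat. \<exists>N. \<forall>k\<ge>N. dist (f k x) (g x) < 1 / real (Suc j)"
      unfolding lim_sequentially by simp
  next
    assume *: "\<forall>j::nat. \<exists>N. \<forall>k\<ge>N. dist (f k x) (g x) < 1 / real (Suc j)"
    show "(\<lambda>k. f k x) \<longlonglongrightarrow> g x"
      unfolding lim_sequentially
    proof (intro allI impI)
      fix r :: real assume "r > 0"
      then obtain j where "1 / real (Suc j) < r" using nat_approx_posE by blast
      moreover obtain N where "\<forall>k\<ge>N. dist (f k x) (g x) < 1 / real (Suc j)" using * by blast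
      ultimately show "\<exists>N. \<forall>k\<ge>N. dist (f k x) (g x) < r" using order_less_trans by blast
    qed
  qed
  then have "{x. (\<lambda>k. f k x) \<longlonglongrightarrow> g x} = {x \<in> space borel. \<forall>j::nat. \<exists>N. \<forall>k\<ge>N. dist (f k x) (g x) < 1 / real (Suc j)}"
    by simp
  also have "\<dots> \<in> sets borel" by measurable
  finally show ?thesis .
qed

lemma continuous_on_horizontal:
  assumes "F holomorphic_on {w. Im w > 0}" "y > 0"
  shows "continuous_on UNIV (\<lambda>x. F (Complex x y))"
proof (rule continuous_on_compose2[OF holomorphic_on_imp_continuous_on[OF assms(1)]])
  show "continuous_on UNIV (\<lambda>x. Complex x y)" unfolding Complex_eq by (intro continuous_intros)
qed (use assms(2) in auto)

lemma borel_measurable_horizontal: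
  assumes "F holomorphic_on {w. Im w > 0}"
  shows "(\<lambda>x. F (Complex x (1 / real (Suc k)))) \<in> borel_measurable borel"
  by (rule borel_measurable_continuous_onI[OF continuous_on_horizontal[OF assms]]) simp

lemma filterlim_inverse_Suc_at_right: "filterlim (\<lambda>k. 1 / real (Suc k)) (at_right 0) sequentially"
  unfolding filterlim_at by (auto simp: inverse_Suc_LIMSEQ simp del: of_nat_Suc)

lemma boundary_value_sequence:
  "((\<lambda>y. F (Complex x y)) \<longlongrightarrow> L) (at_right 0) \<Longrightarrow> (\<lambda>k. F (Complex x (1 / real (Suc k)))) \<longlonglongrightarrow> L"
  by (rule filterlim_compose[OF _ filterlim_inverse_Suc_at_right])

lemma pmass_eq_0_imp_null:
  assumes E: "E \<in> sets borel" and y: "y > 0" and 0: "pmass E x y = 0"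
  shows "E \<in> null_sets lborel"
proof -
  have "AE s in lborel. ennreal (poisson y (s - x)) * indicator E s = 0"
    using 0 E unfolding pmass_def by (subst (asm) nn_integral_0_iff_AE) auto
  then have "AE s in lborel. s \<notin> E"
  proof (rule AE_mp, intro AE_I2 impI)
    fix s assume "ennreal (poisson y (s - x)) * indicator E s = 0"
    then show "s \<notin> E" using poisson_pos[OF y, of "s - x"] by (auto simp: indicator_def)
  qed
  then show ?thesis using E by (simp add: AE_iff_null_sets)
qed

lemma ennreal_mult_le_imp_0:
  assumes "\<And>c. c \<ge> 0 \<Longrightarrow> ennreal c * a \<le> ennreal b"
  shows "a = 0"
proof (rule ccontr)
  assume "a \<noteq> 0"
  then obtain e where e: "e > 0" "ennreal e \<le> a"
  proof (cases a)
    case (real r)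
    then show ?thesis using that[of r] \<open>a \<noteq> 0\<close> by auto
  next
    case top then show ?thesis using that[of 1] by auto
  qed
  define c where "c = (\<bar>b\<bar> + 1) / e"
  have "ennreal (\<bar>b\<bar> + 1) = ennreal c * ennreal e"
    using e(1) by (simp add: c_def ennreal_mult[symmetric])
  also have "\<dots> \<le> ennreal c * a" using e(2) by (intro mult_left_mono) auto
  also have "\<dots> \<le> ennreal b" using e(1) by (intro assms) (auto simp: c_def)
  finally have "\<bar>b\<bar> + 1 \<le> b \<or> (\<bar>b\<bar> + 1 \<le> 0 \<and> b \<le> 0)" unfolding ennreal_le_iff2 by blast
  then show False by linarith
qed

text \<open>If \<open>m\<close> is unbounded near a boundary point then the positive harmonic function \<open>log |m + i|\<close>
  tends to infinity there; by the Poisson lower bound this happens only on a null set.\<close>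

theorem Herglotz_boundary_value:
  fixes m :: "complex \<Rightarrow> complex"
  assumes hol: "m holomorphic_on {w. Im w > 0}" and pos: "\<And>w. Im w > 0 \<Longrightarrow> Im (m w) \<ge> 0"
    and bound: "\<And>e. e > 0 \<Longrightarrow> \<exists>B. \<forall>w. Im w \<ge> e \<longrightarrow> norm (m w) \<le> B"
  shows "AE x in lborel. \<exists>L. ((\<lambda>y. m (Complex x y)) \<longlongrightarrow> L) (at_right 0)"
proof -
  \<comment> \<open>\<open>F\<close> is bounded by 1, so Fatou's theorem applies to it, and a limit
    of \<open>m\<close> can be recovered wherever the limit of \<open>F\<close> is not 0.\<close>
  define F where "F w = 1 / (m w + \<i>)" for w
  have ge1: "norm (m w + \<i>) \<ge> 1" if "Im w > 0" for w
    using pos[OF that] abs_Im_le_cmod[of "m w + \<i>"] by simp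
  have ne: "m w + \<i> \<noteq> 0" if "Im w > 0" for w using ge1[OF that] by auto
  have Fhol: "F holomorphic_on {w. Im w > 0}" unfolding F_def
    using ne by (intro holomorphic_intros hol) auto
  have "AE x in lborel. \<exists>L. ((\<lambda>y. F (Complex x y)) \<longlongrightarrow> L) (at_right 0)"
    by (rule Fatou_bounded[OF Fhol, of 1]) (use ge1 in \<open>auto simp: F_def norm_divide divide_le_eq\<close>)
  moreover have "AE x in lborel. \<not> (\<lambda>k. F (Complex x (1 / real (Suc k)))) \<longlonglongrightarrow> 0"
  proof -
    define N where "N = {x. (\<lambda>k. F (Complex x (1 / real (Suc k)))) \<longlonglongrightarrow> 0}"
    have N: "N \<in> sets borel" unfolding N_def
      using sets_Collect_tendsto[of "\<lambda>k x. F (Complex x (1 / real (Suc k)))" "\<lambda>_. 0"] borel_measurable_horizontal[OF Fhol] by simp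
    \<comment> \<open>The factor \<open>\<i>\<close> moves \<open>ln |m + i|\<close> into the
      imaginary part. Since \<open>m + \<i>\<close> has imaginary part at least 1, it avoids the cut
      of the logarithm, and \<open>|m + i| \<ge> 1\<close> makes \<open>Im K\<close>
      nonnegative.\<close>
    define K where "K w = \<i> * Ln (m w + \<i>)" for w
    have nR: "m w + \<i> \<notin> \<real>\<^sub>\<le>\<^sub>0" if "Im w > 0" for w
      using pos[OF that] by (auto simp: complex_nonpos_Reals_iff)
    have ImK: "Im (K w) = ln (norm (m w + \<i>))" if "Im w > 0" for w
      using ne[OF that] by (simp add: K_def)
    have "ennreal c * pmass N 0 1 \<le> ennreal (Im (K (Complex 0 1)))" if "c \<ge> 0" for c
    proof (rule poisson_lower_bound[OF _ _ _ N])
      show "K holomorphic_on {w. 0 < Im w}" unfolding K_def using nR by (intro holomorphic_intros hol) auto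
      show "0 \<le> Im (K w)" if "0 < Im w" for w using ImK[OF that] ge1[OF that] by simp
      show "\<exists>B. \<forall>w. e \<le> Im w \<longrightarrow> norm (K w) \<le> B" if e: "0 < e" for e
      proof -
        obtain B where B: "\<And>w. e \<le> Im w \<Longrightarrow> norm (m w) \<le> B" using bound[OF e] by blast
        have "norm (K w) \<le> ln (B + 1) + pi" if "e \<le> Im w" for w
        proof -
          have w: "Im w > 0" using that e by simp
          have "norm (m w + \<i>) \<le> B + 1" using B[OF that] norm_triangle_ineq[of "m w" \<i>] by simp
          then have "ln (norm (m w + \<i>)) \<le> ln (B + 1)" using ge1[OF w] by (intro ln_mono) auto
          moreover have "\<bar>ln (norm (m w + \<i>))\<bar> = ln (norm (m w + \<i>))" using ge1[OF w] by simp
          moreover have "norm (K w) \<le> \<bar>Re (Ln (m w + \<i>))\<bar> + \<bar>Im (Ln (m w + \<i>))\<bar>"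
            unfolding K_def using cmod_le[of "Ln (m w + \<i>)"] by (simp add: norm_mult)
          moreover have "\<bar>Im (Ln (m w + \<i>))\<bar> \<le> pi"
            using mpi_less_Im_Ln[OF ne[OF w]] Im_Ln_le_pi[OF ne[OF w]] by linarith
          ultimately show ?thesis using Re_Ln[OF ne[OF w]] by simp
        qed
        then show ?thesis by blast
      qed
      show "\<forall>\<^sub>F k in sequentially. c \<le> Im (K (Complex x (1 / real (Suc k))))" if "x \<in> N" for x
      proof -
        have "(\<lambda>k. F (Complex x (1 / real (Suc k)))) \<longlonglongrightarrow> 0" using that by (simp add: N_def)
        then have "\<forall>\<^sub>F k in sequentially. norm (F (Complex x (1 / real (Suc k)))) < exp (- c)"
          by (auto dest: tendstoD[of _ _ _ "exp (- c)"] simp: dist_norm simp del: of_nat_Suc)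
        then show ?thesis
        proof eventually_elim
          case (elim k)
          define w where "w = Complex x (1 / real (Suc k))"
          have w: "Im w > 0" by (simp add: w_def)
          have "1 / norm (m w + \<i>) < exp (- c)" using elim by (simp add: F_def w_def norm_divide)
          then have "exp c < norm (m w + \<i>)"
            using order_less_le_trans[OF zero_less_one ge1[OF w]] by (simp add: exp_minus field_simps)
          then have "c \<le> ln (norm (m w + \<i>))" using ge1[OF w] by (subst ln_ge_iff) linarith+
          then show ?case using ImK[OF w] by (simp add: w_def)
        qed
      qed
    qed simp
    then have "pmass N 0 1 = 0" by (rule ennreal_mult_le_imp_0)
    then have "N \<in> null_sets lborel" using N by (intro pmass_eq_0_imp_null[of N 1 0]) auto
    then show ?thesis using AE_not_in[of N lborel] by (simp add: N_def)
  qed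
  ultimately show ?thesis
  proof eventually_elim
    case (elim x)
    then obtain L where L: "((\<lambda>y. F (Complex x y)) \<longlongrightarrow> L) (at_right 0)" by blast
    have "L \<noteq> 0" using boundary_value_sequence[OF L] elim(2) by auto
    then have "((\<lambda>y. 1 / F (Complex x y) - \<i>) \<longlongrightarrow> 1 / L - \<i>) (at_right 0)"
      by (intro tendsto_intros L)
    moreover have "\<forall>\<^sub>F y in at_right 0. 1 / F (Complex x y) - \<i> = m (Complex x y)"
      unfolding eventually_at_right_field by (auto simp: F_def intro: exI[of _ 1])
    ultimately have "((\<lambda>y. m (Complex x y)) \<longlongrightarrow> 1 / L - \<i>) (at_right 0)"
      by (rule Lim_transform_eventually)
    then show ?case by blast
  qed
qed

section \<open>Harmonic measure of sets and a density argument\<close>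

lemma pmass_le_1: assumes "E \<in> sets borel" "y > 0" shows "pmass E x y \<le> 1"
proof -
  have "pmass E x y \<le> (\<integral>\<^sup>+s. ennreal (poisson y (s - x)) \<partial>lborel)"
    unfolding pmass_def by (intro nn_integral_mono) (auto simp: indicator_def)
  also have "\<dots> = ennreal 1"
    using has_bochner_integral_poisson[OF assms(2), of x] poisson_pos[OF assms(2)]
    by (subst nn_integral_eq_integral) (auto simp: has_bochner_integral_iff less_imp_le)
  finally show ?thesis by simp
qed

lemma pmass_measurable [measurable]:
  assumes [measurable]: "E \<in> sets borel" shows "(\<lambda>x. pmass E x y) \<in> borel_measurable borel"
  unfolding pmass_def by measurable

lemma pmass_scaled:
  assumes [measurable]: "E \<in> sets borel" and y: "y > 0"
  shows "pmass E x y = (\<integral>\<^sup>+v. ennreal (poisson 1 v) * indicator E (x + y * v) \<partial>lborel)"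
proof -
  have "pmass E x y = ennreal \<bar>y\<bar> * (\<integral>\<^sup>+v. ennreal (poisson y (x + y * v - x)) * indicator E (x + y * v) \<partial>lborel)"
    unfolding pmass_def using y by (intro nn_integral_real_affine) auto
  also have "\<dots> = (\<integral>\<^sup>+v. ennreal \<bar>y\<bar> * (ennreal (poisson y (x + y * v - x)) * indicator E (x + y * v)) \<partial>lborel)"
    by (intro nn_integral_cmult[symmetric]) measurable
  also have "\<dots> = (\<integral>\<^sup>+v. ennreal (poisson 1 v) * indicator E (x + y * v) \<partial>lborel)"
  proof (rule nn_integral_cong)
    fix v
    have "ennreal \<bar>y\<bar> * ennreal (poisson y (x + y * v - x)) = ennreal (poisson 1 v)"
      using y poisson_scale[OF y, of v] poisson_pos[of 1 v] by (simp add: ennreal_mult[symmetric])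
    then show "ennreal \<bar>y\<bar> * (ennreal (poisson y (x + y * v - x)) * indicator E (x + y * v)) = ennreal (poisson 1 v) * indicator E (x + y * v)"
      by (metis mult.assoc)
  qed
  finally show ?thesis .
qed

lemma nn_integral_poisson_1: "(\<integral>\<^sup>+v. ennreal (poisson 1 v) \<partial>lborel) = 1"
  using has_bochner_integral_poisson_1 poisson_pos[of 1]
  by (subst nn_integral_eq_integral) (auto simp: has_bochner_integral_iff less_imp_le)

text \<open>For open sets density is elementary: after rescaling, each fixed \<open>v\<close> is
  eventually moved into \<open>U\<close>.\<close>

lemma pmass_open_tendsto_1:
  assumes U: "open U" "x \<in> U"
  shows "(\<lambda>k. pmass U x (1 / real (Suc k))) \<longlonglongrightarrow> 1"
proof -
  have [measurable]: "U \<in> sets borel" using U by simp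
  have "(\<lambda>k. \<integral>\<^sup>+v. ennreal (poisson 1 v) * indicator U (x + 1 / real (Suc k) * v) \<partial>lborel) \<longlonglongrightarrow> (\<integral>\<^sup>+v. ennreal (poisson 1 v) \<partial>lborel)"
  proof (rule nn_integral_dominated_convergence[where w = "\<lambda>v. ennreal (poisson 1 v)"])
    show "(\<integral>\<^sup>+v. ennreal (poisson 1 v) \<partial>lborel) < \<infinity>" by (simp add: nn_integral_poisson_1)
    show "AE v in lborel. (\<lambda>k. ennreal (poisson 1 v) * indicator U (x + 1 / real (Suc k) * v)) \<longlonglongrightarrow> ennreal (poisson 1 v)"
    proof (rule AE_I2)
      fix v
      have "(\<lambda>k. x + 1 / real (Suc k) * v) \<longlonglongrightarrow> x + 0 * v" by (intro tendsto_intros inverse_Suc_LIMSEQ)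
      then have "\<forall>\<^sub>F k in sequentially. x + 1 / real (Suc k) * v \<in> U"
        using U topological_tendstoD[of _ "x + 0 * v" sequentially U] by simp
      then have "\<forall>\<^sub>F k in sequentially. ennreal (poisson 1 v) * indicator U (x + 1 / real (Suc k) * v) = ennreal (poisson 1 v)"
        by eventually_elim simp
      then show "(\<lambda>k. ennreal (poisson 1 v) * indicator U (x + 1 / real (Suc k) * v)) \<longlonglongrightarrow> ennreal (poisson 1 v)"
        by (rule tendsto_eventually)
    qed
  qed (auto simp: indicator_def)
  then show ?thesis by (simp add: pmass_scaled nn_integral_poisson_1 del: of_nat_Suc)
qed

text \<open>Tonelli and translation invariance. It is used for the excess \<open>U - E\<close> of an
  open set over \<open>E\<close>, whose harmonic measure is small on average though not at every
  point.\<close>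

lemma nn_integral_pmass:
  assumes [measurable]: "E \<in> sets borel" and y: "y > 0"
  shows "(\<integral>\<^sup>+x. pmass E x y \<partial>lborel) = emeasure lborel E"
proof -
  have "(\<integral>\<^sup>+x. pmass E x y \<partial>lborel) = (\<integral>\<^sup>+x. \<integral>\<^sup>+v. ennreal (poisson 1 v) * indicator E (x + y * v) \<partial>lborel \<partial>lborel)"
    by (simp add: pmass_scaled[OF assms])
  also have "\<dots> = (\<integral>\<^sup>+v. \<integral>\<^sup>+x. ennreal (poisson 1 v) * indicator E (x + y * v) \<partial>lborel \<partial>lborel)"
    by (rule lborel_pair.Fubini') measurable
  also have "\<dots> = (\<integral>\<^sup>+v. ennreal (poisson 1 v) * emeasure lborel E \<partial>lborel)"
  proof (rule nn_integral_cong)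
    fix v
    have "(\<integral>\<^sup>+x. indicator E (x + y * v) \<partial>lborel) = emeasure lborel E"
      using nn_integral_real_affine[of "indicator E :: real \<Rightarrow> ennreal" 1 "y * v"] by (simp add: add.commute)
    then show "(\<integral>\<^sup>+x. ennreal (poisson 1 v) * indicator E (x + y * v) \<partial>lborel) = ennreal (poisson 1 v) * emeasure lborel E"
      by (simp add: nn_integral_cmult)
  qed
  also have "\<dots> = emeasure lborel E" by (simp add: nn_integral_multc nn_integral_poisson_1)
  finally show ?thesis .
qed

text \<open>A weak substitute for the Lebesgue density theorem.\<close>

lemma null_set_if_pmass_tendsto_0:
  assumes E: "E \<in> sets borel" and fin: "emeasure lborel E < \<infinity>"
    and lim: "\<And>x. x \<in> E \<Longrightarrow> (\<lambda>k. pmass E x (1 / real (Suc k))) \<longlonglongrightarrow> 0"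
  shows "E \<in> null_sets lborel"
proof -
  note [measurable] = E
  define d where "d k = 1 / real (Suc k)" for k
  have d: "d k > 0" for k by (simp add: d_def)
  have small: "emeasure lborel E \<le> ennreal e" if "e > 0" for e
  proof -
    have El: "E \<in> sets lebesgue" using E by simp
    obtain U where U: "open U" "E \<subseteq> U" "(U - E) \<in> lmeasurable" "emeasure lebesgue (U - E) < ennreal e"
      using sets_lebesgue_outer_open[OF El \<open>e > 0\<close>] by blast
    have [measurable]: "U \<in> sets borel" using U by simp
    have UE: "emeasure lborel (U - E) \<le> ennreal e" using U(4) by (simp add: less_imp_le)
    have split: "pmass U x y = pmass E x y + pmass (U - E) x y" for x y
    proof -
      have "indicator U s = indicator E s + (indicator (U - E) s :: ennreal)" for s
        using U(2) by (auto simp: indicator_def)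
      then show ?thesis unfolding pmass_def
        by (subst nn_integral_add[symmetric]) (auto simp: distrib_left intro!: nn_integral_cong)
    qed
    have l1: "(\<lambda>k. \<integral>\<^sup>+x. pmass U x (d k) * indicator E x \<partial>lborel) \<longlonglongrightarrow> (\<integral>\<^sup>+x. indicator E x \<partial>lborel)"
    proof (rule nn_integral_dominated_convergence[where w = "indicator E"])
      show "AE x in lborel. pmass U x (d k) * indicator E x \<le> indicator E x" for k
        using pmass_le_1[of U "d k"] d by (auto simp: indicator_def)
      show "AE x in lborel. (\<lambda>k. pmass U x (d k) * indicator E x) \<longlonglongrightarrow> indicator E x"
        using pmass_open_tendsto_1[OF U(1)] U(2) by (auto simp: indicator_def d_def)
    qed (use fin in auto)
    have l2: "(\<lambda>k. \<integral>\<^sup>+x. pmass E x (d k) * indicator E x \<partial>lborel) \<longlonglongrightarrow> (\<integral>\<^sup>+x. 0 \<partial>(lborel :: real measure))"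
    proof (rule nn_integral_dominated_convergence[where w = "indicator E" and u' = "\<lambda>_. 0"])
      show "AE x in lborel. pmass E x (d k) * indicator E x \<le> indicator E x" for k
        using pmass_le_1[of E "d k"] d by (auto simp: indicator_def)
      show "AE x in lborel. (\<lambda>k. pmass E x (d k) * indicator E x) \<longlonglongrightarrow> 0"
        using lim by (auto simp: indicator_def d_def)
    qed (use fin in auto)
    \<comment> \<open>Integrated over \<open>E\<close>, the harmonic measure of \<open>U\<close>
      tends to the measure of \<open>E\<close> and that of \<open>E\<close> tends to 0. Their
      difference is the harmonic measure of \<open>U - E\<close>, which contributes at most
      \<open>e\<close>.\<close>
    have le: "(\<integral>\<^sup>+x. pmass U x (d k) * indicator E x \<partial>lborel) \<le> (\<integral>\<^sup>+x. pmass E x (d k) * indicator E x \<partial>lborel) + ennreal e" for k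
    proof -
      have "(\<integral>\<^sup>+x. pmass U x (d k) * indicator E x \<partial>lborel) \<le> (\<integral>\<^sup>+x. pmass E x (d k) * indicator E x + pmass (U - E) x (d k) \<partial>lborel)"
        by (intro nn_integral_mono) (auto simp: split indicator_def)
      also have "\<dots> = (\<integral>\<^sup>+x. pmass E x (d k) * indicator E x \<partial>lborel) + (\<integral>\<^sup>+x. pmass (U - E) x (d k) \<partial>lborel)"
        by (rule nn_integral_add) measurable
      also have "(\<integral>\<^sup>+x. pmass (U - E) x (d k) \<partial>lborel) = emeasure lborel (U - E)"
        using d by (intro nn_integral_pmass) auto
      finally show ?thesis using UE by (meson add_left_mono order_trans)
    qed
    have "(\<integral>\<^sup>+x. indicator E x \<partial>lborel) \<le> (\<integral>\<^sup>+x. 0 \<partial>(lborel :: real measure)) + ennreal e"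
      by (rule LIMSEQ_le[OF l1 tendsto_add[OF l2 tendsto_const]]) (use le in auto)
    then show ?thesis by simp
  qed
  have "emeasure lborel E \<le> 0"
    by (rule ennreal_le_epsilon) (use small in auto)
  then show ?thesis using E by auto
qed

section \<open>Weyl solutions\<close>

text \<open>The site \<open>n\<close> goes to \<open>1 - n\<close>, which exchanges the sites 0 and
  1 entering the \<open>m\<close> functions. The coefficient \<open>a n\<close> belongs to the bond
  from \<open>n\<close> to \<open>n + 1\<close>, which goes to the bond from \<open>- n\<close> to
  \<open>1 - n\<close>; hence the two different index maps.\<close>

definition reflect :: "jacobi \<Rightarrow> jacobi" where
  "reflect J = Jacobi (\<lambda>n. coeff_a J (- n)) (\<lambda>n. coeff_b J (1 - n))"

lemma reflect_coeffs [simp]: "coeff_a (reflect J) n = coeff_a J (- n)" "coeff_b (reflect J) n = coeff_b J (1 - n)"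
  by (simp_all add: reflect_def)

lemma reflect_reflect [simp]: "reflect (reflect J) = J"
  by (cases J) (simp add: reflect_def)

lemma coeff_a_pos: "bounded_jacobi J \<Longrightarrow> coeff_a J n > 0"
  by (simp add: bounded_jacobi_def)

lemma bounded_jacobi_reflect: "bounded_jacobi J \<Longrightarrow> bounded_jacobi (reflect J)"
  unfolding bounded_jacobi_def by (auto intro: bounded_subset)

lemma jacobi_op_reflect: "jacobi_op (reflect J) (\<lambda>n. f (1 - n)) n = jacobi_op J f (1 - n)"
  by (simp add: jacobi_op_def algebra_simps)

fun sol_fw :: "jacobi \<Rightarrow> complex \<Rightarrow> complex \<Rightarrow> complex \<Rightarrow> nat \<Rightarrow> complex" where
  "sol_fw J z u0 u1 0 = u0"
| "sol_fw J z u0 u1 (Suc 0) = u1"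
| "sol_fw J z u0 u1 (Suc (Suc n)) =
     ((z - of_real (coeff_b J (int n + 1))) * sol_fw J z u0 u1 (Suc n)
       - of_real (coeff_a J (int n)) * sol_fw J z u0 u1 n) / of_real (coeff_a J (int n + 1))"

definition sol :: "jacobi \<Rightarrow> complex \<Rightarrow> complex \<Rightarrow> complex \<Rightarrow> int \<Rightarrow> complex" where
  "sol J z u0 u1 n = (if n \<ge> 0 then sol_fw J z u0 u1 (nat n) else sol_fw (reflect J) z u1 u0 (nat (1 - n)))"

lemma sol_0_1 [simp]: "sol J z u0 u1 0 = u0" "sol J z u0 u1 1 = u1"
  by (simp_all add: sol_def)

lemma sol_le_1: "n \<le> 1 \<Longrightarrow> sol J z u0 u1 n = sol_fw (reflect J) z u1 u0 (nat (1 - n))"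
  by (cases "n = 1"; cases "n = 0") (auto simp: sol_def)

lemma jacobi_op_sol_fw:
  assumes "\<And>n. coeff_a J n > 0" "n \<ge> 1" "\<And>k. k \<ge> 0 \<Longrightarrow> f k = sol_fw J z u0 u1 (nat k)"
  shows "jacobi_op J f n = z * f n"
proof -
  obtain k where n: "n = int k + 1" using assms(2) by (metis add.commute zle_iff_zadd)
  have f: "f (n + 1) = sol_fw J z u0 u1 (Suc (Suc k))" "f n = sol_fw J z u0 u1 (Suc k)" "f (n - 1) = sol_fw J z u0 u1 k"
    using assms(3)[of "n+1"] assms(3)[of n] assms(3)[of "n-1"] n by (auto simp: nat_add_distrib)
  show ?thesis unfolding jacobi_op_def f using assms(1)[of "int k + 1"] n by (simp add: field_simps)
qed

lemma jacobi_op_sol: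
  assumes a: "\<And>n. coeff_a J n > 0"
  shows "jacobi_op J (sol J z u0 u1) n = z * sol J z u0 u1 n"
proof (cases "n \<ge> 1")
  case True
  show ?thesis by (rule jacobi_op_sol_fw[OF a True]) (simp add: sol_def)
next
  case False
  have "jacobi_op (reflect J) (\<lambda>n. sol J z u0 u1 (1 - n)) (1 - n) = z * sol J z u0 u1 (1 - (1 - n))"
    by (rule jacobi_op_sol_fw[where J = "reflect J"]) (use a False in \<open>auto simp: sol_le_1\<close>)
  then show ?thesis by (simp add: jacobi_op_reflect)
qed

lemma sol_fw_unique:
  assumes a: "\<And>n. coeff_a J n > 0" and f: "\<And>n. n \<ge> 1 \<Longrightarrow> jacobi_op J f n = z * f n"
  shows "f (int n) = sol_fw J z (f 0) (f 1) n"
proof (induction n rule: induct_nat_012)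
  case (ge2 k)
  define n where n: "n = Suc (Suc k)"
  have "jacobi_op J f (int k + 1) = z * f (int k + 1)" by (rule f) simp
    then have "of_real (coeff_a J (int k + 1)) * f (int n) = (z - of_real (coeff_b J (int k + 1))) * f (int (Suc k)) - of_real (coeff_a J (int k)) * f (int k)"
      by (simp add: jacobi_op_def n algebra_simps)
  then show ?case using ge2 a[of "int k + 1"] n
    by (simp add: field_simps)
qed auto

lemma sol_unique:
  assumes a: "\<And>n. coeff_a J n > 0" and f: "\<And>n. jacobi_op J f n = z * f n"
  shows "f n = sol J z (f 0) (f 1) n"
proof (cases "n \<ge> 0")
  case True
  then show ?thesis using sol_fw_unique[OF a f, of "nat n"] by (simp add: sol_def)
next
  case False
  have "jacobi_op (reflect J) (\<lambda>n. f (1 - n)) k = z * f (1 - k)" for k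
    using f by (simp add: jacobi_op_reflect)
  from sol_fw_unique[OF _ this, of "nat (1 - n)"] show ?thesis using False a
    by (simp add: sol_def)
qed

lemma sol_fw_linear: "sol_fw J z (c * u0 + d * v0) (c * u1 + d * v1) n = c * sol_fw J z u0 u1 n + d * sol_fw J z v0 v1 n"
  by (induction n rule: induct_nat_012) (auto simp: add_divide_distrib diff_divide_distrib algebra_simps)

lemma sol_linear: "sol J z (c * u0 + d * v0) (c * u1 + d * v1) n = c * sol J z u0 u1 n + d * sol J z v0 v1 n"
  by (simp add: sol_def sol_fw_linear)

lemma sol_basis: "sol J z u0 u1 n = u0 * sol J z 1 0 n + u1 * sol J z 0 1 n"
  using sol_linear[of J z u0 1 u1 0 0 1 n] by simp

lemma sol_scale: "sol J z (c * u0) (c * u1) n = c * sol J z u0 u1 n"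
  using sol_linear[of J z c u0 0 0 u1 0 n] by simp

lemma cnj_sol_fw: "cnj (sol_fw J z u0 u1 n) = sol_fw J (cnj z) (cnj u0) (cnj u1) n"
  by (induction J z u0 u1 n rule: sol_fw.induct) auto

lemma cnj_sol: "cnj (sol J z u0 u1 n) = sol J (cnj z) (cnj u0) (cnj u1) n"
  by (simp add: sol_def cnj_sol_fw)

text \<open>Joint continuity in the coefficients, the spectral parameter and the initial values. The
  filter is arbitrary because this is applied both along sequences of Jacobi matrices and to
  continuity in the pair of time and spectral parameter.\<close>

lemma sol_fw_tendsto:
  assumes "\<And>n. ((\<lambda>t. coeff_a (Jt t) n) \<longlongrightarrow> coeff_a J n) F" "\<And>n. ((\<lambda>t. coeff_b (Jt t) n) \<longlongrightarrow> coeff_b J n) F"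
    and "\<And>n. coeff_a J n > 0" and "(zt \<longlongrightarrow> z) F" "(u \<longlongrightarrow> u0) F" "(v \<longlongrightarrow> u1) F"
  shows "((\<lambda>t. sol_fw (Jt t) (zt t) (u t) (v t) n) \<longlongrightarrow> sol_fw J z u0 u1 n) F"
proof (induction n rule: induct_nat_012)
  case (ge2 k)
  have "coeff_a J (int k + 1) \<noteq> 0" using assms(3)[of "int k + 1"] by simp
  then show ?case unfolding sol_fw.simps by (intro tendsto_intros assms ge2) auto
qed (use assms in auto)

lemma sol_tendsto:
  assumes "\<And>n. ((\<lambda>t. coeff_a (Jt t) n) \<longlongrightarrow> coeff_a J n) F" "\<And>n. ((\<lambda>t. coeff_b (Jt t) n) \<longlongrightarrow> coeff_b J n) F"
    and "\<And>n. coeff_a J n > 0" and "(zt \<longlongrightarrow> z) F" "(u \<longlongrightarrow> u0) F" "(v \<longlongrightarrow> u1) F"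
  shows "((\<lambda>t. sol (Jt t) (zt t) (u t) (v t) n) \<longlongrightarrow> sol J z u0 u1 n) F"
  unfolding sol_def
  using sol_fw_tendsto[of Jt J F zt z u u0 v u1 "nat n"] 
    sol_fw_tendsto[of "\<lambda>t. reflect (Jt t)" "reflect J" F zt z v u1 u u0 "nat (1 - n)"] assms by simp

lemma sol_fw_holomorphic: "(\<And>n. coeff_a J n > 0) \<Longrightarrow> (\<lambda>z. sol_fw J z u0 u1 n) holomorphic_on S"
proof (induction n rule: induct_nat_012)
  case (ge2 k)
  have "coeff_a J (int k + 1) \<noteq> 0" using ge2(3)[of "int k + 1"] by simp
  then show ?case unfolding sol_fw.simps using ge2 by (intro holomorphic_intros) auto
qed auto

section \<open>Green's identity\<close>

text \<open>The Wronskian of \<open>cnj f\<close> and \<open>f\<close> divided by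
  \<open>2 i\<close>.\<close>

definition wr_im :: "jacobi \<Rightarrow> (int \<Rightarrow> complex) \<Rightarrow> int \<Rightarrow> real" where
  "wr_im J f n = coeff_a J n * Im (cnj (f n) * f (n + 1))"

text \<open>The sequence \<open>f\<close> is arbitrary: the last term vanishes for Weyl solutions
  and carries the inhomogeneity in \<open>resolvent_bound\<close>.\<close>

lemma Green_local:
  "Im z * (cmod (f n))\<^sup>2 = wr_im J f n - wr_im J f (n - 1) - Im (cnj (f n) * (jacobi_op J f n - z * f n))"
proof -
  have "(cmod (f n))\<^sup>2 = Re (f n) * Re (f n) + Im (f n) * Im (f n)"
    unfolding cmod_power2 by (simp add: power2_eq_square)
  then show ?thesis by (simp add: wr_im_def jacobi_op_def algebra_simps)
qed

lemma Green_sum: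
  assumes "m \<le> n"
  shows "Im z * (\<Sum>k\<in>{m<..n}. (cmod (f k))\<^sup>2) =
     wr_im J f n - wr_im J f m - (\<Sum>k\<in>{m<..n}. Im (cnj (f k) * (jacobi_op J f k - z * f k)))"
  using assms
proof (induction n rule: int_ge_induct)
  case base show ?case by simp
next
  case (step n)
  have "{m<..n + 1} = insert (n + 1) {m<..n}" using step(1) by auto
  then show ?case using step(2) Green_local[of z f "n + 1" J] by (simp add: algebra_simps)
qed

lemma Green_eigen:
  assumes "m \<le> n" "\<And>k. jacobi_op J f k = z * f k"
  shows "Im z * (\<Sum>k\<in>{m<..n}. (cmod (f k))\<^sup>2) = wr_im J f n - wr_im J f m"
  using Green_sum[OF assms(1), of z f J] assms(2) by simp

text \<open>Membership of \<open>m\<close> in the closed Weyl disk of the interval from 1 to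
  \<open>N\<close>; the solution is normalised so that \<open>m = - a 0 * f 1 / f 0\<close>. Only
  finitely many coefficients enter, so the condition passes to limits of \<open>J\<close> and
  \<open>m\<close> together, and \<open>m_plus\<close> is the single point common to all
  disks.\<close>

definition weyl :: "jacobi \<Rightarrow> complex \<Rightarrow> nat \<Rightarrow> complex \<Rightarrow> bool" where
  "weyl J z N m \<longleftrightarrow> Im z * (\<Sum>k\<in>{0<..int N}. (cmod (sol J z 1 (- m / of_real (coeff_a J 0)) k))\<^sup>2) \<le> Im m"

lemma weyl_iff_wr_im:
  assumes a: "\<And>n. coeff_a J n > 0"
  shows "weyl J z N m \<longleftrightarrow> wr_im J (sol J z 1 (- m / of_real (coeff_a J 0))) (int N) \<le> 0"
proof -
  have "wr_im J (sol J z 1 (- m / of_real (coeff_a J 0))) 0 = - Im m"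
    using a[of 0] by (simp add: wr_im_def Im_divide_of_real)
  then show ?thesis unfolding weyl_def
    using Green_eigen[OF _ jacobi_op_sol[OF a], of 0 "int N" z 1 "- m / of_real (coeff_a J 0)"] by auto
qed

text \<open>The term \<open>k = 1\<close> of the sum is \<open>|m|^2 / (a 0)^2\<close>, and this
  alone confines the disk.\<close>

lemma weyl_bound:
  assumes a: "\<And>n. coeff_a J n > 0" and z: "Im z > 0" and "weyl J z N m" "N \<ge> 1"
  shows "Im z * (cmod m)\<^sup>2 / (coeff_a J 0)\<^sup>2 \<le> Im m" "cmod m \<le> (coeff_a J 0)\<^sup>2 / Im z"
proof -
  let ?f = "sol J z 1 (- m / of_real (coeff_a J 0))"
  have "(cmod (?f 1))\<^sup>2 \<le> (\<Sum>k\<in>{0<..int N}. (cmod (?f k))\<^sup>2)"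
    using assms(4) by (intro member_le_sum) auto
  then have "Im z * (cmod (?f 1))\<^sup>2 \<le> Im m"
    using assms(3) z unfolding weyl_def by (meson mult_left_mono less_imp_le order_trans)
  then show *: "Im z * (cmod m)\<^sup>2 / (coeff_a J 0)\<^sup>2 \<le> Im m"
    by (simp add: norm_divide power_divide)
  have "Im z * (cmod m)\<^sup>2 / (coeff_a J 0)\<^sup>2 \<le> cmod m" using * abs_Im_le_cmod[of m] by linarith
  then have "cmod m * (Im z * cmod m) \<le> cmod m * (coeff_a J 0)\<^sup>2"
    using a[of 0] by (simp add: field_simps power2_eq_square)
  then show "cmod m \<le> (coeff_a J 0)\<^sup>2 / Im z"
    using z by (cases "m = 0") (auto simp: field_simps)
qed

lemma weyl_limit:
  assumes "\<And>n. (\<lambda>k. coeff_a (Js k) n) \<longlonglongrightarrow> coeff_a J n" "\<And>n. (\<lambda>k. coeff_b (Js k) n) \<longlonglongrightarrow> coeff_b J n"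
    and a: "\<And>n. coeff_a J n > 0" and w: "\<forall>\<^sub>F k in sequentially. weyl (Js k) z N (ms k)" and m: "ms \<longlonglongrightarrow> m"
  shows "weyl J z N m"
proof -
  have "(\<lambda>k. sol (Js k) z 1 (- ms k / of_real (coeff_a (Js k) 0)) n) \<longlonglongrightarrow> sol J z 1 (- m / of_real (coeff_a J 0)) n" for n
    using a[of 0] by (intro sol_tendsto tendsto_intros assms) auto
  then have "(\<lambda>k. Im z * (\<Sum>n\<in>{0<..int N}. (cmod (sol (Js k) z 1 (- ms k / of_real (coeff_a (Js k) 0)) n))\<^sup>2))
     \<longlonglongrightarrow> Im z * (\<Sum>n\<in>{0<..int N}. (cmod (sol J z 1 (- m / of_real (coeff_a J 0)) n))\<^sup>2)"
    by (intro tendsto_intros)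
  from tendsto_le[OF sequentially_bot tendsto_Im[OF m] this] w show ?thesis
    unfolding weyl_def by simp
qed

text \<open>The value of \<open>m\<close> for which the normalised solution vanishes at
  \<open>N + 1\<close>, that is, the \<open>m\<close> function of a finite matrix. It is rational in
  \<open>z\<close>, which is the source of the holomorphy of \<open>m_plus\<close>.\<close>

definition weyl_m :: "jacobi \<Rightarrow> nat \<Rightarrow> complex \<Rightarrow> complex" where
  "weyl_m J N z = of_real (coeff_a J 0) * sol J z 1 0 (int N + 1) / sol J z 0 1 (int N + 1)"

text \<open>A zero would make the nonreal \<open>z\<close> an eigenvalue of a finite symmetric
  matrix; Green's identity with vanishing boundary terms excludes this.\<close>

lemma sol_Dirichlet_nonzero:
  assumes a: "\<And>n. coeff_a J n > 0" and z: "Im z > 0"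
  shows "sol J z 0 1 (int N + 1) \<noteq> 0"
proof
  assume 0: "sol J z 0 1 (int N + 1) = 0"
  have "N \<noteq> 0"
  proof
    assume "N = 0" with 0 show False by simp
  qed
  have "Im z * (\<Sum>k\<in>{0<..int N}. (cmod (sol J z 0 1 k))\<^sup>2) = 0"
    using Green_eigen[OF _ jacobi_op_sol[OF a], of 0 "int N" z 0 1] 0 by (simp add: wr_im_def)
  then have "(\<Sum>k\<in>{0<..int N}. (cmod (sol J z 0 1 k))\<^sup>2) = 0" using z by simp
  moreover have "(cmod (sol J z 0 1 1))\<^sup>2 \<le> (\<Sum>k\<in>{0<..int N}. (cmod (sol J z 0 1 k))\<^sup>2)"
    using \<open>N \<noteq> 0\<close> by (intro member_le_sum) auto
  ultimately show False by simp
qed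

text \<open>By Green's identity \<open>wr_im\<close> increases along a solution when
  \<open>Im z > 0\<close>. It is 0 at \<open>N\<close>, because the solution vanishes at
  \<open>N + 1\<close>, and so it is at most 0 at every \<open>n \<le> N\<close>: the disks are
  nested.\<close>

lemma weyl_weyl_m:
  assumes a: "\<And>n. coeff_a J n > 0" and z: "Im z > 0" and "n \<le> N"
  shows "weyl J z n (weyl_m J N z)"
proof -
  define m where "m = weyl_m J N z"
  define f where "f = sol J z 1 (- m / of_real (coeff_a J 0))"
  have fN: "f (int N + 1) = 0"
    unfolding f_def m_def weyl_m_def sol_basis[of J z 1 "- (_ :: complex) / _"]
    using sol_Dirichlet_nonzero[OF a z, of N] a[of 0] by simp
  then have "wr_im J f (int N) = 0" by (simp add: wr_im_def)
  moreover have "Im z * (\<Sum>k\<in>{int n<..int N}. (cmod (f k))\<^sup>2) = wr_im J f (int N) - wr_im J f (int n)"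
    unfolding f_def using \<open>n \<le> N\<close> by (intro Green_eigen jacobi_op_sol a) auto
  moreover have "0 \<le> Im z * (\<Sum>k\<in>{int n<..int N}. (cmod (f k))\<^sup>2)"
    using z by (intro mult_nonneg_nonneg sum_nonneg) auto
  ultimately show ?thesis unfolding weyl_iff_wr_im[OF a] f_def[symmetric] m_def[symmetric] by simp
qed

section \<open>Square summable solutions and uniqueness of the Weyl point\<close>

definition l2_plus :: "jacobi \<Rightarrow> complex \<Rightarrow> (int \<Rightarrow> complex) \<Rightarrow> bool" where
  "l2_plus J z f \<longleftrightarrow> eigen_solution J z f \<and> (\<lambda>n. (cmod (f n))\<^sup>2) summable_on {0..}"

lemma summable_on_int_nat:
  fixes g :: "int \<Rightarrow> real"
  assumes "\<And>n. g n \<ge> 0"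
  shows "g summable_on {0..} \<longleftrightarrow> summable (\<lambda>n. g (int n))"
proof -
  have "bij_betw int UNIV {0..}"
    by (auto simp: bij_betw_def inj_on_def image_def) (metis nonneg_int_cases)
  then have "g summable_on {0..} \<longleftrightarrow> (\<lambda>n. g (int n)) summable_on UNIV"
    by (rule summable_on_reindex_bij_betw[symmetric])
  then show ?thesis using assms by (simp add: summable_on_UNIV_nonneg_real_iff)
qed

lemma l2_tendsto_0:
  assumes "(\<lambda>n. (cmod (f n))\<^sup>2) summable_on {0..}"
  shows "(\<lambda>n. f (int n)) \<longlonglongrightarrow> 0"
proof -
  have "summable (\<lambda>n. (cmod (f (int n)))\<^sup>2)"
    using assms summable_on_int_nat[of "\<lambda>n. (cmod (f n))\<^sup>2"] by simp
  then have "(\<lambda>n. (cmod (f (int n)))\<^sup>2) \<longlonglongrightarrow> 0" by (rule summable_LIMSEQ_zero)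
  then have "(\<lambda>n. sqrt ((cmod (f (int n)))\<^sup>2)) \<longlonglongrightarrow> sqrt 0" by (intro tendsto_intros)
  then show ?thesis by (simp add: tendsto_norm_zero_iff)
qed

lemma bounded_jacobi_coeff_bound:
  assumes "bounded_jacobi J"
  obtains C where "C > 0" "\<And>n. coeff_a J n \<le> C" "\<And>n. \<bar>coeff_b J n\<bar> \<le> C"
proof -
  obtain A where A: "\<And>n. \<bar>coeff_a J n\<bar> \<le> A" using assms unfolding bounded_jacobi_def bounded_iff by auto
  obtain B where B: "\<And>n. \<bar>coeff_b J n\<bar> \<le> B" using assms unfolding bounded_jacobi_def bounded_iff by auto
  show thesis
  proof (rule that[of "max 1 (max A B)"])
    show "coeff_a J n \<le> max 1 (max A B)" for n using A[of n] by linarith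
    show "\<bar>coeff_b J n\<bar> \<le> max 1 (max A B)" for n using B[of n] by linarith
  qed simp
qed

lemma coeff_a_mult_tendsto_0:
  assumes "bounded_jacobi J" "g \<longlonglongrightarrow> 0"
  shows "(\<lambda>n. of_real (coeff_a J (h n)) * g n :: complex) \<longlonglongrightarrow> 0"
proof -
  obtain C where C: "C > 0" "\<And>n. coeff_a J n \<le> C" using bounded_jacobi_coeff_bound[OF assms(1)] by metis
  show ?thesis
  proof (rule Lim_null_comparison[where g = "\<lambda>n. C * norm (g n)"])
    show "\<forall>\<^sub>F n in sequentially. norm (of_real (coeff_a J (h n)) * g n) \<le> C * norm (g n)"
      using C(2) coeff_a_pos[OF assms(1)] by (intro always_eventually) (auto simp: norm_mult abs_of_pos intro!: mult_right_mono)
    show "(\<lambda>n. C * norm (g n)) \<longlonglongrightarrow> 0" using assms(2) tendsto_mult_right_zero tendsto_norm_zero by blast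
  qed
qed

lemma wr_im_tendsto_0:
  assumes "bounded_jacobi J" "(\<lambda>n. (cmod (f n))\<^sup>2) summable_on {0..}"
  shows "(\<lambda>n. wr_im J f (int n)) \<longlonglongrightarrow> 0"
proof -
  have 1: "(\<lambda>n. f (int n)) \<longlonglongrightarrow> 0" by (rule l2_tendsto_0[OF assms(2)])
  then have "(\<lambda>n. cnj (f (int n)) * f (int (Suc n))) \<longlonglongrightarrow> cnj 0 * 0"
    by (intro tendsto_mult tendsto_cnj 1 LIMSEQ_Suc[OF 1])
  then have "(\<lambda>n. of_real (coeff_a J (int n)) * (cnj (f (int n)) * f (int (Suc n)))) \<longlonglongrightarrow> 0"
    by (intro coeff_a_mult_tendsto_0[OF assms(1)]) simp
  then have "(\<lambda>n. Im (of_real (coeff_a J (int n)) * (cnj (f (int n)) * f (int (Suc n))))) \<longlonglongrightarrow> Im 0"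
    by (rule tendsto_Im)
  then show ?thesis by (simp add: wr_im_def add.commute algebra_simps)
qed

lemma eigen_solution_zero:
  assumes a: "\<And>n. coeff_a J n > 0" and f: "eigen_solution J z f" and "f k = 0" "f (k + 1) = 0"
  shows False
proof -
  have eq: "jacobi_op J f n = z * f n" for n using f by (simp add: eigen_solution_def)
  have up: "f n = 0 \<and> f (n + 1) = 0" if "n \<ge> k" for n using that
  proof (induction n rule: int_ge_induct)
    case (step n)
    then show ?case using eq[of "n + 1"] a[of "n + 1"] by (simp add: jacobi_op_def)
  qed (use assms in auto)
  have down: "f n = 0 \<and> f (n + 1) = 0" if "n \<le> k" for n using that
  proof (induction n rule: int_le_induct)
    case (step n)
    then show ?case using eq[of n] a[of "n - 1"] by (simp add: jacobi_op_def)
  qed (use assms in auto)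
  have "f n = 0" for n using up[of n] down[of n] by linarith
  with f show False by (simp add: eigen_solution_def)
qed

text \<open>Along the solution \<open>wr_im\<close> increases, and it tends to 0 at infinity, so it
  is nowhere positive. Were it 0 at \<open>n\<close>, the solution would vanish at two neighbouring
  sites and hence everywhere.\<close>

lemma l2_plus_wr_im:
  assumes J: "bounded_jacobi J" and z: "Im z > 0" and f: "l2_plus J z f"
  shows "wr_im J f n < 0" "Im z * (\<Sum>k\<in>{n<..n + int N}. (cmod (f k))\<^sup>2) \<le> - wr_im J f n"
proof -
  have eq: "jacobi_op J f n = z * f n" for n using f by (simp add: l2_plus_def eigen_solution_def)
  have lim: "(\<lambda>n. wr_im J f (int n)) \<longlonglongrightarrow> 0" using f unfolding l2_plus_def by (intro wr_im_tendsto_0 J) auto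
  have mono: "wr_im J f m \<le> wr_im J f n" if "m \<le> n" for m n
  proof -
    have "0 \<le> Im z * (\<Sum>k\<in>{m<..n}. (cmod (f k))\<^sup>2)" using z by (intro mult_nonneg_nonneg sum_nonneg) auto
    then show ?thesis using Green_eigen[OF that eq] by simp
  qed
  have le: "wr_im J f n \<le> 0" for n
  proof (rule tendsto_lowerbound[OF lim])
    show "\<forall>\<^sub>F k in sequentially. wr_im J f n \<le> wr_im J f (int k)"
      unfolding eventually_sequentially by (intro exI[of _ "nat \<bar>n\<bar>"] allI impI mono) auto
  qed simp
  show sum: "Im z * (\<Sum>k\<in>{n<..n + int N}. (cmod (f k))\<^sup>2) \<le> - wr_im J f n" for N
    using Green_eigen[OF _ eq, of n "n + int N"] le[of "n + int N"] by simp
  show "wr_im J f n < 0"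
  proof (rule ccontr)
    assume "\<not> wr_im J f n < 0"
    with sum[of 2] have "Im z * (\<Sum>k\<in>{n<..n + 2}. (cmod (f k))\<^sup>2) \<le> 0" by simp
    moreover have "{n<..n + 2} = {n + 1, n + 2}" by auto
    ultimately have "Im z * ((cmod (f (n + 1)))\<^sup>2 + (cmod (f (n + 1 + 1)))\<^sup>2) \<le> 0" by (simp add: add.assoc)
    then have "(cmod (f (n + 1)))\<^sup>2 + (cmod (f (n + 1 + 1)))\<^sup>2 \<le> 0"
      using z by (simp add: mult_le_0_iff)
    then have "f (n + 1) = 0 \<and> f (n + 1 + 1) = 0"
      by (simp add: sum_power2_le_zero_iff)
    then show False using eigen_solution_zero[OF coeff_a_pos[OF J]] f unfolding l2_plus_def by blast
  qed
qed

lemma l2_plus_nonzero: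
  assumes "bounded_jacobi J" "Im z > 0" "l2_plus J z f" shows "f n \<noteq> 0"
  using l2_plus_wr_im(1)[OF assms, of n] by (auto simp: wr_im_def)

lemma l2_plus_normalized:
  assumes J: "bounded_jacobi J" and z: "Im z > 0" and f: "l2_plus J z f"
  shows "f n / f 0 = sol J z 1 (- (- of_real (coeff_a J 0) * f 1 / f 0) / of_real (coeff_a J 0)) n"
proof -
  have a: "\<And>n. coeff_a J n > 0" using coeff_a_pos[OF J] .
  have "f n = sol J z (f 0) (f 1) n"
    using f by (intro sol_unique a) (auto simp: l2_plus_def eigen_solution_def)
  then have "f n / f 0 = sol J z (inverse (f 0) * f 0) (inverse (f 0) * f 1) n"
    unfolding sol_scale by (simp add: field_simps)
  then show ?thesis using a[of 0] l2_plus_nonzero[OF assms] by (simp add: field_simps)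
qed

lemma l2_plus_weyl:
  assumes J: "bounded_jacobi J" and z: "Im z > 0" and f: "l2_plus J z f"
  shows "weyl J z N (- of_real (coeff_a J 0) * f 1 / f 0)"
proof -
  define g where "g n = f n / f 0" for n
  have "g = sol J z 1 (- (- of_real (coeff_a J 0) * f 1 / f 0) / of_real (coeff_a J 0))"
    unfolding g_def using l2_plus_normalized[OF assms] by blast
  moreover have "l2_plus J z g"
  proof -
    have "(\<lambda>n. (cmod (f n))\<^sup>2 * (1 / (cmod (f 0))\<^sup>2)) summable_on {0..}"
      using f unfolding l2_plus_def by (intro summable_on_cmult_left) auto
    moreover have "eigen_solution J z g"
      using f l2_plus_nonzero[OF assms] unfolding l2_plus_def eigen_solution_def g_def jacobi_op_def
      by (auto simp: add_divide_distrib[symmetric])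
    ultimately show ?thesis by (simp add: l2_plus_def g_def norm_divide power_divide)
  qed
  ultimately show ?thesis using l2_plus_wr_im(1)[OF J z, of g "int N"] weyl_iff_wr_im[OF coeff_a_pos[OF J]] by simp
qed

text \<open>The defining inequality of the disks bounds the partial sums by
  \<open>Im m / Im z\<close>, independently of \<open>N\<close>.\<close>

lemma weyl_l2_plus:
  assumes a: "\<And>n. coeff_a J n > 0" and z: "Im z > 0" and w: "\<And>N. weyl J z N m"
  shows "l2_plus J z (sol J z 1 (- m / of_real (coeff_a J 0)))"
proof -
  let ?f = "sol J z 1 (- m / of_real (coeff_a J 0))"
  have "summable (\<lambda>n. (cmod (?f (int n)))\<^sup>2)"
  proof (rule bounded_imp_summable)
    show "(\<Sum>k\<le>n. (cmod (?f (int k)))\<^sup>2) \<le> 1 + Im m / Im z" for n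
    proof -
      have "(\<Sum>k\<le>n. (cmod (?f (int k)))\<^sup>2) = (cmod (?f 0))\<^sup>2 + (\<Sum>k\<in>{0<..n}. (cmod (?f (int k)))\<^sup>2)"
        by (subst sum.remove[of _ 0]) (auto intro!: sum.cong)
      also have "(\<Sum>k\<in>{0<..n}. (cmod (?f (int k)))\<^sup>2) = (\<Sum>k\<in>{0<..int n}. (cmod (?f k))\<^sup>2)"
        by (rule sum.reindex_bij_witness[of _ nat int]) auto
      also have "\<dots> \<le> Im m / Im z"
        using w[of n] z by (simp add: weyl_def pos_le_divide_eq mult.commute)
      finally show ?thesis by simp
    qed
  qed simp
  then have "(\<lambda>n. (cmod (?f n))\<^sup>2) summable_on {0..}"
    using summable_on_int_nat[of "\<lambda>n. (cmod (?f n))\<^sup>2"] by simp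
  moreover have "eigen_solution J z ?f" unfolding eigen_solution_def
    using jacobi_op_sol[OF a] by (auto intro!: exI[of _ 0])
  ultimately show ?thesis by (simp add: l2_plus_def)
qed

lemma wronskian_const:
  assumes f: "\<And>n. jacobi_op J f n = z * f n" and g: "\<And>n. jacobi_op J g n = z * g n"
  shows "of_real (coeff_a J n) * (f (n + 1) * g n - f n * g (n + 1)) = of_real (coeff_a J 0) * (f 1 * g 0 - f 0 * g 1)"
proof -
  define w where "w n = of_real (coeff_a J n) * (f (n + 1) * g n - f n * g (n + 1))" for n
  have step: "w n = w (n - 1)" for n
  proof -
    have "jacobi_op J f n * g n = f n * jacobi_op J g n" using f g by simp
    then show ?thesis by (simp add: w_def jacobi_op_def algebra_simps)
  qed
  have "w n = w 0"
  proof (induction n rule: int_induct[of _ 0])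
    case (step1 i) then show ?case using step[of "i + 1"] by simp
  next
    case (step2 i) then show ?case using step[of i] by simp
  qed simp
  then show ?thesis by (simp add: w_def)
qed

text \<open>The limit point case. The Wronskian of two square summable solutions is constant, and it
  tends to 0 because \<open>a\<close> is bounded. At site 0 it is \<open>m' - m\<close> for the
  normalised solutions.\<close>

lemma weyl_unique:
  assumes J: "bounded_jacobi J" and z: "Im z > 0" and "\<And>N. weyl J z N m" "\<And>N. weyl J z N m'"
  shows "m = m'"
proof -
  note a = coeff_a_pos[OF J]
  let ?f = "sol J z 1 (- m / of_real (coeff_a J 0))" and ?g = "sol J z 1 (- m' / of_real (coeff_a J 0))"
  have f: "(\<lambda>n. ?f (int n)) \<longlonglongrightarrow> 0" and g: "(\<lambda>n. ?g (int n)) \<longlonglongrightarrow> 0"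
    using weyl_l2_plus[OF a z] assms(3,4) by (auto simp: l2_plus_def intro!: l2_tendsto_0)
  have "(\<lambda>n. ?f (int (Suc n)) * ?g (int n) - ?f (int n) * ?g (int (Suc n))) \<longlonglongrightarrow> 0 * 0 - 0 * 0"
    by (intro tendsto_intros f g LIMSEQ_Suc[OF f] LIMSEQ_Suc[OF g])
  then have "(\<lambda>n. of_real (coeff_a J (int n)) * (?f (int (Suc n)) * ?g (int n) - ?f (int n) * ?g (int (Suc n)))) \<longlonglongrightarrow> 0"
    by (intro coeff_a_mult_tendsto_0[OF J]) simp
  moreover have "of_real (coeff_a J (int n)) * (?f (int (Suc n)) * ?g (int n) - ?f (int n) * ?g (int (Suc n))) =
      of_real (coeff_a J 0) * (?f 1 * ?g 0 - ?f 0 * ?g 1)" for n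
    using wronskian_const[of J ?f z ?g "int n", OF jacobi_op_sol[OF a] jacobi_op_sol[OF a]] by (simp add: add.commute)
  ultimately have "of_real (coeff_a J 0) * (?f 1 * ?g 0 - ?f 0 * ?g 1) = 0"
    by (simp add: LIMSEQ_const_iff)
  then show ?thesis using a[of 0] by simp
qed

text \<open>Compactness turns the uniqueness of the Weyl point into convergence, of the finite
  approximants \<open>weyl_m\<close> as well as of \<open>m_plus\<close> along converging
  matrices.\<close>

lemma unique_cluster_tendsto:
  fixes ms :: "nat \<Rightarrow> complex"
  assumes bd: "bounded (range ms)" and cl: "\<And>r l. strict_mono r \<Longrightarrow> (ms \<circ> r) \<longlonglongrightarrow> l \<Longrightarrow> l = m"
  shows "ms \<longlonglongrightarrow> m"
proof (rule ccontr)
  assume "\<not> ms \<longlonglongrightarrow> m"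
  then obtain e where e: "e > 0" "\<And>N. \<exists>n\<ge>N. \<not> dist (ms n) m < e" unfolding lim_sequentially by blast
  then have "infinite {n. \<not> dist (ms n) m < e}" by (auto simp: infinite_nat_iff_unbounded_le)
  then obtain r :: "nat \<Rightarrow> nat" where r: "strict_mono r" "\<And>n. r n \<in> {n. \<not> dist (ms n) m < e}"
    using infinite_enumerate by blast
  have "bounded (range (ms \<circ> r))" using bd by (rule bounded_subset) auto
  then obtain l s where s: "strict_mono s" "((ms \<circ> r) \<circ> s) \<longlonglongrightarrow> l"
    using bounded_imp_convergent_subsequence by blast
  then have "(ms \<circ> (r \<circ> s)) \<longlonglongrightarrow> l" by (simp add: o_assoc)
  moreover from this have "l = m" using cl strict_mono_o[OF r(1) s(1)] by blast
  ultimately have "\<forall>\<^sub>F n in sequentially. dist ((ms \<circ> (r \<circ> s)) n) m < e"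
    using e(1) tendstoD by blast
  then obtain n where "dist ((ms \<circ> (r \<circ> s)) n) m < e"
    unfolding eventually_sequentially by blast
  then show False using r(2)[of "s n"] by simp
qed

lemma weyl_m_bound:
  assumes "\<And>n. coeff_a J n > 0" and "Im z > 0"
  shows "cmod (weyl_m J (Suc N) z) \<le> (coeff_a J 0)\<^sup>2 / Im z"
  using weyl_bound(2)[OF assms weyl_weyl_m[OF assms, of 1 "Suc N"]] by simp

lemma weyl_weyl_m_subseq:
  assumes "\<And>n. coeff_a J n > 0" and "Im z > 0" and "strict_mono r"
  shows "\<forall>\<^sub>F k in sequentially. weyl J z N (((\<lambda>N. weyl_m J (Suc N) z) \<circ> r) k)"
  unfolding eventually_sequentially
proof (intro exI[of _ N] allI impI)
  fix k assume "N \<le> k"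
  also have "k \<le> r k" by (rule seq_suble[OF assms(3)])
  finally show "weyl J z N (((\<lambda>N. weyl_m J (Suc N) z) \<circ> r) k)"
    unfolding o_apply by (intro weyl_weyl_m assms) simp
qed

lemma ex_weyl:
  assumes a: "\<And>n. coeff_a J n > 0" and z: "Im z > 0"
  obtains m where "\<And>N. weyl J z N m"
proof -
  have bd: "bounded (range (\<lambda>N. weyl_m J (Suc N) z))"
    using weyl_m_bound[OF a z] by (auto simp: bounded_iff)
  then obtain l r where r: "strict_mono r" "((\<lambda>N. weyl_m J (Suc N) z) \<circ> r) \<longlonglongrightarrow> l"
    using bounded_imp_convergent_subsequence by blast
  have "weyl J z N l" for N
    by (rule weyl_limit[where Js = "\<lambda>_. J", OF tendsto_const tendsto_const a weyl_weyl_m_subseq[OF a z r(1)] r(2)])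
  then show thesis using that by blast
qed

section \<open>The function \<open>m_plus\<close>: positivity, bounds, continuity in
  \<open>J\<close>, holomorphy\<close>

lemma f_plus_l2:
  assumes J: "bounded_jacobi J" and z: "Im z > 0"
  shows "l2_plus J z (f_plus J z)"
proof -
  note a = coeff_a_pos[OF J]
  obtain m where "\<And>N. weyl J z N m" using ex_weyl[OF a z] by blast
  from weyl_l2_plus[OF a z this] have "\<exists>f. l2_plus J z f" by blast
  then show ?thesis unfolding f_plus_def l2_plus_def by (rule someI_ex)
qed

lemma m_plus_weyl: "bounded_jacobi J \<Longrightarrow> Im z > 0 \<Longrightarrow> weyl J z N (m_plus J z)"
  unfolding m_plus_def by (rule l2_plus_weyl[OF _ _ f_plus_l2])

lemma m_plus_eqI: "bounded_jacobi J \<Longrightarrow> Im z > 0 \<Longrightarrow> (\<And>N. weyl J z N m) \<Longrightarrow> m_plus J z = m"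
  using weyl_unique m_plus_weyl by blast

lemma m_plus_eq: "bounded_jacobi J \<Longrightarrow> Im z > 0 \<Longrightarrow> l2_plus J z f \<Longrightarrow> m_plus J z = - of_real (coeff_a J 0) * f 1 / f 0"
  by (intro m_plus_eqI l2_plus_weyl)

lemma Im_m_plus_pos:
  assumes J: "bounded_jacobi J" and z: "Im z > 0"
  shows "Im (m_plus J z) > 0"
proof -
  note f = f_plus_l2[OF assms]
  have "f_plus J z 1 \<noteq> 0" "f_plus J z 0 \<noteq> 0" using l2_plus_nonzero[OF J z f] by auto
  then have "m_plus J z \<noteq> 0" using coeff_a_pos[OF J, of 0] by (simp add: m_plus_def)
  then have "0 < Im z * (cmod (m_plus J z))\<^sup>2 / (coeff_a J 0)\<^sup>2"
    using z coeff_a_pos[OF J, of 0] by simp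
  also have "\<dots> \<le> Im (m_plus J z)"
    using weyl_bound(1)[OF coeff_a_pos[OF J] z m_plus_weyl[OF J z, of 1]] by simp
  finally show ?thesis .
qed

lemma m_plus_bound: "bounded_jacobi J \<Longrightarrow> Im z > 0 \<Longrightarrow> cmod (m_plus J z) \<le> (coeff_a J 0)\<^sup>2 / Im z"
  using weyl_bound(2)[OF coeff_a_pos _ m_plus_weyl, of J z 1] by simp

text \<open>Only the coefficient \<open>a 0\<close> enters the bound of \<open>m_plus\<close>, so
  pointwise convergence of the coefficients already gives bounded values. Every cluster point lies
  in all Weyl disks of the limit matrix.\<close>

lemma m_plus_tendsto:
  assumes Js: "\<And>k. bounded_jacobi (Js k)" and J: "bounded_jacobi J" and z: "Im z > 0"
    and lim: "\<And>n. (\<lambda>k. coeff_a (Js k) n) \<longlonglongrightarrow> coeff_a J n" "\<And>n. (\<lambda>k. coeff_b (Js k) n) \<longlonglongrightarrow> coeff_b J n"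
  shows "(\<lambda>k. m_plus (Js k) z) \<longlonglongrightarrow> m_plus J z"
proof (rule unique_cluster_tendsto)
  have "(\<lambda>k. (coeff_a (Js k) 0)\<^sup>2 / Im z) \<longlonglongrightarrow> (coeff_a J 0)\<^sup>2 / Im z"
    by (intro tendsto_intros lim) (use z in simp)
  then have "bounded (range (\<lambda>k. (coeff_a (Js k) 0)\<^sup>2 / Im z))"
    by (rule convergent_imp_bounded)
  then obtain B where B: "\<And>k. \<bar>(coeff_a (Js k) 0)\<^sup>2 / Im z\<bar> \<le> B" unfolding bounded_iff by auto
  show "bounded (range (\<lambda>k. m_plus (Js k) z))"
    unfolding bounded_iff
  proof (intro exI[of _ B] ballI)
    fix x assume "x \<in> range (\<lambda>k. m_plus (Js k) z)"
    then obtain k where "x = m_plus (Js k) z" by blast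
    then have "norm x \<le> \<bar>(coeff_a (Js k) 0)\<^sup>2 / Im z\<bar>"
      using order_trans[OF m_plus_bound[OF Js z, of k] abs_ge_self] by simp
    then show "norm x \<le> B" using B[of k] by (rule order_trans)
  qed
  fix r l assume r: "strict_mono r" "((\<lambda>k. m_plus (Js k) z) \<circ> r) \<longlonglongrightarrow> l"
  have "weyl J z N l" for N
  proof (rule weyl_limit[where Js = "Js \<circ> r" and ms = "(\<lambda>k. m_plus (Js k) z) \<circ> r"])
    show "(\<lambda>k. coeff_a ((Js \<circ> r) k) n) \<longlonglongrightarrow> coeff_a J n" for n
      using LIMSEQ_subseq_LIMSEQ[OF lim(1) r(1), of n] by (simp add: o_def)
    show "(\<lambda>k. coeff_b ((Js \<circ> r) k) n) \<longlonglongrightarrow> coeff_b J n" for n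
      using LIMSEQ_subseq_LIMSEQ[OF lim(2) r(1), of n] by (simp add: o_def)
  qed (use m_plus_weyl[OF Js z] coeff_a_pos[OF J] r in auto)
  then show "l = m_plus J z" using m_plus_eqI[OF J z] by metis
qed

lemma weyl_m_tendsto:
  assumes J: "bounded_jacobi J" and z: "Im z > 0"
  shows "(\<lambda>N. weyl_m J (Suc N) z) \<longlonglongrightarrow> m_plus J z"
proof (rule unique_cluster_tendsto)
  note a = coeff_a_pos[OF J]
  show "bounded (range (\<lambda>N. weyl_m J (Suc N) z))"
    using weyl_m_bound[OF a z] by (auto simp: bounded_iff)
  fix r l assume r: "strict_mono r" "((\<lambda>N. weyl_m J (Suc N) z) \<circ> r) \<longlonglongrightarrow> l"
  have "weyl J z N l" for N
    by (rule weyl_limit[where Js = "\<lambda>_. J", OF tendsto_const tendsto_const a weyl_weyl_m_subseq[OF a z r(1)] r(2)])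
  then show "l = m_plus J z" using m_plus_eqI[OF J z] by metis
qed

text \<open>The rational functions \<open>weyl_m\<close> are locally bounded, so by Montel's theorem
  a subsequence converges to a holomorphic function. The pointwise limit identifies it as
  \<open>m_plus\<close>.\<close>

lemma m_plus_holomorphic:
  assumes J: "bounded_jacobi J"
  shows "m_plus J holomorphic_on {z. Im z > 0}"
proof -
  note a = coeff_a_pos[OF J]
  let ?H = "{z. Im z > 0}"
  obtain g r where g: "g holomorphic_on ?H" "strict_mono (r :: nat \<Rightarrow> nat)"
    "\<And>x. x \<in> ?H \<Longrightarrow> (\<lambda>n. weyl_m J (Suc (r n)) x) \<longlonglongrightarrow> g x"
  proof (rule Montel[of ?H "range (\<lambda>N. weyl_m J (Suc N))" "\<lambda>N. weyl_m J (Suc N)"])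
    show "open ?H" by (rule open_halfspace_Im_gt)
    show "h holomorphic_on ?H" if hr: "h \<in> range (\<lambda>N. weyl_m J (Suc N))" for h
    proof -
      obtain N where h: "h = weyl_m J (Suc N)" using hr by auto
      have "(\<lambda>z. sol J z u0 u1 (int (Suc N) + 1)) holomorphic_on ?H" for u0 u1
        unfolding sol_def using sol_fw_holomorphic[OF a] by simp
      then show ?thesis unfolding h weyl_m_def[abs_def]
        using sol_Dirichlet_nonzero[OF a, of _ "Suc N"] by (intro holomorphic_intros) auto
    qed
    show "\<exists>B. \<forall>h\<in>range (\<lambda>N. weyl_m J (Suc N)). \<forall>z\<in>K. norm (h z) \<le> B" if K: "compact K" "K \<subseteq> ?H" for K
    proof (cases "K = {}")
      case False
      obtain z0 where z0: "z0 \<in> K" "\<And>z. z \<in> K \<Longrightarrow> Im z0 \<le> Im z"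
        using continuous_attains_inf[OF K(1) False continuous_on_Im[OF continuous_on_id]] by auto
      show ?thesis
      proof (intro exI[of _ "(coeff_a J 0)\<^sup>2 / Im z0"] ballI)
        fix h z assume "h \<in> range (\<lambda>N. weyl_m J (Suc N))" "z \<in> K"
        then obtain N where h: "h = weyl_m J (Suc N)" by auto
        have z: "Im z > 0" "Im z0 > 0" using \<open>z \<in> K\<close> z0 K by auto
        have "norm (h z) \<le> (coeff_a J 0)\<^sup>2 / Im z"
          unfolding h by (rule weyl_m_bound[OF a z(1)])
        also have "\<dots> \<le> (coeff_a J 0)\<^sup>2 / Im z0" using z z0(2)[OF \<open>z \<in> K\<close>] by (intro divide_left_mono) auto
        finally show "norm (h z) \<le> (coeff_a J 0)\<^sup>2 / Im z0" .
      qed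
    qed auto
  qed (auto simp: o_def)
  have "g x = m_plus J x" if "x \<in> ?H" for x
    using LIMSEQ_unique[OF g(3)[OF that]] LIMSEQ_subseq_LIMSEQ[OF weyl_m_tendsto[OF J, of x] g(2)] that
    by (simp add: o_def)
  then show ?thesis by (rule holomorphic_transform[OF g(1)])
qed

section \<open>The left half line\<close>

lemma l2_minus_reflect:
  "eigen_solution J z f \<and> (\<lambda>n. (cmod (f n))\<^sup>2) summable_on {..0} \<longleftrightarrow> l2_plus (reflect J) z (\<lambda>n. f (1 - n))"
proof -
  have r: "(\<exists>n. P (1 - n)) \<longleftrightarrow> (\<exists>n. P n)" "(\<forall>n. P (1 - n)) \<longleftrightarrow> (\<forall>n. P n)" for P :: "int \<Rightarrow> bool"
  proof -
    have "surj (\<lambda>n::int. 1 - n)"  by (rule surjI[of _ "\<lambda>n. 1 - n"]) simp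
    then show "(\<exists>n. P (1 - n)) \<longleftrightarrow> (\<exists>n. P n)" "(\<forall>n. P (1 - n)) \<longleftrightarrow> (\<forall>n. P n)"
      unfolding surj_def by metis+
  qed
  have "eigen_solution J z f \<longleftrightarrow> eigen_solution (reflect J) z (\<lambda>n. f (1 - n))"
    unfolding eigen_solution_def jacobi_op_reflect r(1)[of "\<lambda>n. f n \<noteq> 0"] r(2)[of "\<lambda>n. jacobi_op J f n = z * f n"] ..
  moreover have "(\<lambda>n. (cmod (f n))\<^sup>2) summable_on {..0} \<longleftrightarrow> (\<lambda>n. (cmod (f (1 - n)))\<^sup>2) summable_on {0..}"
  proof -
    have "bij_betw (\<lambda>n::int. 1 - n) {0..} {..1}"
      by (rule bij_betw_byWitness[where f' = "\<lambda>n. 1 - n"]) auto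
    then have "(\<lambda>n. (cmod (f (1 - n)))\<^sup>2) summable_on {0..} \<longleftrightarrow> (\<lambda>n. (cmod (f n))\<^sup>2) summable_on {..1}"
      by (rule summable_on_reindex_bij_betw)
    \<comment> \<open>The reflection carries \<open>{0..}\<close> to \<open>{..1}\<close>, one site
      beyond the half line of the definition; a single site does not affect summability.\<close>
    also have "{..1::int} = insert 1 {..0}" by auto
    also have "(\<lambda>n. (cmod (f n))\<^sup>2) summable_on insert 1 {..0} \<longleftrightarrow> (\<lambda>n. (cmod (f n))\<^sup>2) summable_on {..0}"
      by (rule summable_on_insert_iff)
    finally show ?thesis by simp
  qed
  ultimately show ?thesis by (simp add: l2_plus_def)
qed

lemma f_minus_l2:
  assumes "bounded_jacobi J" "Im z > 0"
  shows "l2_plus (reflect J) z (\<lambda>n. f_minus J z (1 - n))"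
proof -
  let ?P = "\<lambda>f. eigen_solution J z f \<and> (\<lambda>n. (cmod (f n))\<^sup>2) summable_on {..0}"
  have "l2_plus (reflect J) z (\<lambda>n. (\<lambda>m. f_plus (reflect J) z (1 - m)) (1 - n))"
    using f_plus_l2[OF bounded_jacobi_reflect[OF assms(1)] assms(2)] by simp
  then have "?P (\<lambda>m. f_plus (reflect J) z (1 - m))" by (rule iffD2[OF l2_minus_reflect])
  then have "?P (f_minus J z)" unfolding f_minus_def by (rule someI[of ?P])
  then show ?thesis by (rule iffD1[OF l2_minus_reflect])
qed

text \<open>Reflection exchanges the values at the sites 0 and 1 and so inverts the quotient. Each
  \<open>m\<close> function carries one factor \<open>a 0\<close>, whence the square.\<close>

lemma m_minus_reflect:
  assumes J: "bounded_jacobi J" and z: "Im z > 0"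
  shows "m_minus J z = - (of_real (coeff_a J 0))\<^sup>2 / m_plus (reflect J) z"
proof -
  note f = f_minus_l2[OF assms]
  note JR = bounded_jacobi_reflect[OF J]
  have 1: "m_plus (reflect J) z = - of_real (coeff_a J 0) * f_minus J z 0 / f_minus J z 1"
    using m_plus_eq[OF JR z f] by simp
  have "f_minus J z 0 \<noteq> 0" "f_minus J z 1 \<noteq> 0"
    using l2_plus_nonzero[OF JR z f, of 1] l2_plus_nonzero[OF JR z f, of 0] by auto
  then show ?thesis unfolding 1 using coeff_a_pos[OF J, of 0]
    by (simp add: m_minus_def field_simps power2_eq_square)
qed

lemma m_plus_nonzero: "bounded_jacobi J \<Longrightarrow> Im z > 0 \<Longrightarrow> m_plus J z \<noteq> 0"
  using Im_m_plus_pos by fastforce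

text \<open>The estimate of \<open>weyl_bound\<close> after inversion. It reflects the growth of
  \<open>m_minus\<close> like \<open>z\<close>, and it is what bounds
  \<open>1 / (m_plus + m_minus)\<close> on \<open>{z. Im z \<ge> e}\<close>.\<close>

lemma Im_m_minus_ge:
  assumes J: "bounded_jacobi J" and z: "Im z > 0"
  shows "Im (m_minus J z) \<ge> Im z"
proof -
  note JR = bounded_jacobi_reflect[OF J]
  define m where "m = m_plus (reflect J) z"
  define c where "c = (coeff_a J 0)\<^sup>2"
  have c: "c > 0" using coeff_a_pos[OF J, of 0] by (simp add: c_def)
  have w: "Im z * (cmod m)\<^sup>2 / c \<le> Im m"
    using weyl_bound(1)[OF coeff_a_pos[OF JR] z m_plus_weyl[OF JR z, of 1]] by (simp add: m_def c_def)
  have m0: "m \<noteq> 0" unfolding m_def by (rule m_plus_nonzero[OF JR z])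
  have "m_minus J z = - of_real c / m" unfolding m_minus_reflect[OF assms] m_def c_def by simp
  then have "Im (m_minus J z) = c * Im m / (cmod m)\<^sup>2" by (simp add: Im_divide cmod_power2)
  then have "Im z * (cmod m)\<^sup>2 \<le> Im (m_minus J z) * (cmod m)\<^sup>2" using w c m0 by (simp add: field_simps)
  then show ?thesis using m0 by (simp add: mult_le_cancel_right)
qed

lemma m_minus_holomorphic:
  assumes J: "bounded_jacobi J"
  shows "m_minus J holomorphic_on {z. Im z > 0}"
proof -
  have "(\<lambda>z. - (of_real (coeff_a J 0))\<^sup>2 / m_plus (reflect J) z) holomorphic_on {z. Im z > 0}"
    using m_plus_nonzero[OF bounded_jacobi_reflect[OF J]]
    by (intro holomorphic_intros m_plus_holomorphic bounded_jacobi_reflect J) auto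
  then show ?thesis by (rule holomorphic_transform) (simp add: m_minus_reflect[OF J])
qed

lemma m_minus_tendsto:
  assumes Js: "\<And>k. bounded_jacobi (Js k)" and J: "bounded_jacobi J" and z: "Im z > 0"
    and lim: "\<And>n. (\<lambda>k. coeff_a (Js k) n) \<longlonglongrightarrow> coeff_a J n" "\<And>n. (\<lambda>k. coeff_b (Js k) n) \<longlonglongrightarrow> coeff_b J n"
  shows "(\<lambda>k. m_minus (Js k) z) \<longlonglongrightarrow> m_minus J z"
  unfolding m_minus_reflect[OF Js z] m_minus_reflect[OF J z]
  using m_plus_nonzero[OF bounded_jacobi_reflect[OF J] z]
  by (intro tendsto_intros lim m_plus_tendsto bounded_jacobi_reflect Js J z) (auto simp: lim)


section \<open>Square summable sequences\<close>

lemma ell2_normI: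
  assumes "\<And>A. finite A \<Longrightarrow> (\<Sum>n\<in>A. (cmod (u n))\<^sup>2) \<le> c\<^sup>2" "c \<ge> 0"
  shows "u \<in> ell2" "ell2_norm u \<le> c"
proof -
  have s: "(\<lambda>n. (cmod (u n))\<^sup>2) summable_on UNIV"
    by (rule nonneg_bdd_above_summable_on) (use assms(1) in \<open>auto intro!: bdd_aboveI2\<close>)
  then show "u \<in> ell2" by (simp add: ell2_def)
  have "(\<Sum>\<^sub>\<infinity>n. (cmod (u n))\<^sup>2) \<le> c\<^sup>2"
    by (rule infsum_le_finite_sums[OF s]) (use assms(1) in auto)
  then show "ell2_norm u \<le> c" unfolding ell2_norm_def using assms(2) by (simp add: real_le_lsqrt)
qed

lemma ell2_norm_nonneg [simp]: "ell2_norm u \<ge> 0"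
  by (simp add: ell2_norm_def infsum_nonneg)

lemma ell2_sum_le:
  assumes "u \<in> ell2" "finite A"
  shows "(\<Sum>n\<in>A. (cmod (u n))\<^sup>2) \<le> (ell2_norm u)\<^sup>2"
proof -
  have "(\<Sum>n\<in>A. (cmod (u n))\<^sup>2) \<le> (\<Sum>\<^sub>\<infinity>n. (cmod (u n))\<^sup>2)"
    using assms by (intro finite_sum_le_infsum) (auto simp: ell2_def)
  then show ?thesis by (simp add: ell2_norm_def infsum_nonneg)
qed

lemma ell2_L2_set_le: "u \<in> ell2 \<Longrightarrow> finite A \<Longrightarrow> L2_set (\<lambda>n. cmod (u n)) A \<le> ell2_norm u"
  unfolding L2_set_def using ell2_sum_le by (intro real_le_lsqrt) (auto intro: sum_nonneg)

lemma ell2_normI':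
  assumes "\<And>A. finite A \<Longrightarrow> L2_set (\<lambda>n. cmod (u n)) A \<le> c"
  shows "u \<in> ell2" "ell2_norm u \<le> c"
proof -
  have c: "c \<ge> 0" using assms[of "{}"] by simp
  have "(\<Sum>n\<in>A. (cmod (u n))\<^sup>2) \<le> c\<^sup>2" if "finite A" for A
    using power_mono[OF assms[OF that], of 2] by (simp add: L2_set_def sum_nonneg)
  then show "u \<in> ell2" "ell2_norm u \<le> c" using ell2_normI c by blast+
qed

lemma ell2_add:
  assumes "u \<in> ell2" "v \<in> ell2"
  shows "(\<lambda>n. u n + v n) \<in> ell2" "ell2_norm (\<lambda>n. u n + v n) \<le> ell2_norm u + ell2_norm v"
proof -
  have "L2_set (\<lambda>n. cmod (u n + v n)) A \<le> ell2_norm u + ell2_norm v" if "finite A" for A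
  proof -
    have "L2_set (\<lambda>n. cmod (u n + v n)) A \<le> L2_set (\<lambda>n. cmod (u n) + cmod (v n)) A"
      by (intro L2_set_mono norm_triangle_ineq) auto
    also have "\<dots> \<le> L2_set (\<lambda>n. cmod (u n)) A + L2_set (\<lambda>n. cmod (v n)) A" by (rule L2_set_triangle_ineq)
    also have "\<dots> \<le> ell2_norm u + ell2_norm v" using assms that by (intro add_mono ell2_L2_set_le)
    finally show ?thesis .
  qed
  then show "(\<lambda>n. u n + v n) \<in> ell2" "ell2_norm (\<lambda>n. u n + v n) \<le> ell2_norm u + ell2_norm v"
    using ell2_normI'[of "\<lambda>n. u n + v n"] by auto
qed

lemma ell2_mult_bounded:
  assumes "u \<in> ell2" "\<And>n. cmod (w n) \<le> K"
  shows "(\<lambda>n. w n * u n) \<in> ell2" "ell2_norm (\<lambda>n. w n * u n) \<le> K * ell2_norm u"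
proof -
  have K: "K \<ge> 0" using order_trans[OF norm_ge_zero assms(2)] .
  have "L2_set (\<lambda>n. cmod (w n * u n)) A \<le> K * ell2_norm u" if "finite A" for A
  proof -
    have "L2_set (\<lambda>n. cmod (w n * u n)) A \<le> L2_set (\<lambda>n. K * cmod (u n)) A"
      using assms(2) by (intro L2_set_mono) (auto simp: norm_mult mult_right_mono)
    also have "\<dots> = K * L2_set (\<lambda>n. cmod (u n)) A" using K by (simp add: L2_set_right_distrib)
    also have "\<dots> \<le> K * ell2_norm u" using assms that K by (intro mult_left_mono ell2_L2_set_le)
    finally show ?thesis .
  qed
  then show "(\<lambda>n. w n * u n) \<in> ell2" "ell2_norm (\<lambda>n. w n * u n) \<le> K * ell2_norm u"
    using ell2_normI'[of "\<lambda>n. w n * u n"] by auto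
qed

lemma ell2_scale:
  assumes "u \<in> ell2"
  shows "(\<lambda>n. c * u n) \<in> ell2" "ell2_norm (\<lambda>n. c * u n) \<le> cmod c * ell2_norm u"
  using ell2_mult_bounded[OF assms, of "\<lambda>_. c" "cmod c"] by auto

lemma ell2_translate:
  assumes "u \<in> ell2" shows "(\<lambda>n. u (n + k)) \<in> ell2"
proof (rule ell2_normI'(1))
  fix A :: "int set" assume "finite A"
  have "(\<Sum>n\<in>A. (cmod (u (n + k)))\<^sup>2) = (\<Sum>n\<in>(\<lambda>n. n + k) ` A. (cmod (u n))\<^sup>2)"
    by (subst sum.reindex) (auto simp: inj_on_def)
  then have "L2_set (\<lambda>n. cmod (u (n + k))) A = L2_set (\<lambda>n. cmod (u n)) ((\<lambda>n. n + k) ` A)"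
    by (simp add: L2_set_def)
  also have "\<dots> \<le> ell2_norm u" using assms \<open>finite A\<close> by (intro ell2_L2_set_le) auto
  finally show "L2_set (\<lambda>n. cmod (u (n + k))) A \<le> ell2_norm u" .
qed

lemma ell2_sum: "finite I \<Longrightarrow> (\<And>i. i \<in> I \<Longrightarrow> u i \<in> ell2) \<Longrightarrow> (\<lambda>n. \<Sum>i\<in>I. u i n) \<in> ell2"
proof (induction I rule: finite_induct)
  case empty then show ?case by (simp add: ell2_def)
next
  case (insert i I) then show ?case using ell2_add(1)[of "u i" "\<lambda>n. \<Sum>i\<in>I. u i n"] by simp
qed

lemma ell2_diff:
  assumes "u \<in> ell2" "v \<in> ell2" shows "(\<lambda>n. u n - v n) \<in> ell2" 
  using ell2_add(1)[OF assms(1) ell2_scale(1)[OF assms(2), of "-1"]] by simp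

lemma unit_seq_ell2: "unit_seq k \<in> ell2"
proof (rule ell2_normI(1)[where c = 1])
  fix A :: "int set" assume "finite A"
  have "(\<Sum>n\<in>A. (cmod (unit_seq k n))\<^sup>2) = (\<Sum>n\<in>A. if n = k then 1 else 0)"
    by (intro sum.cong) (auto simp: unit_seq_def)
  also have "\<dots> \<le> 1" using \<open>finite A\<close> by (simp add: sum.delta)
  finally show "(\<Sum>n\<in>A. (cmod (unit_seq k n))\<^sup>2) \<le> 1\<^sup>2" by simp
qed simp

lemma ell2_component_le:
  assumes "u \<in> ell2" shows "cmod (u n) \<le> ell2_norm u"
  using ell2_L2_set_le[OF assms, of "{n}"] by simp

lemma jacobi_op_ell2:
  assumes "bounded_jacobi J" "u \<in> ell2" shows "jacobi_op J u \<in> ell2"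
proof -
  obtain C where C: "\<And>n. coeff_a J n \<le> C" "\<And>n. \<bar>coeff_b J n\<bar> \<le> C"
    using bounded_jacobi_coeff_bound[OF assms(1)] by metis
  have "(\<lambda>n. of_real (coeff_a J n) * u (n + 1) + of_real (coeff_a J (n - 1)) * u (n + - 1) + of_real (coeff_b J n) * u n) \<in> ell2"
    using C coeff_a_pos[OF assms(1)]
    by (intro ell2_add(1) ell2_mult_bounded(1)[where K = C] ell2_translate assms(2)) (auto simp: abs_of_pos)
  then show ?thesis by (simp add: jacobi_op_def[abs_def])
qed

lemma ell2_tendsto_0:
  assumes "u \<in> ell2" shows "(\<lambda>n. u (int n)) \<longlonglongrightarrow> 0" "(\<lambda>n. u (- int n)) \<longlonglongrightarrow> 0"
proof -
  have u: "(\<lambda>n. (cmod (u n))\<^sup>2) summable_on UNIV" using assms by (simp add: ell2_def)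
  then show "(\<lambda>n. u (int n)) \<longlonglongrightarrow> 0" by (intro l2_tendsto_0 summable_on_subset_banach[OF u]) auto
  have "bij (uminus :: int \<Rightarrow> int)" by (rule bij_uminus)
  then have "(\<lambda>n. (cmod (u (- n)))\<^sup>2) summable_on UNIV"
    using u summable_on_reindex_bij_betw[of uminus UNIV UNIV "\<lambda>n. (cmod (u n))\<^sup>2"] by simp
  then have "(\<lambda>n. (cmod (u (- n)))\<^sup>2) summable_on {0..}" by (rule summable_on_subset_banach) simp
  then show "(\<lambda>n. u (- int n)) \<longlonglongrightarrow> 0" by (rule l2_tendsto_0[of "\<lambda>m. u (- m)"])
qed

text \<open>The bound \<open>1 / Im z\<close> for the norm of the resolvent in a priori form.
  Green's identity on a symmetric window has boundary terms \<open>W N\<close> that tend to 0, and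
  Cauchy-Schwarz estimates the inhomogeneity.\<close>

lemma resolvent_bound:
  assumes J: "bounded_jacobi J" and z: "Im z > 0" and v: "v \<in> ell2"
    and g: "\<And>n. g n = jacobi_op J v n - z * v n"
  shows "Im z * ell2_norm v \<le> ell2_norm g"
proof -
  have gl: "g \<in> ell2" unfolding g[abs_def]
    using jacobi_op_ell2[OF J v] ell2_scale(1)[OF v] by (rule ell2_diff)
  define W where "W N = wr_im J v (int N) - wr_im J v (- int N - 1)" for N
  have W0: "W \<longlonglongrightarrow> 0"
  proof -
    have "(\<lambda>n. cnj (v (int n)) * v (int (Suc n))) \<longlonglongrightarrow> cnj 0 * 0"
      by (intro tendsto_mult tendsto_cnj ell2_tendsto_0(1)[OF v] LIMSEQ_Suc[OF ell2_tendsto_0(1)[OF v]])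
    then have 1: "(\<lambda>n. Im (of_real (coeff_a J (int n)) * (cnj (v (int n)) * v (int (Suc n))))) \<longlonglongrightarrow> Im 0"
      by (intro tendsto_Im coeff_a_mult_tendsto_0[OF J]) simp
    have "(\<lambda>n. cnj (v (- int (Suc n))) * v (- int n)) \<longlonglongrightarrow> cnj 0 * 0"
      by (intro tendsto_mult tendsto_cnj ell2_tendsto_0(2)[OF v] LIMSEQ_Suc[OF ell2_tendsto_0(2)[OF v]])
    then have 2: "(\<lambda>n. Im (of_real (coeff_a J (- int n - 1)) * (cnj (v (- int (Suc n))) * v (- int n)))) \<longlonglongrightarrow> Im 0"
      by (intro tendsto_Im coeff_a_mult_tendsto_0[OF J]) simp
    have 3: "int (Suc n) = int n + 1" "- int (Suc n) = - int n - 1" "- int n = - int n - 1 + 1" for n by auto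
    have R: "Im (of_real r * w) = r * Im w" for r w by simp
    have e1: "Im (of_real (coeff_a J (int n)) * (cnj (v (int n)) * v (int (Suc n)))) = wr_im J v (int n)" for n
      by (simp only: 3(1) wr_im_def R)
    have e2: "Im (of_real (coeff_a J (- int n - 1)) * (cnj (v (- int (Suc n))) * v (- int n))) = wr_im J v (- int n - 1)" for n
      unfolding 3(2) wr_im_def R by simp
    show ?thesis using tendsto_diff[OF 1 2] unfolding W_def[abs_def] e1 e2 by simp
  qed
  have fin: "Im z * (\<Sum>n\<in>A. (cmod (v n))\<^sup>2) \<le> ell2_norm v * ell2_norm g" if A: "finite A" for A
  proof (rule tendsto_lowerbound[where F = sequentially])
    show "(\<lambda>N. ell2_norm v * ell2_norm g + W N) \<longlonglongrightarrow> ell2_norm v * ell2_norm g"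
      using tendsto_add[OF tendsto_const W0] by simp
    obtain M where M: "\<And>n. n \<in> A \<Longrightarrow> \<bar>n\<bar> \<le> M"
      by (rule that[of "\<Sum>n\<in>A. \<bar>n\<bar>"]) (rule member_le_sum, use A in auto)
    show "\<forall>\<^sub>F N in sequentially. Im z * (\<Sum>n\<in>A. (cmod (v n))\<^sup>2) \<le> ell2_norm v * ell2_norm g + W N"
      unfolding eventually_sequentially
    proof (intro exI[of _ "nat M"] allI impI)
      fix N assume N: "nat M \<le> N"
      let ?I = "{- int N - 1<..int N}"
      have "A \<subseteq> ?I" using M N by force
      then have "(\<Sum>n\<in>A. (cmod (v n))\<^sup>2) \<le> (\<Sum>n\<in>?I. (cmod (v n))\<^sup>2)" by (intro sum_mono2) auto
      then have "Im z * (\<Sum>n\<in>A. (cmod (v n))\<^sup>2) \<le> Im z * (\<Sum>n\<in>?I. (cmod (v n))\<^sup>2)"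
        using z by (intro mult_left_mono) auto
      also have "\<dots> = W N - (\<Sum>n\<in>?I. Im (cnj (v n) * g n))"
        unfolding W_def g by (intro Green_sum) simp
      also have "- (\<Sum>n\<in>?I. Im (cnj (v n) * g n)) \<le> ell2_norm v * ell2_norm g"
      proof -
        have "- (\<Sum>n\<in>?I. Im (cnj (v n) * g n)) \<le> \<bar>\<Sum>n\<in>?I. Im (cnj (v n) * g n)\<bar>" by simp
        also have "\<dots> \<le> (\<Sum>n\<in>?I. \<bar>Im (cnj (v n) * g n)\<bar>)" by (rule sum_abs)
        also have "\<dots> \<le> (\<Sum>n\<in>?I. \<bar>cmod (v n)\<bar> * \<bar>cmod (g n)\<bar>)"
          by (intro sum_mono order_trans[OF abs_Im_le_cmod]) (simp add: norm_mult)
        also have "\<dots> \<le> L2_set (\<lambda>n. cmod (v n)) ?I * L2_set (\<lambda>n. cmod (g n)) ?I"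
          by (rule L2_set_mult_ineq)
        also have "\<dots> \<le> ell2_norm v * ell2_norm g"
          using v gl by (intro mult_mono ell2_L2_set_le L2_set_nonneg) auto
        finally show ?thesis .
      qed
      then have "W N - (\<Sum>n\<in>?I. Im (cnj (v n) * g n)) \<le> ell2_norm v * ell2_norm g + W N" by simp
      finally show "Im z * (\<Sum>n\<in>A. (cmod (v n))\<^sup>2) \<le> ell2_norm v * ell2_norm g + W N" .
    qed
  qed simp
  have "ell2_norm v \<le> sqrt (ell2_norm v * ell2_norm g / Im z)"
  proof (rule ell2_normI(2))
    fix A :: "int set" assume "finite A"
    then show "(\<Sum>n\<in>A. (cmod (v n))\<^sup>2) \<le> (sqrt (ell2_norm v * ell2_norm g / Im z))\<^sup>2"
      using fin[of A] z by (simp add: pos_le_divide_eq mult.commute)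
  qed (use z in auto)
  then have "(ell2_norm v)\<^sup>2 \<le> (sqrt (ell2_norm v * ell2_norm g / Im z))\<^sup>2"
    by (rule power_mono) simp
  also have "\<dots> = ell2_norm v * ell2_norm g / Im z" using z by (intro real_sqrt_pow2) auto
  finally have "(ell2_norm v)\<^sup>2 \<le> ell2_norm v * ell2_norm g / Im z" .
  then have "ell2_norm v * (Im z * ell2_norm v) \<le> ell2_norm v * ell2_norm g"
    using z by (simp add: pos_le_divide_eq power2_eq_square mult.commute mult.left_commute)
  then show ?thesis
  proof (cases "ell2_norm v = 0")
    case False
    then have "ell2_norm v > 0" using ell2_norm_nonneg[of v] by linarith
    then show ?thesis using \<open>ell2_norm v * (Im z * ell2_norm v) \<le> ell2_norm v * ell2_norm g\<close> by simp
  qed simp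
qed

section \<open>The generators of the Toda hierarchy\<close>

lemma jacobi_power_real: "Im ((jacobi_op J ^^ i) (unit_seq k) j) = 0"
proof (induction i arbitrary: j)
  case (Suc i)
  show ?case unfolding funpow.simps o_apply jacobi_op_def[of J "(jacobi_op J ^^ i) (unit_seq k)"] using Suc by simp
qed (simp add: unit_seq_def)

lemma jacobi_power_banded: "\<bar>j - k\<bar> > int i \<Longrightarrow> (jacobi_op J ^^ i) (unit_seq k) j = 0"
proof (induction i arbitrary: j)
  case (Suc i)
  have "int i < \<bar>j + 1 - k\<bar>" "int i < \<bar>j - 1 - k\<bar>" "int i < \<bar>j - k\<bar>" using Suc.prems by linarith+
  then show ?case unfolding funpow.simps o_apply jacobi_op_def[of J "(jacobi_op J ^^ i) (unit_seq k)"]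
    using Suc.IH by simp
qed (simp add: unit_seq_def)

lemma jacobi_power_bounded:
  assumes C: "\<And>n. \<bar>coeff_a J n\<bar> \<le> C" "\<And>n. \<bar>coeff_b J n\<bar> \<le> C"
  shows "cmod ((jacobi_op J ^^ i) (unit_seq k) j) \<le> (3 * C) ^ i"
proof (induction i arbitrary: j)
  case (Suc i)
  have C0: "C \<ge> 0" using order_trans[OF abs_ge_zero C(1)[of 0]] .
  let ?u = "(jacobi_op J ^^ i) (unit_seq k)"
  have "cmod (jacobi_op J ?u j) \<le> cmod (of_real (coeff_a J j) * ?u (j + 1)) + cmod (of_real (coeff_a J (j - 1)) * ?u (j - 1)) + cmod (of_real (coeff_b J j) * ?u j)"
    unfolding jacobi_op_def by (intro norm_triangle_le add_right_mono norm_triangle_ineq)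
  also have "\<dots> \<le> C * (3 * C) ^ i + C * (3 * C) ^ i + C * (3 * C) ^ i"
    unfolding norm_mult norm_of_real using C0 C Suc by (intro add_mono mult_mono) auto
  finally show ?case by (simp add: algebra_simps)
qed (simp add: unit_seq_def)

lemma jacobi_power_tendsto:
  assumes "\<And>n. ((\<lambda>t. coeff_a (Jt t) n) \<longlongrightarrow> coeff_a J n) F" "\<And>n. ((\<lambda>t. coeff_b (Jt t) n) \<longlongrightarrow> coeff_b J n) F"
  shows "((\<lambda>t. (jacobi_op (Jt t) ^^ i) (unit_seq k) j) \<longlongrightarrow> (jacobi_op J ^^ i) (unit_seq k) j) F"
proof (induction i arbitrary: j)
  case (Suc i)
  show ?case unfolding funpow.simps o_apply jacobi_op_def[of _ "(_ ^^ _) _"]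
    by (intro tendsto_intros assms Suc)
qed simp

definition toda_entry :: "real poly \<Rightarrow> jacobi \<Rightarrow> int \<Rightarrow> int \<Rightarrow> complex" where
  "toda_entry p J j k = antisym_entry (poly_op p J) j k"

lemma mat_entry_poly_op: "mat_entry (poly_op p J) j k = (\<Sum>i\<le>degree p. of_real (coeff p i) * (jacobi_op J ^^ i) (unit_seq k) j)"
  by (simp add: mat_entry_def poly_op_def)

lemma toda_entry_real: "Im (toda_entry p J j k) = 0"
  by (simp add: toda_entry_def antisym_entry_def mat_entry_poly_op jacobi_power_real)

lemma toda_entry_banded: "\<bar>j - k\<bar> > int (degree p) \<Longrightarrow> toda_entry p J j k = 0"
  by (simp add: toda_entry_def antisym_entry_def mat_entry_poly_op jacobi_power_banded)

lemma toda_entry_bounded: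
  assumes "bounded_jacobi J"
  obtains K where "\<And>j k. cmod (toda_entry p J j k) \<le> K"
proof -
  obtain C where C: "C > 0" "\<And>n. coeff_a J n \<le> C" "\<And>n. \<bar>coeff_b J n\<bar> \<le> C"
    using bounded_jacobi_coeff_bound[OF assms] by metis
  then have C': "\<And>n. \<bar>coeff_a J n\<bar> \<le> C" using coeff_a_pos[OF assms] by (simp add: abs_of_pos)
  show thesis
  proof
    fix j k
    have "cmod (toda_entry p J j k) \<le> cmod (mat_entry (poly_op p J) j k)"
      by (simp add: toda_entry_def antisym_entry_def)
    also have "\<dots> \<le> (\<Sum>i\<le>degree p. cmod (of_real (coeff p i) * (jacobi_op J ^^ i) (unit_seq k) j))"
      unfolding mat_entry_poly_op by (rule norm_sum)
    also have "\<dots> \<le> (\<Sum>i\<le>degree p. \<bar>coeff p i\<bar> * (3 * C) ^ i)"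
      unfolding norm_mult norm_of_real by (intro sum_mono mult_left_mono jacobi_power_bounded C C') auto
    finally show "cmod (toda_entry p J j k) \<le> (\<Sum>i\<le>degree p. \<bar>coeff p i\<bar> * (3 * C) ^ i)" .
  qed
qed

lemma toda_entry_tendsto:
  assumes "\<And>n. ((\<lambda>t. coeff_a (Jt t) n) \<longlongrightarrow> coeff_a J n) F" "\<And>n. ((\<lambda>t. coeff_b (Jt t) n) \<longlongrightarrow> coeff_b J n) F"
  shows "((\<lambda>t. toda_entry p (Jt t) j k) \<longlongrightarrow> toda_entry p J j k) F"
proof -
  have "((\<lambda>t. mat_entry (poly_op p (Jt t)) j k) \<longlongrightarrow> mat_entry (poly_op p J) j k) F"
    unfolding mat_entry_poly_op by (intro tendsto_intros jacobi_power_tendsto assms)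
  then show ?thesis unfolding toda_entry_def antisym_entry_def by (auto intro: tendsto_intros)
qed

definition toda_op :: "real poly \<Rightarrow> jacobi \<Rightarrow> (int \<Rightarrow> complex) \<Rightarrow> int \<Rightarrow> complex" where
  "toda_op p J = antisym_part (poly_op p J)"

lemma toda_op_eq: "toda_op p J u j = (\<Sum>k\<in>{j - int (degree p)..j + int (degree p)}. toda_entry p J j k * u k)"
proof -
  have "toda_op p J u j = (\<Sum>\<^sub>\<infinity>k. toda_entry p J j k * u k)"
    by (simp add: toda_op_def antisym_part_def toda_entry_def)
  also have "\<dots> = (\<Sum>\<^sub>\<infinity>k\<in>{j - int (degree p)..j + int (degree p)}. toda_entry p J j k * u k)"
    by (rule infsum_cong_neutral) (auto simp: toda_entry_banded)
  finally show ?thesis by simp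
qed

lemma toda_op_shifted: "toda_op p J u j = (\<Sum>i\<in>{- int (degree p)..int (degree p)}. toda_entry p J j (j + i) * u (j + i))"
  unfolding toda_op_eq by (rule sum.reindex_bij_witness[of _ "\<lambda>i. j + i" "\<lambda>k. k - j"]) auto

lemma toda_op_ell2:
  assumes "bounded_jacobi J" "u \<in> ell2" shows "toda_op p J u \<in> ell2"
proof -
  obtain K where K: "\<And>j k. cmod (toda_entry p J j k) \<le> K" using toda_entry_bounded[OF assms(1)] by metis
  have "(\<lambda>j. \<Sum>i\<in>{- int (degree p)..int (degree p)}. toda_entry p J j (j + i) * u (j + i)) \<in> ell2"
    by (intro ell2_sum ell2_mult_bounded(1)[where K = K] ell2_translate assms K) auto
  then show ?thesis by (simp add: toda_op_shifted[abs_def])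
qed

lemma toda_op_add: "toda_op p J (\<lambda>n. u n + v n) j = toda_op p J u j + toda_op p J v j"
  by (simp add: toda_op_eq distrib_left sum.distrib)

lemma toda_op_scale: "toda_op p J (\<lambda>n. c * u n) j = c * toda_op p J u j"
  by (simp add: toda_op_eq sum_distrib_left mult.left_commute)

lemma toda_op_unit_seq: "toda_op p J (unit_seq k) j = toda_entry p J j k"
proof -
  have "toda_op p J (unit_seq k) j = (\<Sum>i\<in>{j - int (degree p)..j + int (degree p)}. if i = k then toda_entry p J j k else 0)"
    unfolding toda_op_eq by (intro sum.cong) (auto simp: unit_seq_def)
  also have "\<dots> = toda_entry p J j k" using toda_entry_banded[of p j k J] by (auto simp: sum.delta)
  finally show ?thesis .
qed


section \<open>Weyl solutions of the left half line and their normalisation\<close>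

definition l2_minus :: "jacobi \<Rightarrow> complex \<Rightarrow> (int \<Rightarrow> complex) \<Rightarrow> bool" where
  "l2_minus J z f \<longleftrightarrow> eigen_solution J z f \<and> (\<lambda>n. (cmod (f n))\<^sup>2) summable_on {..0}"

lemma l2_minus_iff: "l2_minus J z f \<longleftrightarrow> l2_plus (reflect J) z (\<lambda>n. f (1 - n))"
  unfolding l2_minus_def by (rule l2_minus_reflect)

lemma f_minus_l2_minus: "bounded_jacobi J \<Longrightarrow> Im z > 0 \<Longrightarrow> l2_minus J z (f_minus J z)"
  unfolding l2_minus_iff by (rule f_minus_l2)

lemma l2_minus_nonzero:
  assumes "bounded_jacobi J" "Im z > 0" "l2_minus J z f" shows "f n \<noteq> 0"
  using l2_plus_nonzero[OF bounded_jacobi_reflect[OF assms(1)] assms(2), of "\<lambda>n. f (1 - n)" "1 - n"] assms(3)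
  by (simp add: l2_minus_iff)

lemma m_minus_eq:
  assumes J: "bounded_jacobi J" and z: "Im z > 0" and f: "l2_minus J z f"
  shows "m_minus J z = of_real (coeff_a J 0) * f 1 / f 0"
proof -
  have 1: "m_plus (reflect J) z = - of_real (coeff_a J 0) * f 0 / f 1"
    using m_plus_eq[OF bounded_jacobi_reflect[OF J] z, of "\<lambda>n. f (1 - n)"] f by (simp add: l2_minus_iff)
  show ?thesis unfolding m_minus_reflect[OF J z] 1
    using l2_minus_nonzero[OF assms] coeff_a_pos[OF J, of 0] by (simp add: field_simps power2_eq_square)
qed

lemma eigen_solution_scale: "eigen_solution J z f \<Longrightarrow> c \<noteq> 0 \<Longrightarrow> eigen_solution J z (\<lambda>n. c * f n)"
  unfolding eigen_solution_def jacobi_op_def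
  by (auto simp: mult.left_commute distrib_left[symmetric])

lemma l2_plus_scale: "l2_plus J z f \<Longrightarrow> c \<noteq> 0 \<Longrightarrow> l2_plus J z (\<lambda>n. c * f n)"
  unfolding l2_plus_def by (auto simp: norm_mult power_mult_distrib intro: eigen_solution_scale summable_on_cmult_right)

lemma l2_minus_scale: "l2_minus J z f \<Longrightarrow> c \<noteq> 0 \<Longrightarrow> l2_minus J z (\<lambda>n. c * f n)"
  unfolding l2_minus_def by (auto simp: norm_mult power_mult_distrib intro: eigen_solution_scale summable_on_cmult_right)

section \<open>Green's function\<close>

definition wronsk :: "jacobi \<Rightarrow> complex \<Rightarrow> complex" where
  "wronsk J z = of_real (coeff_a J 0) * (f_plus J z 1 * f_minus J z 0 - f_plus J z 0 * f_minus J z 1)"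

text \<open>Column \<open>k\<close> and row \<open>n\<close> of \<open>(J - z)^(-1)\<close>. It is
  homogeneous of degree 0 in both Weyl solutions, so it does not depend on the choices behind
  \<open>f_plus\<close> and \<open>f_minus\<close> and can be differentiated in time.\<close>

definition green :: "jacobi \<Rightarrow> complex \<Rightarrow> int \<Rightarrow> int \<Rightarrow> complex" where
  "green J z k n = f_plus J z (max n k) * f_minus J z (min n k) / wronsk J z"

lemma Im_m_minus_pos: "bounded_jacobi J \<Longrightarrow> Im z > 0 \<Longrightarrow> Im (m_minus J z) > 0"
  using Im_m_minus_ge by fastforce

lemma m_sum_nonzero: "bounded_jacobi J \<Longrightarrow> Im z > 0 \<Longrightarrow> m_plus J z + m_minus J z \<noteq> 0"
  using Im_m_plus_pos[of J z] Im_m_minus_pos[of J z] by (auto simp: complex_eq_iff)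

lemma wronsk_nonzero:
  assumes J: "bounded_jacobi J" and z: "Im z > 0"
  shows "wronsk J z \<noteq> 0"
proof
  assume "wronsk J z = 0"
  then have "f_plus J z 1 * f_minus J z 0 = f_plus J z 0 * f_minus J z 1"
    using coeff_a_pos[OF J, of 0] by (simp add: wronsk_def)
  then have "f_plus J z 1 / f_plus J z 0 = f_minus J z 1 / f_minus J z 0"
    using l2_plus_nonzero[OF assms f_plus_l2[OF assms]] l2_minus_nonzero[OF assms f_minus_l2_minus[OF assms]]
    by (simp add: frac_eq_eq mult.commute)
  then have "m_plus J z + m_minus J z = 0"
    unfolding m_plus_def m_minus_def by (simp add: times_divide_eq_right[symmetric] del: times_divide_eq_right)
  with m_sum_nonzero[OF assms] show False by contradiction
qed

lemma f_plus_eigen: "bounded_jacobi J \<Longrightarrow> Im z > 0 \<Longrightarrow> jacobi_op J (f_plus J z) n = z * f_plus J z n"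
  using f_plus_l2 by (simp add: l2_plus_def eigen_solution_def)

lemma f_minus_eigen: "bounded_jacobi J \<Longrightarrow> Im z > 0 \<Longrightarrow> jacobi_op J (f_minus J z) n = z * f_minus J z n"
  using f_minus_l2_minus by (simp add: l2_minus_def eigen_solution_def)

text \<open>Off the diagonal, the column is locally a multiple of one Weyl solution. At
  \<open>n = k\<close> the two pieces meet, and the defect is the Wronskian divided by
  itself.\<close>

lemma green_eq:
  assumes J: "bounded_jacobi J" and z: "Im z > 0"
  shows "jacobi_op J (green J z k) n = z * green J z k n + unit_seq k n"
proof -
  let ?p = "f_plus J z" and ?m = "f_minus J z" and ?w = "wronsk J z"
  note w = wronsk_nonzero[OF assms]
  consider "n < k" | "n > k" | "n = k" by linarith
  then show ?thesis
  proof cases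
    case 1
    then have "green J z k (n + 1) = ?p k / ?w * ?m (n + 1)" "green J z k (n - 1) = ?p k / ?w * ?m (n - 1)"
      "green J z k n = ?p k / ?w * ?m n" by (auto simp: green_def max_def min_def)
    then have "jacobi_op J (green J z k) n = ?p k / ?w * jacobi_op J ?m n"
      by (simp add: jacobi_op_def algebra_simps)
    then show ?thesis using 1 f_minus_eigen[OF assms, of n] by (simp add: green_def unit_seq_def max_def min_def)
  next
    case 2
    then have "max (n - 1) k = n - 1" "min (n - 1) k = k" "max n k = n" "min n k = k" "max (n + 1) k = n + 1" "min (n + 1) k = k"
      by auto
    then have "green J z k (n + 1) = ?m k / ?w * ?p (n + 1)" "green J z k (n - 1) = ?m k / ?w * ?p (n - 1)"
      "green J z k n = ?m k / ?w * ?p n" by (simp_all add: green_def)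
    then have "jacobi_op J (green J z k) n = ?m k / ?w * jacobi_op J ?p n"
      by (simp add: jacobi_op_def algebra_simps)
    then show ?thesis using 2 f_plus_eigen[OF assms, of n] by (simp add: green_def unit_seq_def max_def min_def)
  next
    case 3
    have g: "green J z k (n + 1) = ?p (n + 1) * ?m n / ?w" "green J z k (n - 1) = ?p n * ?m (n - 1) / ?w"
      "green J z k n = ?p n * ?m n / ?w" using 3 by (auto simp: green_def max_def min_def)
    have "of_real (coeff_a J n) * (?p (n + 1) * ?m n - ?p n * ?m (n + 1)) = ?w"
      unfolding wronsk_def by (rule wronskian_const[OF f_plus_eigen[OF assms] f_minus_eigen[OF assms]])
    moreover have "of_real (coeff_a J (n - 1)) * ?m (n - 1) = z * ?m n - of_real (coeff_b J n) * ?m n - of_real (coeff_a J n) * ?m (n + 1)"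
      using f_minus_eigen[OF assms, of n] by (simp add: jacobi_op_def algebra_simps)
    then have "of_real (coeff_a J (n - 1)) * (?p n * ?m (n - 1)) = ?p n * (z * ?m n - of_real (coeff_b J n) * ?m n - of_real (coeff_a J n) * ?m (n + 1))"
      by (simp only: mult.left_commute)
    ultimately have "of_real (coeff_a J n) * (?p (n + 1) * ?m n) + of_real (coeff_a J (n - 1)) * (?p n * ?m (n - 1))
      + of_real (coeff_b J n) * (?p n * ?m n) = z * (?p n * ?m n) + ?w"
      by (simp add: algebra_simps)
    then have "(of_real (coeff_a J n) * (?p (n + 1) * ?m n) + of_real (coeff_a J (n - 1)) * (?p n * ?m (n - 1))
      + of_real (coeff_b J n) * (?p n * ?m n)) / ?w = z * (?p n * ?m n) / ?w + 1"
      using w by (simp add: add_divide_distrib)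
    then show ?thesis unfolding jacobi_op_def g using 3 by (simp add: unit_seq_def add_divide_distrib)
  qed
qed

lemma summable_on_int_ray:
  fixes g :: "int \<Rightarrow> real"
  assumes "g summable_on {0..}" shows "g summable_on {k..}"
proof -
  have "g summable_on ({k..<0} \<union> {0..})"
    using assms by (intro summable_on_Un_disjoint) auto
  then show ?thesis by (rule summable_on_subset_banach) auto
qed

lemma l2_plus_ray: "l2_plus J z f \<Longrightarrow> (\<lambda>n. (cmod (f n))\<^sup>2) summable_on {k..}"
  unfolding l2_plus_def using summable_on_int_ray by blast

lemma l2_minus_ray:
  assumes "l2_minus J z f" shows "(\<lambda>n. (cmod (f n))\<^sup>2) summable_on {..k}"
proof -
  have "(\<lambda>n. (cmod (f n))\<^sup>2) summable_on ({..0} \<union> {0<..k})"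
    using assms unfolding l2_minus_def by (intro summable_on_Un_disjoint) auto
  then show ?thesis by (rule summable_on_subset_banach) auto
qed

lemma green_ell2:
  assumes J: "bounded_jacobi J" and z: "Im z > 0"
  shows "green J z k \<in> ell2"
proof -
  let ?p = "f_plus J z" and ?m = "f_minus J z" and ?w = "wronsk J z"
  have "(\<lambda>n. (cmod (?p k / ?w))\<^sup>2 * (cmod (?m n))\<^sup>2) summable_on {..k}"
    by (intro summable_on_cmult_right l2_minus_ray[OF f_minus_l2_minus[OF assms]])
  then have 1: "(\<lambda>n. (cmod (green J z k n))\<^sup>2) summable_on {..k}"
    by (rule summable_on_cong[THEN iffD1, rotated]) (auto simp: green_def max_def min_def norm_mult norm_divide power_mult_distrib power_divide)
  have "(\<lambda>n. (cmod (?m k / ?w))\<^sup>2 * (cmod (?p n))\<^sup>2) summable_on {k+1..}"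
    by (intro summable_on_cmult_right l2_plus_ray[OF f_plus_l2[OF assms]])
  then have 2: "(\<lambda>n. (cmod (green J z k n))\<^sup>2) summable_on {k+1..}"
    by (rule summable_on_cong[THEN iffD1, rotated]) (auto simp: green_def max_def min_def norm_mult norm_divide power_mult_distrib power_divide)
  have "(\<lambda>n. (cmod (green J z k n))\<^sup>2) summable_on ({..k} \<union> {k+1..})"
    using 1 2 by (intro summable_on_Un_disjoint) auto
  moreover have "{..k} \<union> {k+1..} = UNIV" by auto
  ultimately show ?thesis by (simp add: ell2_def)
qed

section \<open>The flow of the resolvent\<close>

definition toda_comm :: "real poly \<Rightarrow> jacobi \<Rightarrow> (int \<Rightarrow> complex) \<Rightarrow> int \<Rightarrow> complex" where
  "toda_comm p J = commutator (toda_op p J) (jacobi_op J)"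

lemma toda_comm_eq: "toda_comm p J u n = toda_op p J (jacobi_op J u) n - jacobi_op J (toda_op p J u) n"
  by (simp add: toda_comm_def commutator_def)

lemma toda_comm_ell2: "bounded_jacobi J \<Longrightarrow> u \<in> ell2 \<Longrightarrow> toda_comm p J u \<in> ell2"
  unfolding toda_comm_eq[abs_def] by (intro ell2_diff toda_op_ell2 jacobi_op_ell2)

lemma toda_difference_quotient:
  assumes F: "toda_solution p F" and u: "u \<in> ell2" and e: "e > 0"
  shows "\<forall>\<^sub>F h in at 0. (\<lambda>n. (jacobi_op (F (t + h)) u n - jacobi_op (F t) u n) / of_real h - toda_comm p (F t) u n) \<in> ell2 \<and>
     ell2_norm (\<lambda>n. (jacobi_op (F (t + h)) u n - jacobi_op (F t) u n) / of_real h - toda_comm p (F t) u n) \<le> e * ell2_norm u"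
proof -
  have "\<forall>\<^sub>F h in at 0. op_norm_le (\<lambda>u n. (jacobi_op (F (t + h)) u n - jacobi_op (F t) u n) / of_real h
                  - toda_comm p (F t) u n) e"
    using F e unfolding toda_solution_def toda_comm_def toda_op_def by blast
  then show ?thesis by eventually_elim (use u in \<open>auto simp: op_norm_le_def\<close>)
qed

lemma toda_bounded: "toda_solution p F \<Longrightarrow> bounded_jacobi (F t)"
  by (simp add: toda_solution_def)

lemma has_vector_derivativeI_quotient:
  fixes f :: "real \<Rightarrow> complex"
  assumes "((\<lambda>h. (f (t + h) - f t) / of_real h - D) \<longlongrightarrow> 0) (at 0)"
  shows "(f has_vector_derivative D) (at t)"
  unfolding has_vector_derivative_def has_derivative_at
proof
  show "bounded_linear (\<lambda>h. h *\<^sub>R D)" by (rule bounded_linear_scaleR_left)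
  show "((\<lambda>h. norm (f (t + h) - f t - h *\<^sub>R D) / norm h) \<longlongrightarrow> 0) (at 0)"
  proof (rule Lim_transform_eventually[OF tendsto_norm_zero[OF assms]])
    show "\<forall>\<^sub>F h in at 0. norm ((f (t + h) - f t) / of_real h - D) = norm (f (t + h) - f t - h *\<^sub>R D) / norm h"
      unfolding eventually_at_filter
    proof (rule always_eventually, intro allI impI)
      fix h :: real assume h: "h \<noteq> 0"
      then have "(f (t + h) - f t) / of_real h - D = (f (t + h) - f t - h *\<^sub>R D) / of_real h"
        by (simp add: scaleR_conv_of_real diff_divide_distrib)
      then show "norm ((f (t + h) - f t) / of_real h - D) = norm (f (t + h) - f t - h *\<^sub>R D) / norm h"
        by (simp add: norm_divide)
    qed
  qed
qed

lemma toda_operator_derivative: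
  assumes F: "toda_solution p F" and u: "u \<in> ell2"
  shows "((\<lambda>t. jacobi_op (F t) u n) has_vector_derivative toda_comm p (F t) u n) (at t)"
proof (rule has_vector_derivativeI_quotient, rule tendstoI)
  fix e :: real assume e: "e > 0"
  \<comment> \<open>The summand 1 keeps \<open>K\<close> positive when \<open>u\<close> is
    zero.\<close>
  define K where "K = ell2_norm u + 1"
  define e' where "e' = e / (2 * K)"
  have pos: "K > 0" unfolding K_def by (rule add_nonneg_pos) auto
  have e': "e' > 0" "e' * ell2_norm u < e"
  proof -
    show "e' > 0" unfolding e'_def using e pos by simp
    have "e' * ell2_norm u \<le> e' * K" using \<open>e' > 0\<close> by (intro mult_left_mono) (auto simp: K_def)
    also have "\<dots> = e / 2" unfolding e'_def using pos by simp
    finally show "e' * ell2_norm u < e" using e by simp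
  qed
  show "\<forall>\<^sub>F h in at 0. dist ((jacobi_op (F (t + h)) u n - jacobi_op (F t) u n) / of_real h - toda_comm p (F t) u n) 0 < e"
    using toda_difference_quotient[OF F u e'(1), of t]
  proof eventually_elim
    case (elim h)
    then show ?case using ell2_component_le[OF conjunct1[OF elim], of n] e'(2) by simp
  qed
qed

lemma toda_coeff_isCont:
  assumes F: "toda_solution p F"
  shows "isCont (\<lambda>t. coeff_a (F t) n) t" "isCont (\<lambda>t. coeff_b (F t) n) t"
proof -
  have c: "isCont (\<lambda>t. Re (jacobi_op (F t) (unit_seq k) n)) t" for k
    by (intro continuous_Re has_vector_derivative_continuous[OF toda_operator_derivative[OF F unit_seq_ell2]])
  show "isCont (\<lambda>t. coeff_a (F t) n) t" "isCont (\<lambda>t. coeff_b (F t) n) t"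
    using c[of "n + 1"] c[of n] by (simp_all add: jacobi_op_def unit_seq_def)
qed

text \<open>This is \<open>dG/dt = A G - G A\<close> with \<open>A = p(J)_a\<close>, applied to the
  unit vector at \<open>k\<close>; the sum arises because column \<open>k\<close> of
  \<open>A\<close> is finite. The error \<open>v\<close> of the difference quotient satisfies an
  equation \<open>(J(t + h) - z) v = g\<close> with small \<open>g\<close>, so
  \<open>resolvent_bound\<close> makes it small.\<close>

lemma green_derivative:
  assumes F: "toda_solution p F" and z: "Im z > 0"
  defines "d \<equiv> int (degree p)"
  shows "((\<lambda>t. green (F t) z k n) has_vector_derivative
     (toda_op p (F t) (green (F t) z k) n - (\<Sum>j\<in>{k - d..k + d}. toda_entry p (F t) j k * green (F t) z j n))) (at t)"
proof -
  define J where "J = F t"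
  have J: "bounded_jacobi J" unfolding J_def using toda_bounded[OF F] .
  define u where "u = green J z k"
  define w where "w n = toda_op p J u n - (\<Sum>j\<in>{k - d..k + d}. toda_entry p J j k * green J z j n)" for n
  define X where "X = toda_comm p J"
  have ul: "u \<in> ell2" unfolding u_def by (rule green_ell2[OF J z])
  have wl: "w \<in> ell2" unfolding w_def
    by (intro ell2_diff toda_op_ell2 ell2_sum ell2_scale green_ell2 J z ul) auto
  have Xw: "X w \<in> ell2" unfolding X_def by (rule toda_comm_ell2[OF J wl])
  have Jlin: "jacobi_op J' (\<lambda>n. f n - g n) m = jacobi_op J' f m - jacobi_op J' g m" for J' f g m
    by (simp add: jacobi_op_def algebra_simps)
  have Jdiv: "jacobi_op J' (\<lambda>n. f n / c) m = jacobi_op J' f m / c" for J' f c m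
    by (simp add: jacobi_op_def add_divide_distrib)
  have Jsum: "jacobi_op J (\<lambda>n. \<Sum>j\<in>I. c j * f j n) m = (\<Sum>j\<in>I. c j * jacobi_op J (f j) m)" for I c f m
    by (simp add: jacobi_op_def sum.distrib sum_distrib_left distrib_left mult.left_commute)
  \<comment> \<open>The equation \<open>(J - z) w = - [A, J] u\<close>, which differentiating
    \<open>(J - z) u = unit_seq k\<close> formally requires of the derivative of
    \<open>u\<close>.\<close>
  have wX: "jacobi_op J w m = z * w m - X u m" for m
  proof -
    have "jacobi_op J u = (\<lambda>n. z * u n + unit_seq k n)" unfolding u_def using green_eq[OF J z] by blast
    then have "toda_op p J (jacobi_op J u) m = z * toda_op p J u m + toda_entry p J m k"
      by (simp add: toda_op_add toda_op_scale toda_op_unit_seq)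
    then have 1: "jacobi_op J (toda_op p J u) m = z * toda_op p J u m + toda_entry p J m k - X u m"
      by (simp add: X_def toda_comm_eq)
    have "(\<Sum>j\<in>{k - d..k + d}. toda_entry p J j k * unit_seq j m) = (\<Sum>j\<in>{k - d..k + d}. if j = m then toda_entry p J m k else 0)"
      by (intro sum.cong) (auto simp: unit_seq_def)
    also have "\<dots> = toda_entry p J m k"
      using toda_entry_banded[of p m k J] by (auto simp: d_def)
    finally have 2: "(\<Sum>j\<in>{k - d..k + d}. toda_entry p J j k * unit_seq j m) = toda_entry p J m k" .
    have "jacobi_op J (\<lambda>n. \<Sum>j\<in>{k - d..k + d}. toda_entry p J j k * green J z j n) m
      = (\<Sum>j\<in>{k - d..k + d}. toda_entry p J j k * (z * green J z j m + unit_seq j m))"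
      unfolding Jsum green_eq[OF J z] ..
    also have "\<dots> = z * (\<Sum>j\<in>{k - d..k + d}. toda_entry p J j k * green J z j m) + toda_entry p J m k"
      by (simp add: distrib_left sum.distrib 2 sum_distrib_left mult.left_commute)
    finally show ?thesis unfolding w_def Jlin 1 by (simp add: algebra_simps)
  qed
  define v where "v h n = (green (F (t + h)) z k n - u n) / of_real h - w n" for h n
  have vl: "v h \<in> ell2" for h
  proof -
    have "v h = (\<lambda>n. inverse (of_real h) * (green (F (t + h)) z k n - u n) - w n)"
      by (auto simp: v_def divide_inverse mult.commute)
    then show ?thesis
      by (simp only:) (intro ell2_diff ell2_scale(1) green_ell2 toda_bounded[OF F] z ul wl)
  qed
  have bound: "\<forall>\<^sub>F h in at 0. ell2_norm (v h) \<le> (e * ell2_norm u + \<bar>h\<bar> * (e * ell2_norm w + ell2_norm (X w))) / Im z"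
    if e: "e > 0" for e
    using toda_difference_quotient[OF F ul e, of t] toda_difference_quotient[OF F wl e, of t] eventually_at_ball'[OF zero_less_one]
    unfolding J_def[symmetric] X_def[symmetric]
  proof eventually_elim
    case (elim h)
    then have h: "h \<noteq> 0" by simp
    define J' where "J' = F (t + h)"
    have J': "bounded_jacobi J'" unfolding J'_def using toda_bounded[OF F] .
    define Du where "Du n = (jacobi_op J' u n - jacobi_op J u n) / of_real h - X u n" for n
    define Dw where "Dw n = (jacobi_op J' w n - jacobi_op J w n) / of_real h - X w n" for n
    have Du: "Du \<in> ell2" "ell2_norm Du \<le> e * ell2_norm u" using elim(1) unfolding Du_def J'_def by auto
    have Dw: "Dw \<in> ell2" "ell2_norm Dw \<le> e * ell2_norm w" using elim(2) unfolding Dw_def J'_def by auto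
    \<comment> \<open>\<open>Du\<close> and \<open>Dw\<close> are the errors of the difference
      quotient of \<open>J\<close> on \<open>u\<close> and \<open>w\<close>. The part with the
      factor \<open>h\<close> appears because \<open>w\<close> solves its equation for the operator
      at time \<open>t\<close>, while the error is tested with the operator at time
      \<open>t + h\<close>.\<close>
    define g where "g n = - 1 * Du n + (- of_real h) * (Dw n + X w n)" for n
    have g: "g n = jacobi_op J' (v h) n - z * v h n" for n
    proof -
      have "jacobi_op J' (v h) n = (z * green J' z k n + unit_seq k n - jacobi_op J' u n) / of_real h - jacobi_op J' w n"
        unfolding v_def J'_def[symmetric] Jlin Jdiv green_eq[OF J' z] ..
      moreover have "jacobi_op J u n = z * u n + unit_seq k n" unfolding u_def by (rule green_eq[OF J z])
      moreover have "jacobi_op J' w n = of_real h * (Dw n + X w n) + (z * w n - X u n)"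
        using h unfolding Dw_def wX by simp
      ultimately show ?thesis
        using h unfolding g_def Du_def v_def J'_def[symmetric] by (simp add: field_simps)
    qed
    have gl: "ell2_norm g \<le> e * ell2_norm u + \<bar>h\<bar> * (e * ell2_norm w + ell2_norm (X w))"
    proof -
      note s = ell2_add[OF Dw(1) Xw]
      have "ell2_norm g \<le> ell2_norm (\<lambda>n. - 1 * Du n) + ell2_norm (\<lambda>n. (- of_real h) * (Dw n + X w n))"
        unfolding g_def by (intro ell2_add(2) ell2_scale(1) Du(1) s(1))
      also have "\<dots> \<le> cmod (- 1) * ell2_norm Du + cmod (- of_real h) * ell2_norm (\<lambda>n. Dw n + X w n)"
        by (intro add_mono ell2_scale(2) Du(1) s(1))
      also have "\<dots> \<le> e * ell2_norm u + \<bar>h\<bar> * (e * ell2_norm w + ell2_norm (X w))"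
      proof (rule add_mono)
        have "ell2_norm (\<lambda>n. Dw n + X w n) \<le> e * ell2_norm w + ell2_norm (X w)"
          using Dw(2) s(2) by linarith
        then show "cmod (- of_real h) * ell2_norm (\<lambda>n. Dw n + X w n) \<le> \<bar>h\<bar> * (e * ell2_norm w + ell2_norm (X w))"
          by (simp add: mult_left_mono)
      qed (use Du(2) in simp)
      finally show ?thesis .
    qed
    have "Im z * ell2_norm (v h) \<le> ell2_norm g"
      by (rule resolvent_bound[OF J' z vl g])
    with gl have "Im z * ell2_norm (v h) \<le> e * ell2_norm u + \<bar>h\<bar> * (e * ell2_norm w + ell2_norm (X w))" by linarith
    then show ?case using z by (simp add: pos_le_divide_eq mult.commute)
  qed
  have "((\<lambda>h. v h n) \<longlongrightarrow> 0) (at 0)"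
  proof (rule tendstoI)
    fix r :: real assume r: "r > 0"
    define K where "K = ell2_norm u + 1"
    define e where "e = r * Im z / (2 * K)"
    have pos: "K > 0" unfolding K_def by (rule add_nonneg_pos) auto
    have e: "e > 0" unfolding e_def using r z pos by simp
    have eu: "e * ell2_norm u \<le> r * Im z / 2"
    proof -
      have "e * ell2_norm u \<le> e * K" using e by (intro mult_left_mono) (auto simp: K_def)
      also have "\<dots> = r * Im z / 2" unfolding e_def using pos by simp
      finally show ?thesis .
    qed
    have "((\<lambda>h. \<bar>h\<bar> * (e * ell2_norm w + ell2_norm (X w))) \<longlongrightarrow> \<bar>0\<bar> * (e * ell2_norm w + ell2_norm (X w))) (at 0)"
      by (intro tendsto_intros)
    then have "\<forall>\<^sub>F h in at 0. \<bar>h\<bar> * (e * ell2_norm w + ell2_norm (X w)) < r * Im z / 2"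
      using r z by (intro order_tendstoD(2)[of _ "\<bar>0\<bar> * (e * ell2_norm w + ell2_norm (X w))"]) auto
    with bound[OF e] show "\<forall>\<^sub>F h in at 0. dist (v h n) 0 < r"
    proof eventually_elim
      case (elim h)
      have "e * ell2_norm u + \<bar>h\<bar> * (e * ell2_norm w + ell2_norm (X w)) < r * Im z"
        using elim(2) eu by linarith
      then have "(e * ell2_norm u + \<bar>h\<bar> * (e * ell2_norm w + ell2_norm (X w))) / Im z < r"
        using z by (simp add: pos_divide_less_eq)
      then show ?case using elim(1) ell2_component_le[OF vl, of h n] by simp
    qed
  qed
  then have "((\<lambda>t. green (F t) z k n) has_vector_derivative w n) (at t)"
    unfolding v_def by (intro has_vector_derivativeI_quotient) (simp add: u_def J_def)
  then show ?thesis unfolding w_def u_def J_def .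
qed


section \<open>Planar linear systems with nearly real coefficients\<close>

definition lin_sys where
  "lin_sys \<alpha> \<beta> \<gamma> \<delta> (X :: real \<Rightarrow> complex) Y \<longleftrightarrow>
     (\<forall>s\<in>{0..1}. (X has_vector_derivative \<alpha> s * X s + \<beta> s * Y s) (at s within {0..1}) \<and>
                 (Y has_vector_derivative \<gamma> s * X s + \<delta> s * Y s) (at s within {0..1}))"

lemma lin_sys_cnj:
  assumes "lin_sys \<alpha> \<beta> \<gamma> \<delta> X Y"
  shows "lin_sys (\<lambda>s. cnj (\<alpha> s)) (\<lambda>s. cnj (\<beta> s)) (\<lambda>s. cnj (\<gamma> s)) (\<lambda>s. cnj (\<delta> s)) (\<lambda>s. cnj (X s)) (\<lambda>s. cnj (Y s))"
  unfolding lin_sys_def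
proof (intro ballI conjI)
  fix s :: real assume "s \<in> {0..1}"
  then have "(X has_vector_derivative \<alpha> s * X s + \<beta> s * Y s) (at s within {0..1})"
    "(Y has_vector_derivative \<gamma> s * X s + \<delta> s * Y s) (at s within {0..1})"
    using assms by (auto simp: lin_sys_def)
  from this[THEN bounded_linear.has_vector_derivative[OF bounded_linear_cnj]]
  show "((\<lambda>s. cnj (X s)) has_vector_derivative cnj (\<alpha> s) * cnj (X s) + cnj (\<beta> s) * cnj (Y s)) (at s within {0..1})"
    "((\<lambda>s. cnj (Y s)) has_vector_derivative cnj (\<gamma> s) * cnj (X s) + cnj (\<delta> s) * cnj (Y s)) (at s within {0..1})"
    by simp_all
qed

text \<open>Gronwall's inequality for the squared norm. The constant comes from
  \<open>2 C (a + b)^2 \<le> 4 C (a^2 + b^2)\<close> for the moduli \<open>a\<close> and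
  \<open>b\<close> of the two components.\<close>

lemma lin_sys_bound:
  assumes sys: "lin_sys \<alpha> \<beta> \<gamma> \<delta> X Y"
    and C: "\<And>s. s \<in> {0..1} \<Longrightarrow> cmod (\<alpha> s) \<le> C \<and> cmod (\<beta> s) \<le> C \<and> cmod (\<gamma> s) \<le> C \<and> cmod (\<delta> s) \<le> C"
    and t: "t \<in> {0..1}"
  shows "(cmod (X t))\<^sup>2 + (cmod (Y t))\<^sup>2 \<le> exp (4 * C) * ((cmod (X 0))\<^sup>2 + (cmod (Y 0))\<^sup>2)"
proof -
  have C0: "C \<ge> 0" using order_trans[OF norm_ge_zero, of "\<alpha> 0" C] C[of 0] by simp
  define N where "N s = X s \<bullet> X s + Y s \<bullet> Y s" for s
  define N' where "N' s = 2 * (X s \<bullet> (\<alpha> s * X s + \<beta> s * Y s)) + 2 * (Y s \<bullet> (\<gamma> s * X s + \<delta> s * Y s))" for s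
  have N: "(N has_vector_derivative N' s) (at s within {0..1})" if "s \<in> {0..1}" for s
  proof -
    have X: "(X has_vector_derivative \<alpha> s * X s + \<beta> s * Y s) (at s within {0..1})"
      and Y: "(Y has_vector_derivative \<gamma> s * X s + \<delta> s * Y s) (at s within {0..1})"
      using sys that by (auto simp: lin_sys_def)
    show ?thesis unfolding N_def[abs_def] N'_def
      using has_vector_derivative_add[OF bounded_bilinear.has_vector_derivative[OF bounded_bilinear_inner X X]
          bounded_bilinear.has_vector_derivative[OF bounded_bilinear_inner Y Y]]
      by (simp add: inner_commute)
  qed
  have N'_le: "N' s \<le> 4 * C * N s" if "s \<in> {0..1}" for s
  proof -
    define a b where "a = cmod (X s)" and "b = cmod (Y s)"
    have le: "u \<bullet> (p * X s + q * Y s) \<le> cmod u * (C * (a + b))" if "cmod p \<le> C" "cmod q \<le> C" for u p q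
    proof -
      have "u \<bullet> (p * X s + q * Y s) \<le> cmod u * cmod (p * X s + q * Y s)" by (rule norm_cauchy_schwarz)
      also have "cmod (p * X s + q * Y s) \<le> C * a + C * b" unfolding a_def b_def
        using that by (intro norm_triangle_le add_mono) (auto simp: norm_mult mult_right_mono)
      finally show ?thesis by (simp add: mult_left_mono distrib_left)
    qed
    have "N' s \<le> 2 * (a * (C * (a + b))) + 2 * (b * (C * (a + b)))"
      unfolding N'_def using le[of "\<alpha> s" "\<beta> s" "X s"] le[of "\<gamma> s" "\<delta> s" "Y s"] C[OF that]
      by (intro add_mono mult_left_mono) (auto simp: a_def b_def)
    also have "\<dots> = 2 * C * (a + b)\<^sup>2" by (simp add: power2_eq_square algebra_simps)
    also have "\<dots> \<le> 2 * C * (2 * (a\<^sup>2 + b\<^sup>2))"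
      using C0 sum_squares_ge_zero[of "a - b" 0] by (intro mult_left_mono) (auto simp: power2_eq_square algebra_simps)
    also have "\<dots> = 4 * C * N s" by (simp add: N_def a_def b_def power2_norm_eq_inner)
    finally show ?thesis .
  qed
  have "N t * exp (- (4 * C) * t) \<le> N 0 * exp (- (4 * C) * 0)"
  proof (cases "t = 0")
    case False
    then have t0: "0 < t" "t \<le> 1" using t by auto
    have N_at: "(N has_real_derivative N' s) (at s)" if "0 < s" "s < t" for s
    proof -
      have "at s within {0..1} = at s" using that t0 by (intro at_within_interior) auto
      then show ?thesis using N[of s] that t0 by (simp add: has_real_derivative_iff_has_vector_derivative)
    qed
    show ?thesis
    proof (rule DERIV_nonpos_imp_decreasing_open[where f = "\<lambda>s. N s * exp (- (4 * C) * s)", OF less_imp_le[OF t0(1)]])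
      fix s assume s: "0 < s" "s < t"
      have "((\<lambda>s. N s * exp (- (4 * C) * s)) has_real_derivative N' s * exp (- (4 * C) * s) + exp (- (4 * C) * s) * (- (4 * C)) * N s) (at s)"
        by (intro DERIV_mult N_at s) (auto intro!: derivative_eq_intros)
      moreover have "N' s * exp (- (4 * C) * s) + exp (- (4 * C) * s) * (- (4 * C)) * N s = (N' s - 4 * C * N s) * exp (- (4 * C) * s)"
        by (simp add: algebra_simps)
      moreover have "(N' s - 4 * C * N s) * exp (- (4 * C) * s) \<le> 0"
        using N'_le[of s] s t0 by (intro mult_nonpos_nonneg) auto
      ultimately show "\<exists>y. ((\<lambda>s. N s * exp (- (4 * C) * s)) has_real_derivative y) (at s) \<and> y \<le> 0" by metis
    next
      have "continuous_on {0..1} N"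
        by (rule continuous_on_vector_derivative[OF N])
      then have "continuous_on {0..t} N" by (rule continuous_on_subset) (use t0 in auto)
      then show "continuous_on {0..t} (\<lambda>s. N s * exp (- (4 * C) * s))" by (intro continuous_intros)
    qed
  qed simp
  then have "N t \<le> N 0 * exp (4 * C * t)" by (simp add: exp_minus field_simps)
  also have "\<dots> \<le> N 0 * exp (4 * C)"
    using t C0 by (intro mult_left_mono) (auto simp: N_def mult_left_le)
  finally show ?thesis by (simp add: N_def power2_norm_eq_inner mult.commute)
qed

text \<open>Variation of constants: after multiplication by \<open>exp (- E s)\<close> only the
  perturbation is left. One factor \<open>exp C\<close> is spent on entering this picture and one on
  returning from it.\<close>

lemma perturbed_exponential:
  fixes N :: "real \<Rightarrow> complex"
  assumes N: "\<And>s. s \<in> {0..1} \<Longrightarrow> (N has_vector_derivative of_real (\<tau> s) * N s + r s) (at s within {0..1})"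
    and r: "\<And>s. s \<in> {0..1} \<Longrightarrow> cmod (r s) \<le> \<eta>"
    and E: "\<And>s. s \<in> {0..1} \<Longrightarrow> (E has_real_derivative \<tau> s) (at s within {0..1})" "E 0 = 0"
    and C: "\<And>s. s \<in> {0..1} \<Longrightarrow> \<bar>E s\<bar> \<le> C"
  shows "cmod (N 1 - of_real (exp (E 1)) * N 0) \<le> exp (2 * C) * \<eta>"
proof -
  define H where "H s = exp (- E s) *\<^sub>R N s" for s
  have H: "(H has_vector_derivative exp (- E s) *\<^sub>R r s) (at s within {0..1})" if "s \<in> {0..1}" for s
  proof -
    have "((\<lambda>s. exp (- E s)) has_real_derivative exp (- E s) * - \<tau> s) (at s within {0..1})"
      by (auto intro!: derivative_eq_intros E(1)[OF that])
    then have "((\<lambda>s. exp (- E s) *\<^sub>R N s) has_vector_derivative (exp (- E s) *\<^sub>R (of_real (\<tau> s) * N s + r s) + (exp (- E s) * - \<tau> s) *\<^sub>R N s)) (at s within {0..1})"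
      by (rule has_vector_derivative_scaleR[OF _ N[OF that]])
    then show ?thesis unfolding H_def[abs_def] by (simp add: scaleR_conv_of_real algebra_simps)
  qed
  have "norm (H 1 - H 0) \<le> (exp C * \<eta>) * norm (1 - 0 :: real)"
  proof (rule differentiable_bound[of "{0..1}"])
    show "(H has_derivative (\<lambda>h. h *\<^sub>R (exp (- E s) *\<^sub>R r s))) (at s within {0..1})" if "s \<in> {0..1}" for s
      using H[OF that] by (simp add: has_vector_derivative_def)
    show "onorm (\<lambda>h. h *\<^sub>R (exp (- E s) *\<^sub>R r s)) \<le> exp C * \<eta>" if "s \<in> {0..1}" for s
    proof (rule onorm_le)
      fix h :: real
      have "- E s \<le> C" using C[OF that] by linarith
      then have "exp (- E s) * cmod (r s) \<le> exp C * \<eta>" using r[OF that] by (intro mult_mono) auto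
      then show "norm (h *\<^sub>R (exp (- E s) *\<^sub>R r s)) \<le> exp C * \<eta> * norm h"
        using mult_left_mono[of "exp (- E s) * cmod (r s)" "exp C * \<eta>" "\<bar>h\<bar>"] by (simp add: mult_ac abs_mult)
    qed
  qed auto
  then have h: "cmod (H 1 - H 0) \<le> exp C * \<eta>" by simp
  have "N 1 - of_real (exp (E 1)) * N 0 = exp (E 1) *\<^sub>R (H 1 - H 0)"
    by (simp add: H_def E(2) scaleR_diff_right scaleR_conv_of_real exp_minus field_simps)
  then have "cmod (N 1 - of_real (exp (E 1)) * N 0) = exp (E 1) * cmod (H 1 - H 0)" by simp
  also have "\<dots> \<le> exp C * (exp C * \<eta>)"
    using h C[of 1] by (intro mult_mono) auto
  finally show ?thesis by (simp add: mult.assoc[symmetric] mult_exp_exp)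
qed

text \<open>An approximate Liouville formula: the determinant of two solutions is multiplied by the
  exponential of the integrated trace. The two systems may differ, as long as both are within
  \<open>\<eta>\<close> of the same real one. This covers the pairing of a solution with its
  conjugate, which solves the conjugate system. The error \<open>r\<close> has four terms of size
  \<open>2 * \<eta> * K^2\<close>.\<close>

lemma bracket_asymptotics:
  assumes XY: "lin_sys \<alpha> \<beta> \<gamma> \<delta> X Y" and VW: "lin_sys \<alpha>' \<beta>' \<gamma>' \<delta>' V W"
    and near: "\<And>s. s \<in> {0..1} \<Longrightarrow> cmod (\<alpha> s - of_real (a s)) \<le> \<eta> \<and> cmod (\<beta> s - of_real (b s)) \<le> \<eta> \<and>
      cmod (\<gamma> s - of_real (c s)) \<le> \<eta> \<and> cmod (\<delta> s - of_real (d s)) \<le> \<eta>"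
    and near': "\<And>s. s \<in> {0..1} \<Longrightarrow> cmod (\<alpha>' s - of_real (a s)) \<le> \<eta> \<and> cmod (\<beta>' s - of_real (b s)) \<le> \<eta> \<and>
      cmod (\<gamma>' s - of_real (c s)) \<le> \<eta> \<and> cmod (\<delta>' s - of_real (d s)) \<le> \<eta>"
    and K: "\<And>s. s \<in> {0..1} \<Longrightarrow> cmod (X s) \<le> K \<and> cmod (Y s) \<le> K \<and> cmod (V s) \<le> K \<and> cmod (W s) \<le> K"
    and E: "\<And>s. s \<in> {0..1} \<Longrightarrow> (E has_real_derivative a s + d s) (at s within {0..1})" "E 0 = 0"
    and C: "\<And>s. s \<in> {0..1} \<Longrightarrow> \<bar>E s\<bar> \<le> C"
  shows "cmod ((X 1 * W 1 - Y 1 * V 1) - of_real (exp (E 1)) * (X 0 * W 0 - Y 0 * V 0)) \<le> exp (2 * C) * (8 * \<eta> * K\<^sup>2)"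
proof -
  define r where "r s = ((\<alpha> s - of_real (a s)) + (\<delta>' s - of_real (d s))) * (X s * W s)
    - ((\<delta> s - of_real (d s)) + (\<alpha>' s - of_real (a s))) * (Y s * V s)
    + ((\<beta> s - of_real (b s)) - (\<beta>' s - of_real (b s))) * (Y s * W s)
    + ((\<gamma>' s - of_real (c s)) - (\<gamma> s - of_real (c s))) * (X s * V s)" for s
  show ?thesis
  proof (rule perturbed_exponential[where \<tau> = "\<lambda>s. a s + d s" and r = r, OF _ _ E C])
    fix s :: real assume s: "s \<in> {0..1}"
    have d: "(X has_vector_derivative \<alpha> s * X s + \<beta> s * Y s) (at s within {0..1})"
      "(Y has_vector_derivative \<gamma> s * X s + \<delta> s * Y s) (at s within {0..1})"
      "(V has_vector_derivative \<alpha>' s * V s + \<beta>' s * W s) (at s within {0..1})"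
      "(W has_vector_derivative \<gamma>' s * V s + \<delta>' s * W s) (at s within {0..1})"
      using XY VW s by (auto simp: lin_sys_def)
    have "((\<lambda>s. X s * W s - Y s * V s) has_vector_derivative
       (X s * (\<gamma>' s * V s + \<delta>' s * W s) + (\<alpha> s * X s + \<beta> s * Y s) * W s) -
       (Y s * (\<alpha>' s * V s + \<beta>' s * W s) + (\<gamma> s * X s + \<delta> s * Y s) * V s)) (at s within {0..1})"
      by (intro has_vector_derivative_diff has_vector_derivative_mult d)
    moreover have "(X s * (\<gamma>' s * V s + \<delta>' s * W s) + (\<alpha> s * X s + \<beta> s * Y s) * W s) -
       (Y s * (\<alpha>' s * V s + \<beta>' s * W s) + (\<gamma> s * X s + \<delta> s * Y s) * V s)
       = of_real (a s + d s) * (X s * W s - Y s * V s) + r s"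
      by (simp add: r_def algebra_simps)
    ultimately show "((\<lambda>s. X s * W s - Y s * V s) has_vector_derivative of_real (a s + d s) * (X s * W s - Y s * V s) + r s) (at s within {0..1})"
      by simp
    note n = near[OF s] near'[OF s] and k = K[OF s]
    have K0: "K \<ge> 0" using k norm_ge_zero order_trans by blast
    have e0: "\<eta> \<ge> 0" using n norm_ge_zero order_trans by blast
    have t: "cmod (u * (v * w)) \<le> 2 * \<eta> * K\<^sup>2" if "cmod u \<le> 2 * \<eta>" "cmod v \<le> K" "cmod w \<le> K" for u v w
      unfolding norm_mult power2_eq_square using that K0 e0 by (intro mult_mono) auto
    have sum: "cmod (u + v) \<le> 2 * \<eta>" "cmod (u - v) \<le> 2 * \<eta>" if "cmod u \<le> \<eta>" "cmod v \<le> \<eta>" for u v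
      using that norm_triangle_ineq[of u v] norm_triangle_ineq4[of u v] by auto
    have "cmod (r s) \<le> cmod (((\<alpha> s - of_real (a s)) + (\<delta>' s - of_real (d s))) * (X s * W s))
      + cmod (((\<delta> s - of_real (d s)) + (\<alpha>' s - of_real (a s))) * (Y s * V s))
      + cmod (((\<beta> s - of_real (b s)) - (\<beta>' s - of_real (b s))) * (Y s * W s))
      + cmod (((\<gamma>' s - of_real (c s)) - (\<gamma> s - of_real (c s))) * (X s * V s))"
      unfolding r_def by (intro norm_triangle_mono norm_triangle_ineq4 order_refl)
    also have "\<dots> \<le> 2 * \<eta> * K\<^sup>2 + 2 * \<eta> * K\<^sup>2 + 2 * \<eta> * K\<^sup>2 + 2 * \<eta> * K\<^sup>2"
      using n k by (intro add_mono t sum) auto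
    finally show "cmod (r s) \<le> 8 * \<eta> * K\<^sup>2" by simp
  qed
qed

lemma continuous_real_antiderivative:
  fixes \<tau> :: "real \<Rightarrow> real"
  assumes "continuous_on {0..1} \<tau>"
  obtains E where "\<And>s. s \<in> {0..1} \<Longrightarrow> (E has_real_derivative \<tau> s) (at s within {0..1})" "E 0 = 0"
proof -
  obtain g where g: "\<And>s. s \<in> {0..1} \<Longrightarrow> (g has_vector_derivative \<tau> s) (at s within {0..1})"
    using antiderivative_continuous[OF assms] by blast
  show thesis
  proof (rule that[of "\<lambda>s. g s - g 0"])
    fix s :: real assume "s \<in> {0..1}"
    then have "(g has_real_derivative \<tau> s) (at s within {0..1})"
      using g by (simp add: has_real_derivative_iff_has_vector_derivative)
    from DERIV_diff[OF this DERIV_const[of "g 0"]]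
    show "((\<lambda>s. g s - g 0) has_real_derivative \<tau> s) (at s within {0..1})" by simp
  qed simp
qed

text \<open>By uniform continuity on \<open>S\<close> the coefficients at \<open>z k\<close> become
  real uniformly in time. All three brackets therefore acquire the same factor, the exponential of
  the integrated trace at \<open>x\<close>. The conclusions are about differences because the
  brackets themselves may fail to converge.\<close>

lemma linear_flow_asymptotics:
  fixes x :: real and z :: "nat \<Rightarrow> complex" and \<alpha> \<beta> \<gamma> \<delta> :: "real \<Rightarrow> complex \<Rightarrow> complex"
  defines "S \<equiv> {0..1} \<times> cball (of_real x) 1"
  assumes cont: "continuous_on S (\<lambda>(s, w). \<alpha> s w)" "continuous_on S (\<lambda>(s, w). \<beta> s w)"
      "continuous_on S (\<lambda>(s, w). \<gamma> s w)" "continuous_on S (\<lambda>(s, w). \<delta> s w)"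
    and real: "\<And>s. Im (\<alpha> s (of_real x)) = 0" "\<And>s. Im (\<beta> s (of_real x)) = 0"
      "\<And>s. Im (\<gamma> s (of_real x)) = 0" "\<And>s. Im (\<delta> s (of_real x)) = 0"
    and z: "\<And>k. z k \<in> cball (of_real x) 1" "z \<longlonglongrightarrow> of_real x"
    and sys: "\<And>k. lin_sys (\<lambda>s. \<alpha> s (z k)) (\<lambda>s. \<beta> s (z k)) (\<lambda>s. \<gamma> s (z k)) (\<lambda>s. \<delta> s (z k)) (X k) (Y k)"
      "\<And>k. lin_sys (\<lambda>s. \<alpha> s (z k)) (\<lambda>s. \<beta> s (z k)) (\<lambda>s. \<gamma> s (z k)) (\<lambda>s. \<delta> s (z k)) (V k) (W k)"
    and init: "\<And>k. cmod (X k 0) \<le> B \<and> cmod (Y k 0) \<le> B \<and> cmod (V k 0) \<le> B \<and> cmod (W k 0) \<le> B"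
  obtains r K where "r > 0" "\<And>k. cmod (X k 1) \<le> K \<and> cmod (Y k 1) \<le> K \<and> cmod (V k 1) \<le> K \<and> cmod (W k 1) \<le> K"
    "(\<lambda>k. (X k 1 * W k 1 - Y k 1 * V k 1) - of_real r * (X k 0 * W k 0 - Y k 0 * V k 0)) \<longlonglongrightarrow> 0"
    "(\<lambda>k. Im (X k 1 * cnj (Y k 1)) - r * Im (X k 0 * cnj (Y k 0))) \<longlonglongrightarrow> 0"
    "(\<lambda>k. Im (V k 1 * cnj (W k 1)) - r * Im (V k 0 * cnj (W k 0))) \<longlonglongrightarrow> 0"
proof -
  have S: "compact S" unfolding S_def by (intro compact_Times) auto
  have xS: "(s, of_real x) \<in> S" if "s \<in> {0..1}" for s using that by (simp add: S_def)
  have zS: "(s, z k) \<in> S" if "s \<in> {0..1}" for s k using that z(1) by (simp add: S_def)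
  have bd: "\<exists>C. \<forall>s w. (s, w) \<in> S \<longrightarrow> cmod (f s w) \<le> C" if "continuous_on S (\<lambda>(s, w). f s w)" for f :: "real \<Rightarrow> complex \<Rightarrow> complex"
    using compact_imp_bounded[OF compact_continuous_image[OF that S]] unfolding bounded_iff by fastforce
  obtain C1 C2 C3 C4 where C: "\<And>s w. (s, w) \<in> S \<Longrightarrow> cmod (\<alpha> s w) \<le> C1" "\<And>s w. (s, w) \<in> S \<Longrightarrow> cmod (\<beta> s w) \<le> C2"
    "\<And>s w. (s, w) \<in> S \<Longrightarrow> cmod (\<gamma> s w) \<le> C3" "\<And>s w. (s, w) \<in> S \<Longrightarrow> cmod (\<delta> s w) \<le> C4"
    using cont[THEN bd] by blast
  define C where "C = max (max C1 C2) (max C3 C4)"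
  have Cb: "cmod (\<alpha> s w) \<le> C \<and> cmod (\<beta> s w) \<le> C \<and> cmod (\<gamma> s w) \<le> C \<and> cmod (\<delta> s w) \<le> C" if "(s, w) \<in> S" for s w
    using C(1)[OF that] C(2)[OF that] C(3)[OF that] C(4)[OF that] unfolding C_def by linarith
  define K where "K = sqrt (exp (4 * C) * (B\<^sup>2 + B\<^sup>2))"
  have le_K: "cmod (P s) \<le> K \<and> cmod (Q s) \<le> K"
    if "lin_sys (\<lambda>s. \<alpha> s (z k)) (\<lambda>s. \<beta> s (z k)) (\<lambda>s. \<gamma> s (z k)) (\<lambda>s. \<delta> s (z k)) P Q" "cmod (P 0) \<le> B" "cmod (Q 0) \<le> B" "s \<in> {0..1}" for P Q k s
  proof -
    have "(cmod (P s))\<^sup>2 + (cmod (Q s))\<^sup>2 \<le> exp (4 * C) * ((cmod (P 0))\<^sup>2 + (cmod (Q 0))\<^sup>2)"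
      by (rule lin_sys_bound[OF that(1) _ that(4)]) (rule Cb[OF zS])
    also have "\<dots> \<le> exp (4 * C) * (B\<^sup>2 + B\<^sup>2)"
      using that by (intro mult_left_mono add_mono power_mono) auto
    finally have s: "(cmod (P s))\<^sup>2 + (cmod (Q s))\<^sup>2 \<le> exp (4 * C) * (B\<^sup>2 + B\<^sup>2)" .
    have "(cmod (P s))\<^sup>2 \<le> exp (4 * C) * (B\<^sup>2 + B\<^sup>2)" "(cmod (Q s))\<^sup>2 \<le> exp (4 * C) * (B\<^sup>2 + B\<^sup>2)"
      using s zero_le_power2[of "cmod (P s)"] zero_le_power2[of "cmod (Q s)"] by linarith+
    then show ?thesis unfolding K_def by (simp add: real_le_rsqrt)
  qed
  have K: "cmod (X k s) \<le> K \<and> cmod (Y k s) \<le> K \<and> cmod (V k s) \<le> K \<and> cmod (W k s) \<le> K" if "s \<in> {0..1}" for k s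
    using le_K[OF sys(1)[of k] _ _ that] le_K[OF sys(2)[of k] _ _ that] init[of k] by blast
  have cx: "continuous_on {0..1} (\<lambda>s. f s (of_real x))" if "continuous_on S (\<lambda>(s, w). f s w)" for f :: "real \<Rightarrow> complex \<Rightarrow> complex"
  proof -
    have "continuous_on {0..1} (\<lambda>s::real. (s, of_real x :: complex))" by (intro continuous_intros)
    moreover have "(\<lambda>s. (s, of_real x)) ` {0..1} \<subseteq> S" using xS by blast
    ultimately show ?thesis using continuous_on_compose2[OF that] by fastforce
  qed
  have "continuous_on {0..1} (\<lambda>s. Re (\<alpha> s (of_real x)) + Re (\<delta> s (of_real x)))"
    by (intro continuous_intros cx cont)
  then obtain E where E: "\<And>s. s \<in> {0..1} \<Longrightarrow> (E has_real_derivative Re (\<alpha> s (of_real x)) + Re (\<delta> s (of_real x))) (at s within {0..1})" "E 0 = 0"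
    using continuous_real_antiderivative by blast
  have "continuous_on {0..1} E" using E(1) by (rule DERIV_continuous_on)
  then have "bounded (E ` {0..1})" by (intro compact_imp_bounded compact_continuous_image) auto
  then obtain D where "\<forall>s\<in>{0..1}. \<bar>E s\<bar> \<le> D" by (auto simp: bounded_iff)
  then have D: "\<bar>E s\<bar> \<le> D" if "s \<in> {0..1}" for s using that by blast
  have near1: "\<forall>\<^sub>F k in sequentially. \<forall>s\<in>{0..1}. cmod (f s (z k) - of_real (Re (f s (of_real x)))) \<le> \<eta>"
    if f: "continuous_on S (\<lambda>(s, w). f s w)" and re: "\<And>s. Im (f s (of_real x)) = 0" and e: "\<eta> > 0" for f :: "real \<Rightarrow> complex \<Rightarrow> complex" and \<eta>
  proof -
    have "uniformly_continuous_on S (\<lambda>(s, w). f s w)" using f S by (rule compact_uniformly_continuous)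
    then obtain d where d: "d > 0" "\<And>p q. p \<in> S \<Longrightarrow> q \<in> S \<Longrightarrow> dist q p < d \<Longrightarrow> dist (case q of (s, w) \<Rightarrow> f s w) (case p of (s, w) \<Rightarrow> f s w) < \<eta>"
      unfolding uniformly_continuous_on_def using e by metis
    have "\<forall>\<^sub>F k in sequentially. dist (z k) (of_real x) < d" using z(2) d(1) by (rule tendstoD)
    then show ?thesis
    proof eventually_elim
      case (elim k)
      show ?case
      proof
        fix s :: real assume s: "s \<in> {0..1}"
        have "dist (s, z k) (s, of_real x) < d" using elim by (simp add: dist_Pair_Pair)
        from d(2)[OF xS[OF s] zS[OF s] this] have "dist (f s (z k)) (f s (of_real x)) < \<eta>" by simp
        moreover have "f s (of_real x) = of_real (Re (f s (of_real x)))" using re[of s] by (simp add: complex_eq_iff)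
        ultimately show "cmod (f s (z k) - of_real (Re (f s (of_real x)))) \<le> \<eta>" by (simp add: dist_norm)
      qed
    qed
  qed
  have lim: "G \<longlonglongrightarrow> 0" if G: "\<And>\<eta> k. \<eta> > 0 \<Longrightarrow>
      (\<forall>s\<in>{0..1}. cmod (\<alpha> s (z k) - of_real (Re (\<alpha> s (of_real x)))) \<le> \<eta>) \<Longrightarrow>
      (\<forall>s\<in>{0..1}. cmod (\<beta> s (z k) - of_real (Re (\<beta> s (of_real x)))) \<le> \<eta>) \<Longrightarrow>
      (\<forall>s\<in>{0..1}. cmod (\<gamma> s (z k) - of_real (Re (\<gamma> s (of_real x)))) \<le> \<eta>) \<Longrightarrow>
      (\<forall>s\<in>{0..1}. cmod (\<delta> s (z k) - of_real (Re (\<delta> s (of_real x)))) \<le> \<eta>) \<Longrightarrow> cmod (G k) \<le> exp (2 * D) * (8 * \<eta> * K\<^sup>2)" for G :: "nat \<Rightarrow> complex"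
  proof (rule tendstoI)
    fix e :: real assume e: "e > 0"
    define M where "M = exp (2 * D) * (8 * K\<^sup>2) + 1"
    have M: "M > 0" unfolding M_def by (intro add_nonneg_pos) auto
    define \<eta> where "\<eta> = e / (2 * M)"
    have \<eta>: "\<eta> > 0" unfolding \<eta>_def using e M by simp
    have "exp (2 * D) * (8 * \<eta> * K\<^sup>2) \<le> \<eta> * M" unfolding M_def using \<eta> by (simp add: algebra_simps)
    also have "\<eta> * M = e / 2" unfolding \<eta>_def using M by simp
    finally have le: "exp (2 * D) * (8 * \<eta> * K\<^sup>2) < e" using e by linarith
    show "\<forall>\<^sub>F k in sequentially. dist (G k) 0 < e"
      using near1[OF cont(1) real(1) \<eta>] near1[OF cont(2) real(2) \<eta>] near1[OF cont(3) real(3) \<eta>] near1[OF cont(4) real(4) \<eta>]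
    proof eventually_elim
      case (elim k)
      from G[OF \<eta> elim] le show ?case by simp
    qed
  qed
  have cn: "cmod (cnj u - of_real v) = cmod (u - of_real v)" for u v
    by (metis complex_cnj_complex_of_real complex_cnj_diff complex_mod_cnj)
  have 1: "(\<lambda>k. (X k 1 * W k 1 - Y k 1 * V k 1) - of_real (exp (E 1)) * (X k 0 * W k 0 - Y k 0 * V k 0)) \<longlonglongrightarrow> 0"
  proof (rule lim)
    fix \<eta> :: real and k assume "\<eta> > 0" and n: "\<forall>s\<in>{0..1}. cmod (\<alpha> s (z k) - of_real (Re (\<alpha> s (of_real x)))) \<le> \<eta>"
      "\<forall>s\<in>{0..1}. cmod (\<beta> s (z k) - of_real (Re (\<beta> s (of_real x)))) \<le> \<eta>"
      "\<forall>s\<in>{0..1}. cmod (\<gamma> s (z k) - of_real (Re (\<gamma> s (of_real x)))) \<le> \<eta>"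
      "\<forall>s\<in>{0..1}. cmod (\<delta> s (z k) - of_real (Re (\<delta> s (of_real x)))) \<le> \<eta>"
    show "cmod ((X k 1 * W k 1 - Y k 1 * V k 1) - of_real (exp (E 1)) * (X k 0 * W k 0 - Y k 0 * V k 0)) \<le> exp (2 * D) * (8 * \<eta> * K\<^sup>2)"
      by (rule bracket_asymptotics[OF sys(1) sys(2) _ _ _ E D]) (use n K in blast)+
  qed
  have 2: "(\<lambda>k. Im (P k 1 * cnj (Q k 1)) - exp (E 1) * Im (P k 0 * cnj (Q k 0))) \<longlonglongrightarrow> 0"
    if PQ: "\<And>k. lin_sys (\<lambda>s. \<alpha> s (z k)) (\<lambda>s. \<beta> s (z k)) (\<lambda>s. \<gamma> s (z k)) (\<lambda>s. \<delta> s (z k)) (P k) (Q k)"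
      and PK: "\<And>s k. s \<in> {0..1} \<Longrightarrow> cmod (P k s) \<le> K \<and> cmod (Q k s) \<le> K" for P Q
  proof -
    \<comment> \<open>The bracket of the solution with its conjugate, which is \<open>2 i\<close>
      times the imaginary part in question.\<close>
    define G where "G k = (P k 1 * cnj (Q k 1) - Q k 1 * cnj (P k 1)) - of_real (exp (E 1)) * (P k 0 * cnj (Q k 0) - Q k 0 * cnj (P k 0))" for k
    have "G \<longlonglongrightarrow> 0"
    proof (rule lim)
      fix \<eta> :: real and k assume "\<eta> > 0" and n: "\<forall>s\<in>{0..1}. cmod (\<alpha> s (z k) - of_real (Re (\<alpha> s (of_real x)))) \<le> \<eta>"
        "\<forall>s\<in>{0..1}. cmod (\<beta> s (z k) - of_real (Re (\<beta> s (of_real x)))) \<le> \<eta>"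
        "\<forall>s\<in>{0..1}. cmod (\<gamma> s (z k) - of_real (Re (\<gamma> s (of_real x)))) \<le> \<eta>"
        "\<forall>s\<in>{0..1}. cmod (\<delta> s (z k) - of_real (Re (\<delta> s (of_real x)))) \<le> \<eta>"
      show "cmod (G k) \<le> exp (2 * D) * (8 * \<eta> * K\<^sup>2)" unfolding G_def
      proof (rule bracket_asymptotics[OF PQ lin_sys_cnj[OF PQ] _ _ _ E D])
        fix s :: real assume s: "s \<in> {0..1}"
        show "cmod (\<alpha> s (z k) - of_real (Re (\<alpha> s (of_real x)))) \<le> \<eta> \<and> cmod (\<beta> s (z k) - of_real (Re (\<beta> s (of_real x)))) \<le> \<eta> \<and>
          cmod (\<gamma> s (z k) - of_real (Re (\<gamma> s (of_real x)))) \<le> \<eta> \<and> cmod (\<delta> s (z k) - of_real (Re (\<delta> s (of_real x)))) \<le> \<eta>"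
          using n s by blast
        then show "cmod (cnj (\<alpha> s (z k)) - of_real (Re (\<alpha> s (of_real x)))) \<le> \<eta> \<and> cmod (cnj (\<beta> s (z k)) - of_real (Re (\<beta> s (of_real x)))) \<le> \<eta> \<and>
          cmod (cnj (\<gamma> s (z k)) - of_real (Re (\<gamma> s (of_real x)))) \<le> \<eta> \<and> cmod (cnj (\<delta> s (z k)) - of_real (Re (\<delta> s (of_real x)))) \<le> \<eta>"
          unfolding cn .
        show "cmod (P k s) \<le> K \<and> cmod (Q k s) \<le> K \<and> cmod (cnj (P k s)) \<le> K \<and> cmod (cnj (Q k s)) \<le> K"
          using PK[OF s, of k] by simp
      qed
    qed
    then have "(\<lambda>k. Im (G k) / 2) \<longlonglongrightarrow> Im 0 / 2" by (intro tendsto_intros) auto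
    moreover have "Im (G k) / 2 = Im (P k 1 * cnj (Q k 1)) - exp (E 1) * Im (P k 0 * cnj (Q k 0))" for k
      by (simp add: G_def field_simps)
    ultimately show ?thesis by simp
  qed
  show thesis
  proof (rule that[of "exp (E 1)" K])
    show "cmod (X k 1) \<le> K \<and> cmod (Y k 1) \<le> K \<and> cmod (V k 1) \<le> K \<and> cmod (W k 1) \<le> K" for k
      using K[of 1 k] by simp
  qed (use 1 2[OF sys(1)] 2[OF sys(2)] K in auto)
qed


section \<open>Boundary behaviour along shifts and Toda flows\<close>

text \<open>The flag selects the half line, \<open>True\<close> being the right one, so that one
  proof serves both. For given \<open>J\<close> and \<open>z\<close> the pair \<open>(P, Q)\<close>
  is determined only up to a common factor.\<close>

definition weyl_vec :: "bool \<Rightarrow> jacobi \<Rightarrow> complex \<Rightarrow> complex \<Rightarrow> complex \<Rightarrow> bool" where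
  "weyl_vec s J z P Q \<longleftrightarrow> (\<exists>f. (if s then l2_plus J z f else l2_minus J z f) \<and> f 1 = P \<and> f 0 = Q)"

lemma weyl_vec_nonzero: "bounded_jacobi J \<Longrightarrow> Im z > 0 \<Longrightarrow> weyl_vec s J z P Q \<Longrightarrow> P \<noteq> 0 \<and> Q \<noteq> 0"
  unfolding weyl_vec_def using l2_plus_nonzero l2_minus_nonzero by (auto split: if_splits)

lemma weyl_vec_m_plus: "bounded_jacobi J \<Longrightarrow> Im z > 0 \<Longrightarrow> weyl_vec True J z P Q \<Longrightarrow> m_plus J z = - of_real (coeff_a J 0) * P / Q"
  unfolding weyl_vec_def using m_plus_eq by auto

lemma weyl_vec_m_minus: "bounded_jacobi J \<Longrightarrow> Im z > 0 \<Longrightarrow> weyl_vec False J z P Q \<Longrightarrow> m_minus J z = of_real (coeff_a J 0) * P / Q"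
  unfolding weyl_vec_def using m_minus_eq by auto

lemma weyl_vec_scale:
  assumes "weyl_vec s J z P Q" "l \<noteq> 0" shows "weyl_vec s J z (l * P) (l * Q)"
proof -
  obtain f where "if s then l2_plus J z f else l2_minus J z f" "f 1 = P" "f 0 = Q"
    using assms(1) by (auto simp: weyl_vec_def)
  then show ?thesis unfolding weyl_vec_def using l2_plus_scale[OF _ assms(2)] l2_minus_scale[OF _ assms(2)]
    by (intro exI[of _ "\<lambda>n. l * f n"]) auto
qed

lemma weyl_vec_proportional:
  assumes J: "bounded_jacobi J" "Im z > 0" and r: "weyl_vec s J z P Q" "weyl_vec s J z P' Q'"
  obtains l where "l \<noteq> 0" "P = l * P'" "Q = l * Q'"
proof -
  have nz: "Q \<noteq> 0" "Q' \<noteq> 0" using weyl_vec_nonzero[OF J r(1)] weyl_vec_nonzero[OF J r(2)] by auto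
  have a: "coeff_a J 0 \<noteq> 0" using coeff_a_pos[OF J(1), of 0] by simp
  have "of_real (coeff_a J 0) * P / Q = of_real (coeff_a J 0) * P' / Q'"
    using weyl_vec_m_plus[OF J, of P Q] weyl_vec_m_plus[OF J, of P' Q'] weyl_vec_m_minus[OF J, of P Q] weyl_vec_m_minus[OF J, of P' Q'] r
    by (cases s) auto
  then have "P * Q' = Q * P'" using nz a by (simp add: field_simps)
  then show thesis using nz by (intro that[of "Q / Q'"]) (auto simp: field_simps)
qed

text \<open>This column of the resolvent is so far out that it agrees with a Weyl solution at all sites
  that \<open>p(J)_a\<close> couples to the sites 0 and 1.\<close>

definition far_col :: "bool \<Rightarrow> real poly \<Rightarrow> int" where
  "far_col s p = (if s then - int (degree p) else int (degree p) + 1)"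

lemma green_nonzero:
  assumes "bounded_jacobi J" "Im z > 0" shows "green J z k n \<noteq> 0"
  unfolding green_def using wronsk_nonzero[OF assms] l2_plus_nonzero[OF assms f_plus_l2[OF assms]]
    l2_minus_nonzero[OF assms f_minus_l2_minus[OF assms]] by simp

text \<open>On one side of its diagonal entry a column equals a fixed multiple of the Weyl solution
  of that side; the multiple is nonzero, as Weyl solutions have no zeros.\<close>

lemma green_half_line:
  assumes J: "bounded_jacobi J" "Im z > 0"
  obtains f where "if s then l2_plus J z f else l2_minus J z f" "\<And>i. (if s then k \<le> i else i \<le> k) \<Longrightarrow> green J z k i = f i"
proof (cases s)
  case True
  have "f_minus J z k / wronsk J z \<noteq> 0"
    using wronsk_nonzero[OF J] l2_minus_nonzero[OF J f_minus_l2_minus[OF J]] by simp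
  from l2_plus_scale[OF f_plus_l2[OF J] this] show thesis
    using True by (intro that[of "\<lambda>n. f_minus J z k / wronsk J z * f_plus J z n"]) (simp_all add: green_def max_absorb1 min_absorb2)
next
  case False
  have "f_plus J z k / wronsk J z \<noteq> 0"
    using wronsk_nonzero[OF J] l2_plus_nonzero[OF J f_plus_l2[OF J]] by simp
  from l2_minus_scale[OF f_minus_l2_minus[OF J] this] show thesis
    using False by (intro that[of "\<lambda>n. f_plus J z k / wronsk J z * f_minus J z n"]) (simp_all add: green_def max_absorb2 min_absorb1)
qed

lemma green_weyl_vec:
  assumes J: "bounded_jacobi J" "Im z > 0"
  shows "weyl_vec s J z (green J z (far_col s p) 1) (green J z (far_col s p) 0)"
proof -
  obtain f where f: "if s then l2_plus J z f else l2_minus J z f"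
    "\<And>i. (if s then far_col s p \<le> i else i \<le> far_col s p) \<Longrightarrow> green J z (far_col s p) i = f i"
    using green_half_line[OF J] by metis
  have "green J z (far_col s p) 1 = f 1" "green J z (far_col s p) 0 = f 0" by (rule f(2), simp add: far_col_def)+
  then show ?thesis unfolding weyl_vec_def using f(1) by auto
qed

text \<open>The solutions of \<open>(J - z) f = 0\<close> form a plane with coordinates
  \<open>f 0\<close> and \<open>f 1\<close>, and \<open>p(J)_a f\<close> at the sites 0 and 1 is
  linear in these coordinates. This is the resulting matrix, with rows \<open>n\<close> and columns
  \<open>j\<close>.\<close>

definition toda_A :: "real poly \<Rightarrow> jacobi \<Rightarrow> complex \<Rightarrow> int \<Rightarrow> int \<Rightarrow> complex" where
  "toda_A p J z n j = toda_op p J (sol J z (if j = 0 then 1 else 0) (if j = 0 then 0 else 1)) n"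

lemma toda_A_tendsto:
  assumes "\<And>n. ((\<lambda>t. coeff_a (Jt t) n) \<longlongrightarrow> coeff_a J n) F" "\<And>n. ((\<lambda>t. coeff_b (Jt t) n) \<longlongrightarrow> coeff_b J n) F"
    and "\<And>n. coeff_a J n > 0" and "(zt \<longlongrightarrow> z) F"
  shows "((\<lambda>t. toda_A p (Jt t) (zt t) n j) \<longlongrightarrow> toda_A p J z n j) F"
  unfolding toda_A_def toda_op_eq
  by (intro tendsto_sum tendsto_mult toda_entry_tendsto sol_tendsto tendsto_const assms)

text \<open>At real \<open>z\<close> the basis solutions are real, and so are the entries of
  \<open>p(J)_a\<close>. This is where the Toda flow becomes a real linear map on boundary
  data.\<close>

lemma toda_A_real: "Im (toda_A p J (of_real x) n j) = 0"
proof -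
  have "Im (sol J (of_real x) (of_real u) (of_real v) i) = 0" for u v i
    using cnj_sol[of J "of_real x" "of_real u" "of_real v" i] by (simp add: complex_eq_iff)
  from this[of 1 0] this[of 0 1] show ?thesis
    by (auto simp: toda_A_def toda_op_eq toda_entry_real Im_sum)
qed

lemma toda_op_green:
  assumes J: "bounded_jacobi J" "Im z > 0" and n: "n = 0 \<or> n = 1"
  shows "toda_op p J (green J z (far_col s p)) n =
    toda_A p J z n 0 * green J z (far_col s p) 0 + toda_A p J z n 1 * green J z (far_col s p) 1"
proof -
  obtain f where f: "if s then l2_plus J z f else l2_minus J z f"
    and gf: "\<And>i. (if s then far_col s p \<le> i else i \<le> far_col s p) \<Longrightarrow> green J z (far_col s p) i = f i"
    using green_half_line[OF J] by metis
  have f01: "green J z (far_col s p) 1 = f 1" "green J z (far_col s p) 0 = f 0" by (rule gf, simp add: far_col_def)+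
  have eq: "jacobi_op J f i = z * f i" for i
    using f by (cases s) (auto simp: l2_plus_def l2_minus_def eigen_solution_def)
  have fs: "f i = f 0 * sol J z 1 0 i + f 1 * sol J z 0 1 i" for i
    unfolding sol_basis[of J z "f 0" "f 1" i, symmetric] by (rule sol_unique[OF coeff_a_pos[OF J(1)] eq])
  have "toda_op p J (green J z (far_col s p)) n = toda_op p J f n"
    unfolding toda_op_eq using n by (intro sum.cong refl arg_cong2[where f = "(*)"] gf) (auto simp: far_col_def)
  also have "\<dots> = toda_op p J (\<lambda>i. f 0 * sol J z 1 0 i + f 1 * sol J z 0 1 i) n"
    by (rule arg_cong[where f = "\<lambda>u. toda_op p J u n"]) (rule ext, rule fs)
  also have "\<dots> = f 0 * toda_A p J z n 0 + f 1 * toda_A p J z n 1"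
    by (simp only: toda_op_add toda_op_scale) (simp add: toda_A_def)
  finally show ?thesis by (simp add: f01 mult.commute)
qed

text \<open>All these columns lie on the same side of the sites 0 and 1, where each is a multiple of
  the same Weyl solution. Hence the term of \<open>green_derivative\<close> that mixes columns
  reduces to multiplication by the scalar \<open>flow_c\<close>.\<close>

lemma green_columns_proportional:
  assumes J: "bounded_jacobi J" "Im z > 0" and n: "n = 0 \<or> n = 1"
    and j: "j \<in> {far_col s p - int (degree p)..far_col s p + int (degree p)}"
  shows "green J z j n = green J z j 0 / green J z (far_col s p) 0 * green J z (far_col s p) n"
proof -
  note nz = wronsk_nonzero[OF J] l2_plus_nonzero[OF J f_plus_l2[OF J]] l2_minus_nonzero[OF J f_minus_l2_minus[OF J]]
  show ?thesis
  proof (cases s)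
    case True
    then have "max n j = n" "min n j = j" "max 0 j = 0" "min 0 j = j" "far_col s p \<le> 0" using n j by (auto simp: far_col_def)
    moreover have "max n (far_col s p) = n" "min n (far_col s p) = far_col s p" "max 0 (far_col s p) = 0" "min 0 (far_col s p) = far_col s p"
      using n True by (auto simp: far_col_def)
    ultimately show ?thesis unfolding green_def using nz by (simp add: field_simps)
  next
    case False
    then have "max n j = j" "min n j = n" "max 0 j = j" "min 0 j = 0" using n j by (auto simp: far_col_def)
    moreover have "max n (far_col s p) = far_col s p" "min n (far_col s p) = n" "max 0 (far_col s p) = far_col s p" "min 0 (far_col s p) = 0"
      using n False by (auto simp: far_col_def)
    ultimately show ?thesis unfolding green_def using nz by (simp add: field_simps)
  qed
qed

definition flow_c :: "bool \<Rightarrow> real poly \<Rightarrow> (real \<Rightarrow> jacobi) \<Rightarrow> complex \<Rightarrow> real \<Rightarrow> complex" where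
  "flow_c s p F z t = (\<Sum>j\<in>{far_col s p - int (degree p)..far_col s p + int (degree p)}.
     toda_entry p (F t) j (far_col s p) * (green (F t) z j 0 / green (F t) z (far_col s p) 0))"

lemma green_flow:
  assumes F: "toda_solution p F" and z: "Im z > 0" and n: "n = 0 \<or> n = 1"
  shows "((\<lambda>t. green (F t) z (far_col s p) n) has_vector_derivative
     (toda_A p (F t) z n 1 * green (F t) z (far_col s p) 1 + toda_A p (F t) z n 0 * green (F t) z (far_col s p) 0
      - flow_c s p F z t * green (F t) z (far_col s p) n)) (at t)"
proof -
  note J = toda_bounded[OF F, of t]
  have "(\<Sum>j\<in>{far_col s p - int (degree p)..far_col s p + int (degree p)}. toda_entry p (F t) j (far_col s p) * green (F t) z j n)
    = flow_c s p F z t * green (F t) z (far_col s p) n"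
    unfolding flow_c_def sum_distrib_right
    by (intro sum.cong refl) (subst green_columns_proportional[OF J z n], auto)
  then show ?thesis using green_derivative[OF F z, of "far_col s p" n t] toda_op_green[OF J z n, of p s]
    by (simp add: add.commute)
qed

lemma flow_c_continuous:
  assumes F: "toda_solution p F" and z: "Im z > 0"
  shows "continuous_on UNIV (flow_c s p F z)"
proof -
  have g: "isCont (\<lambda>t. green (F t) z k n) t" for k n t
    using green_derivative[OF F z] by (rule has_vector_derivative_continuous)
  have e: "isCont (\<lambda>t. toda_entry p (F t) j k) t" for j k t
    unfolding isCont_def using toda_coeff_isCont[OF F]
    by (intro toda_entry_tendsto) (auto simp: isCont_def)
  have "isCont (flow_c s p F z) t" for t
    unfolding flow_c_def[abs_def] using green_nonzero[OF toda_bounded[OF F] z]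
    by (intro continuous_sum continuous_mult continuous_divide g e) auto
  then show ?thesis by (simp add: continuous_on_eq_continuous_at)
qed

text \<open>The scalar \<open>flow_c\<close> has no controlled behaviour as \<open>z\<close>
  approaches the real line. Since Weyl vectors may be rescaled freely, the integrating factor
  \<open>e\<close> removes it, and a system with coefficients \<open>toda_A\<close> remains. Time is
  scaled to \<open>{0..1}\<close>, which also admits negative \<open>T\<close>.\<close>

lemma flow_vectors:
  assumes F: "toda_solution p F" and z: "Im z > 0" and r: "weyl_vec s (F 0) z P Q"
  obtains X Y where "X 0 = P" "Y 0 = Q" "weyl_vec s (F T) z (X 1) (Y 1)"
    "lin_sys (\<lambda>u. of_real T * toda_A p (F (T * u)) z 1 1) (\<lambda>u. of_real T * toda_A p (F (T * u)) z 1 0)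
       (\<lambda>u. of_real T * toda_A p (F (T * u)) z 0 1) (\<lambda>u. of_real T * toda_A p (F (T * u)) z 0 0) X Y"
proof -
  let ?g = "\<lambda>n u. green (F (T * u)) z (far_col s p) n"
  obtain l where l: "l \<noteq> 0" "P = l * ?g 1 0" "Q = l * ?g 0 0"
    using weyl_vec_proportional[OF toda_bounded[OF F] z r green_weyl_vec[OF toda_bounded[OF F] z]] by auto
  have "continuous_on {0..1} (\<lambda>u. of_real T * flow_c s p F z (T * u))"
    by (intro continuous_intros continuous_on_compose2[OF flow_c_continuous[OF F z]]) auto
  then obtain C where C: "\<And>u. u \<in> {0..1} \<Longrightarrow> (C has_vector_derivative of_real T * flow_c s p F z (T * u)) (at u within {0..1})"
    using antiderivative_continuous by blast
  define e where "e u = l * exp (C u - C 0)" for u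
  have e: "(e has_vector_derivative of_real T * flow_c s p F z (T * u) * e u) (at u within {0..1})" if "u \<in> {0..1}" for u
  proof -
    have "((\<lambda>u. C u - C 0) has_vector_derivative of_real T * flow_c s p F z (T * u)) (at u within {0..1})"
      using has_vector_derivative_diff[OF C[OF that] has_vector_derivative_const[of "C 0"]] by simp
    moreover have "((\<lambda>w. l * exp w) has_field_derivative l * exp (C u - C 0)) (at (C u - C 0) within (\<lambda>u. C u - C 0) ` {0..1})"
      by (auto intro!: derivative_eq_intros)
    ultimately show ?thesis
      using field_vector_diff_chain_within[of "\<lambda>u. C u - C 0" _ u "{0..1}" "\<lambda>w. l * exp w"] by (simp add: e_def[abs_def] o_def)
  qed
  have g: "(?g n has_vector_derivative of_real T * (toda_A p (F (T * u)) z n 1 * ?g 1 u + toda_A p (F (T * u)) z n 0 * ?g 0 u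
      - flow_c s p F z (T * u) * ?g n u)) (at u within {0..1})" if n: "n = 0 \<or> n = 1" for n u
  proof -
    have "((\<lambda>u. T * u) has_vector_derivative T) (at u within {0..1})"
      by (auto intro!: derivative_eq_intros)
    from vector_diff_chain_within[OF this has_vector_derivative_at_within[OF green_flow[OF F z n, of s "T * u"]]]
    show ?thesis by (simp add: o_def scaleR_conv_of_real)
  qed
  have eg: "((\<lambda>u. e u * ?g n u) has_vector_derivative of_real T * toda_A p (F (T * u)) z n 1 * (e u * ?g 1 u)
      + of_real T * toda_A p (F (T * u)) z n 0 * (e u * ?g 0 u)) (at u within {0..1})" if n: "n = 0 \<or> n = 1" and u: "u \<in> {0..1}" for n u
  proof -
    have "((\<lambda>u. e u * ?g n u) has_vector_derivative e u * (of_real T * (toda_A p (F (T * u)) z n 1 * ?g 1 u + toda_A p (F (T * u)) z n 0 * ?g 0 u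
      - flow_c s p F z (T * u) * ?g n u)) + (of_real T * flow_c s p F z (T * u) * e u) * ?g n u) (at u within {0..1})"
      by (intro has_vector_derivative_mult e u g n)
    then show ?thesis by (simp add: algebra_simps)
  qed
  show thesis
  proof (rule that[of "\<lambda>u. e u * ?g 1 u" "\<lambda>u. e u * ?g 0 u"])
    show "e 0 * ?g 1 0 = P" "e 0 * ?g 0 0 = Q" using l by (auto simp: e_def)
    have "e 1 \<noteq> 0" using l by (simp add: e_def)
    from weyl_vec_scale[OF green_weyl_vec[OF toda_bounded[OF F] z] this] show "weyl_vec s (F T) z (e 1 * ?g 1 1) (e 1 * ?g 0 1)" by simp
    show "lin_sys (\<lambda>u. of_real T * toda_A p (F (T * u)) z 1 1) (\<lambda>u. of_real T * toda_A p (F (T * u)) z 1 0)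
       (\<lambda>u. of_real T * toda_A p (F (T * u)) z 0 1) (\<lambda>u. of_real T * toda_A p (F (T * u)) z 0 0) (\<lambda>u. e u * ?g 1 u) (\<lambda>u. e u * ?g 0 u)"
      unfolding lin_sys_def using eg by blast
  qed
qed

section \<open>The determinant at a boundary point and its invariance\<close>

abbreviation zseq :: "real \<Rightarrow> nat \<Rightarrow> complex" where
  "zseq x k \<equiv> Complex x (1 / real (Suc k))"

text \<open>The limit \<open>c\<close> is the negative of the determinant at \<open>x\<close>. Limits of the \<open>m\<close> functions
  themselves need not be followed along the flow.\<close>

definition boundary_det :: "jacobi \<Rightarrow> real \<Rightarrow> real \<Rightarrow> bool" where
  "boundary_det J x c \<longleftrightarrow> (\<exists>P Q P' Q' B \<delta>. \<delta> > 0 \<and>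
     (\<forall>k. weyl_vec True J (zseq x k) (P k) (Q k) \<and> weyl_vec False J (zseq x k) (P' k) (Q' k)) \<and>
     (\<forall>k. cmod (P k) \<le> B \<and> cmod (Q k) \<le> B \<and> cmod (P' k) \<le> B \<and> cmod (Q' k) \<le> B) \<and>
     (\<forall>\<^sub>F k in sequentially. \<delta> \<le> cmod (P k * Q' k - Q k * P' k)) \<and>
     (\<lambda>k. Im (P k * cnj (Q k)) * Im (P' k * cnj (Q' k)) / (cmod (P k * Q' k - Q k * P' k))\<^sup>2) \<longlonglongrightarrow> c)"

lemma boundary_detI:
  assumes "\<delta> > 0" "\<And>k. weyl_vec True J (zseq x k) (P k) (Q k)" "\<And>k. weyl_vec False J (zseq x k) (P' k) (Q' k)"
    "\<And>k. cmod (P k) \<le> B \<and> cmod (Q k) \<le> B \<and> cmod (P' k) \<le> B \<and> cmod (Q' k) \<le> B"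
    "\<forall>\<^sub>F k in sequentially. \<delta> \<le> cmod (P k * Q' k - Q k * P' k)"
    "(\<lambda>k. Im (P k * cnj (Q k)) * Im (P' k * cnj (Q' k)) / (cmod (P k * Q' k - Q k * P' k))\<^sup>2) \<longlonglongrightarrow> c"
  shows "boundary_det J x c"
  unfolding boundary_det_def
  by (rule exI[of _ P], rule exI[of _ Q], rule exI[of _ P'], rule exI[of _ Q'], rule exI[of _ B], rule exI[of _ \<delta>])
    (intro conjI allI assms)

lemma boundary_detE:
  assumes "boundary_det J x c"
  obtains P Q P' Q' B \<delta> where "\<delta> > 0" "\<forall>\<^sub>F k in sequentially. \<delta> \<le> cmod (P k * Q' k - Q k * P' k)"
    "\<And>k. weyl_vec True J (zseq x k) (P k) (Q k)" "\<And>k. weyl_vec False J (zseq x k) (P' k) (Q' k)"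
    "\<And>k. cmod (P k) \<le> B \<and> cmod (Q k) \<le> B \<and> cmod (P' k) \<le> B \<and> cmod (Q' k) \<le> B"
    "(\<lambda>k. Im (P k * cnj (Q k)) * Im (P' k * cnj (Q' k)) / (cmod (P k * Q' k - Q k * P' k))\<^sup>2) \<longlonglongrightarrow> c"
  using assms unfolding boundary_det_def
proof (elim exE conjE)
  fix P Q P' Q' B \<delta>
  assume a: "\<delta> > 0" and b: "\<forall>k. weyl_vec True J (zseq x k) (P k) (Q k) \<and> weyl_vec False J (zseq x k) (P' k) (Q' k)"
    and c: "\<forall>k. cmod (P k) \<le> B \<and> cmod (Q k) \<le> B \<and> cmod (P' k) \<le> B \<and> cmod (Q' k) \<le> B"
    and d: "\<forall>\<^sub>F k in sequentially. \<delta> \<le> cmod (P k * Q' k - Q k * P' k)"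
    and e: "(\<lambda>k. Im (P k * cnj (Q k)) * Im (P' k * cnj (Q' k)) / (cmod (P k * Q' k - Q k * P' k))\<^sup>2) \<longlonglongrightarrow> c"
  show thesis by (rule that[OF a d conjunct1[OF spec[OF b]] conjunct2[OF spec[OF b]] spec[OF c] e])
qed

lemma null_times_bounded:
  fixes f g :: "nat \<Rightarrow> real"
  assumes "f \<longlonglongrightarrow> 0" "\<forall>\<^sub>F k in sequentially. \<bar>g k\<bar> \<le> K"
  shows "(\<lambda>k. f k * g k) \<longlonglongrightarrow> 0"
proof (rule Lim_null_comparison)
  show "\<forall>\<^sub>F k in sequentially. norm (f k * g k) \<le> K * \<bar>f k\<bar>"
    using assms(2)
  proof eventually_elim
    case (elim k)
    then show ?case using mult_right_mono[OF elim, of "\<bar>f k\<bar>"] by (simp add: abs_mult mult.commute)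
  qed
  show "(\<lambda>k. K * \<bar>f k\<bar>) \<longlonglongrightarrow> 0" using tendsto_mult_right_zero[OF tendsto_rabs_zero[OF assms(1)]] .
qed

text \<open>Numerator and squared denominator are both multiplied by \<open>r^2\<close> up to null
  sequences. Boundedness makes the errors of the products null, and the lower bound
  \<open>\<delta>\<close> lets them be divided; it is passed on as \<open>r * \<delta> / 2\<close>
  for the next step.\<close>

lemma ratio_limit:
  fixes a b a1 b1 :: "nat \<Rightarrow> real" and w w1 :: "nat \<Rightarrow> complex"
  assumes r: "r > 0" and \<delta>: "\<delta> > 0" "\<forall>\<^sub>F k in sequentially. \<delta> \<le> cmod (w k)"
    and bd: "\<And>k. \<bar>a k\<bar> \<le> A" "\<And>k. \<bar>b1 k\<bar> \<le> A" "\<And>k. cmod (w k) \<le> A" "\<And>k. cmod (w1 k) \<le> A"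
    and lim: "(\<lambda>k. a1 k - r * a k) \<longlonglongrightarrow> 0" "(\<lambda>k. b1 k - r * b k) \<longlonglongrightarrow> 0" "(\<lambda>k. w1 k - of_real r * w k) \<longlonglongrightarrow> 0"
    and c: "(\<lambda>k. a k * b k / (cmod (w k))\<^sup>2) \<longlonglongrightarrow> c"
  shows "\<forall>\<^sub>F k in sequentially. r * \<delta> / 2 \<le> cmod (w1 k)" "(\<lambda>k. a1 k * b1 k / (cmod (w1 k))\<^sup>2) \<longlonglongrightarrow> c"
proof -
  have cw: "cmod (of_real r * w k) = r * cmod (w k)" for k using r by (simp add: norm_mult)
  have "\<forall>\<^sub>F k in sequentially. dist (w1 k - of_real r * w k) 0 < r * \<delta> / 2"
    using lim(3) by (rule tendstoD) (use r \<delta> in simp)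
  with \<delta>(2) show low: "\<forall>\<^sub>F k in sequentially. r * \<delta> / 2 \<le> cmod (w1 k)"
  proof eventually_elim
    case (elim k)
    have "r * \<delta> \<le> r * cmod (w k)" using elim(1) r by simp
    moreover have "r * cmod (w k) \<le> cmod (w1 k) + cmod (w1 k - of_real r * w k)"
      using norm_triangle_ineq2[of "of_real r * w k" "w1 k"] by (simp add: cw norm_minus_commute)
    ultimately show ?case using elim(2) by simp
  qed
  have "A \<ge> 0" using order_trans[OF abs_ge_zero bd(1)] .
  have d0: "(\<lambda>k. cmod (w1 k) - r * cmod (w k)) \<longlonglongrightarrow> 0"
  proof (rule Lim_null_comparison[OF _ tendsto_norm_zero[OF lim(3)]])
    show "\<forall>\<^sub>F k in sequentially. norm (cmod (w1 k) - r * cmod (w k)) \<le> cmod (w1 k - of_real r * w k)"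
      using norm_triangle_ineq3[of "w1 _" "of_real r * w _"] by (intro always_eventually) (simp add: cw)
  qed
  have d1: "(\<lambda>k. (cmod (w1 k) - r * cmod (w k)) * (cmod (w1 k) + r * cmod (w k))) \<longlonglongrightarrow> 0"
  proof (rule null_times_bounded[OF d0])
    show "\<forall>\<^sub>F k in sequentially. \<bar>cmod (w1 k) + r * cmod (w k)\<bar> \<le> A + r * A"
    proof (intro always_eventually allI)
      fix k
      have "cmod (w1 k) + r * cmod (w k) \<le> A + r * A" using bd(3)[of k] bd(4)[of k] r by (intro add_mono mult_left_mono) auto
      then show "\<bar>cmod (w1 k) + r * cmod (w k)\<bar> \<le> A + r * A" using r by simp
    qed
  qed
  have n1: "(\<lambda>k. (a1 k - r * a k) * b1 k + (b1 k - r * b k) * (r * a k)) \<longlonglongrightarrow> 0 + 0"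
  proof (intro tendsto_add null_times_bounded lim)
    show "\<forall>\<^sub>F k in sequentially. \<bar>b1 k\<bar> \<le> A" using bd(2) by (intro always_eventually) auto
    show "\<forall>\<^sub>F k in sequentially. \<bar>r * a k\<bar> \<le> r * A" using bd(1) r by (intro always_eventually) (auto simp: abs_mult)
  qed
  have num: "(\<lambda>k. (a1 k - r * a k) * b1 k + (b1 k - r * b k) * (r * a k)
      - a k * b k / (cmod (w k))\<^sup>2 * ((cmod (w1 k) - r * cmod (w k)) * (cmod (w1 k) + r * cmod (w k)))) \<longlonglongrightarrow> 0 + 0 - c * 0"
    by (intro tendsto_diff tendsto_mult n1 c d1)
  have "(\<lambda>k. ((a1 k - r * a k) * b1 k + (b1 k - r * b k) * (r * a k)
      - a k * b k / (cmod (w k))\<^sup>2 * ((cmod (w1 k) - r * cmod (w k)) * (cmod (w1 k) + r * cmod (w k)))) * (1 / (cmod (w1 k))\<^sup>2)) \<longlonglongrightarrow> 0"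
  proof (rule null_times_bounded)
    show "\<forall>\<^sub>F k in sequentially. \<bar>1 / (cmod (w1 k))\<^sup>2\<bar> \<le> 1 / (r * \<delta> / 2)\<^sup>2"
      using low
    proof eventually_elim
      case (elim k)
      have p: "0 < r * \<delta> / 2" using r \<delta> by simp
      then have "0 < cmod (w1 k)" using elim by linarith
      then show ?case using elim p by (auto intro!: divide_left_mono power_mono mult_pos_pos simp: less_imp_le)
    qed
  qed (use num in simp)
  moreover have "\<forall>\<^sub>F k in sequentially. ((a1 k - r * a k) * b1 k + (b1 k - r * b k) * (r * a k)
      - a k * b k / (cmod (w k))\<^sup>2 * ((cmod (w1 k) - r * cmod (w k)) * (cmod (w1 k) + r * cmod (w k)))) * (1 / (cmod (w1 k))\<^sup>2)
      = a1 k * b1 k / (cmod (w1 k))\<^sup>2 - a k * b k / (cmod (w k))\<^sup>2"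
    using low \<delta>(2)
  proof eventually_elim
    case (elim k)
    have p: "0 < r * \<delta> / 2" using r \<delta> by simp
    have nz: "cmod (w1 k) \<noteq> 0" "cmod (w k) \<noteq> 0" using elim p \<delta>(1) by auto
    define v v1 where "v = cmod (w k)" and "v1 = cmod (w1 k)"
    have "v \<noteq> 0" "v1 \<noteq> 0" using nz by (auto simp: v_def v1_def)
    then have "((a1 k - r * a k) * b1 k + (b1 k - r * b k) * (r * a k) - a k * b k / v\<^sup>2 * ((v1 - r * v) * (v1 + r * v))) * (1 / v1\<^sup>2)
      = a1 k * b1 k / v1\<^sup>2 - a k * b k / v\<^sup>2"
      by (simp add: field_simps power2_eq_square)
    then show ?case by (simp add: v_def v1_def)
  qed
  ultimately have "(\<lambda>k. a1 k * b1 k / (cmod (w1 k))\<^sup>2 - a k * b k / (cmod (w k))\<^sup>2) \<longlonglongrightarrow> 0"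
    by (rule Lim_transform_eventually)
  from tendsto_add[OF this c] show "(\<lambda>k. a1 k * b1 k / (cmod (w1 k))\<^sup>2) \<longlonglongrightarrow> c" by simp
qed

lemma boundary_det_step:
  fixes P Q P' Q' R S R' S' :: "nat \<Rightarrow> complex"
  assumes r: "r > 0" and \<delta>: "\<delta> > 0" "\<forall>\<^sub>F k in sequentially. \<delta> \<le> cmod (P k * Q' k - Q k * P' k)"
    and B: "\<And>k. cmod (P k) \<le> B \<and> cmod (Q k) \<le> B \<and> cmod (P' k) \<le> B \<and> cmod (Q' k) \<le> B"
    and K: "\<And>k. cmod (R k) \<le> K \<and> cmod (S k) \<le> K \<and> cmod (R' k) \<le> K \<and> cmod (S' k) \<le> K"
    and weyl_vec: "\<And>k. weyl_vec True J (zseq x k) (R k) (S k)" "\<And>k. weyl_vec False J (zseq x k) (R' k) (S' k)"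
    and lim: "(\<lambda>k. (R k * S' k - S k * R' k) - of_real r * (P k * Q' k - Q k * P' k)) \<longlonglongrightarrow> 0"
      "(\<lambda>k. Im (R k * cnj (S k)) - r * Im (P k * cnj (Q k))) \<longlonglongrightarrow> 0"
      "(\<lambda>k. Im (R' k * cnj (S' k)) - r * Im (P' k * cnj (Q' k))) \<longlonglongrightarrow> 0"
    and c: "(\<lambda>k. Im (P k * cnj (Q k)) * Im (P' k * cnj (Q' k)) / (cmod (P k * Q' k - Q k * P' k))\<^sup>2) \<longlonglongrightarrow> c"
  shows "boundary_det J x c"
proof -
  \<comment> \<open>One bound for both kinds of brackets; the factor 2 is for the two products in a
    determinant.\<close>
  define A where "A = 2 * (max B K * max B K)"
  have M0: "0 \<le> max B K" using B[of 0] norm_ge_zero[of "P 0"] by linarith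
  have m: "cmod u * cmod v \<le> max B K * max B K" if "cmod u \<le> max B K" "cmod v \<le> max B K" for u v
    using that M0 by (intro mult_mono) auto
  have im: "\<bar>Im (u * cnj v)\<bar> \<le> A" if "cmod u \<le> max B K" "cmod v \<le> max B K" for u v
    using abs_Im_le_cmod[of "u * cnj v"] m[OF that] M0 unfolding A_def norm_mult complex_mod_cnj
    by (smt (verit) mult_nonneg_nonneg)
  have dt: "cmod (u * v - u' * v') \<le> A" if "cmod u \<le> max B K" "cmod v \<le> max B K" "cmod u' \<le> max B K" "cmod v' \<le> max B K" for u v u' v'
    using norm_triangle_ineq4[of "u * v" "u' * v'"] m[OF that(1,2)] m[OF that(3,4)] unfolding A_def norm_mult by linarith
  have B': "cmod (P k) \<le> max B K" "cmod (Q k) \<le> max B K" "cmod (P' k) \<le> max B K" "cmod (Q' k) \<le> max B K" for k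
    using B[of k] by auto
  have K': "cmod (R k) \<le> max B K" "cmod (S k) \<le> max B K" "cmod (R' k) \<le> max B K" "cmod (S' k) \<le> max B K" for k
    using K[of k] by auto
  note rl = ratio_limit[OF r \<delta> im[OF B'(1,2)] im[OF K'(3,4)] dt[OF B'(1,4,2,3)] dt[OF K'(1,4,2,3)] lim(2,3,1) c]
  have "r * \<delta> / 2 > 0" using r \<delta>(1) by simp
  then show ?thesis by (rule boundary_detI[OF _ weyl_vec K rl])
qed

lemma zseq_Im [simp]: "Im (zseq x k) > 0" by simp

lemma zseq_tendsto: "zseq x \<longlonglongrightarrow> of_real x"
proof -
  have "zseq x \<longlonglongrightarrow> Complex x 0" by (intro tendsto_Complex tendsto_const inverse_Suc_LIMSEQ)
  then show ?thesis by (simp add: complex_of_real_def)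
qed

lemma boundary_det_toda:
  assumes F: "toda_solution p F" and g: "boundary_det (F 0) x c"
  shows "boundary_det (F T) x c"
using g
proof (rule boundary_detE)
  fix P Q P' Q' :: "nat \<Rightarrow> complex" and B \<delta> :: real
  assume \<delta>: "\<delta> > 0" "\<forall>\<^sub>F k in sequentially. \<delta> \<le> cmod (P k * Q' k - Q k * P' k)"
    and weyl_vec: "\<And>k. weyl_vec True (F 0) (zseq x k) (P k) (Q k)" "\<And>k. weyl_vec False (F 0) (zseq x k) (P' k) (Q' k)"
    and B: "\<And>k. cmod (P k) \<le> B \<and> cmod (Q k) \<le> B \<and> cmod (P' k) \<le> B \<and> cmod (Q' k) \<le> B"
    and c: "(\<lambda>k. Im (P k * cnj (Q k)) * Im (P' k * cnj (Q' k)) / (cmod (P k * Q' k - Q k * P' k))\<^sup>2) \<longlonglongrightarrow> c"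
  define A where "A n j u w = of_real T * toda_A p (F (T * u)) w n j" for n j :: int and u :: real and w :: complex
  have ex: "\<exists>X Y. X 0 = p0 \<and> Y 0 = q0 \<and> weyl_vec s (F T) (zseq x k) (X 1) (Y 1) \<and>
      lin_sys (\<lambda>u. A 1 1 u (zseq x k)) (\<lambda>u. A 1 0 u (zseq x k)) (\<lambda>u. A 0 1 u (zseq x k)) (\<lambda>u. A 0 0 u (zseq x k)) X Y"
    if "weyl_vec s (F 0) (zseq x k) p0 q0" for s k p0 q0
  proof (rule flow_vectors[OF F zseq_Im that, of T])
    fix X Y assume h: "X 0 = p0" "Y 0 = q0" "weyl_vec s (F T) (zseq x k) (X 1) (Y 1)"
      "lin_sys (\<lambda>u. of_real T * toda_A p (F (T * u)) (zseq x k) 1 1) (\<lambda>u. of_real T * toda_A p (F (T * u)) (zseq x k) 1 0)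
       (\<lambda>u. of_real T * toda_A p (F (T * u)) (zseq x k) 0 1) (\<lambda>u. of_real T * toda_A p (F (T * u)) (zseq x k) 0 0) X Y"
    show ?thesis unfolding A_def by (rule exI[of _ X], rule exI[of _ Y]) (intro conjI h)
  qed
  let ?R = "\<lambda>s p0 q0 k X Y. X 0 = p0 \<and> Y 0 = q0 \<and> weyl_vec s (F T) (zseq x k) (X 1) (Y 1) \<and>
      lin_sys (\<lambda>u. A 1 1 u (zseq x k)) (\<lambda>u. A 1 0 u (zseq x k)) (\<lambda>u. A 0 1 u (zseq x k)) (\<lambda>u. A 0 0 u (zseq x k)) X Y"
  have "\<forall>k. \<exists>X Y. ?R True (P k) (Q k) k X Y" using ex[OF weyl_vec(1)] by blast
  from choice[OF this] obtain X where "\<forall>k. \<exists>Y. ?R True (P k) (Q k) k (X k) Y" ..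
  from choice[OF this] obtain Y where "\<forall>k. ?R True (P k) (Q k) k (X k) (Y k)" ..
  then have XY: "\<And>k. X k 0 = P k" "\<And>k. Y k 0 = Q k" "\<And>k. weyl_vec True (F T) (zseq x k) (X k 1) (Y k 1)"
    "\<And>k. lin_sys (\<lambda>u. A 1 1 u (zseq x k)) (\<lambda>u. A 1 0 u (zseq x k)) (\<lambda>u. A 0 1 u (zseq x k)) (\<lambda>u. A 0 0 u (zseq x k)) (X k) (Y k)"
    by blast+
  have "\<forall>k. \<exists>X Y. ?R False (P' k) (Q' k) k X Y" using ex[OF weyl_vec(2)] by blast
  from choice[OF this] obtain V where "\<forall>k. \<exists>Y. ?R False (P' k) (Q' k) k (V k) Y" ..
  from choice[OF this] obtain W where "\<forall>k. ?R False (P' k) (Q' k) k (V k) (W k)" ..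
  then have VW: "\<And>k. V k 0 = P' k" "\<And>k. W k 0 = Q' k" "\<And>k. weyl_vec False (F T) (zseq x k) (V k 1) (W k 1)"
    "\<And>k. lin_sys (\<lambda>u. A 1 1 u (zseq x k)) (\<lambda>u. A 1 0 u (zseq x k)) (\<lambda>u. A 0 1 u (zseq x k)) (\<lambda>u. A 0 0 u (zseq x k)) (V k) (W k)"
    by blast+
  \<comment> \<open>Continuity must be joint in time and spectral parameter, since it is compactness
    of the product that yields closeness to the real coefficients uniformly in time.\<close>
  have cont: "continuous_on ({0..1} \<times> cball (of_real x) 1) (\<lambda>(s, w). A n j s w)" for n j
    unfolding continuous_on_def
  proof (intro ballI)
    fix q :: "real \<times> complex"
    define G where "G = at q within ({0..1} \<times> cball (of_real x) 1)"
    have q1: "((\<lambda>q. T * fst q) \<longlongrightarrow> T * fst q) G" "(snd \<longlongrightarrow> snd q) G"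
      unfolding G_def by (auto intro!: tendsto_intros)
    have a: "((\<lambda>q. coeff_a (F (T * fst q)) n) \<longlongrightarrow> coeff_a (F (T * fst q)) n) G" for n
      by (rule isCont_tendsto_compose[OF toda_coeff_isCont(1)[OF F] q1(1)])
    have b: "((\<lambda>q. coeff_b (F (T * fst q)) n) \<longlongrightarrow> coeff_b (F (T * fst q)) n) G" for n
      by (rule isCont_tendsto_compose[OF toda_coeff_isCont(2)[OF F] q1(1)])
    have "((\<lambda>q. of_real T * toda_A p (F (T * fst q)) (snd q) n j) \<longlongrightarrow> of_real T * toda_A p (F (T * fst q)) (snd q) n j) G"
      by (intro tendsto_mult tendsto_const toda_A_tendsto a b coeff_a_pos[OF toda_bounded[OF F]] q1(2))
    then show "((\<lambda>(s, w). A n j s w) \<longlongrightarrow> (case q of (s, w) \<Rightarrow> A n j s w)) (at q within {0..1} \<times> cball (of_real x) 1)"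
      by (simp add: A_def G_def case_prod_unfold)
  qed
  have real: "Im (A n j s (of_real x)) = 0" for n j s by (simp add: A_def toda_A_real)
  have zc: "zseq x k \<in> cball (of_real x) 1" for k
  proof -
    have "zseq x k - of_real x = Complex 0 (1 / real (Suc k))" by (simp add: complex_eq_iff)
    then have "dist (of_real x) (zseq x k) = 1 / real (Suc k)" by (simp add: dist_norm norm_minus_commute cmod_def)
    then show ?thesis by simp
  qed
  obtain r K where rK: "r > 0" "\<And>k. cmod (X k 1) \<le> K \<and> cmod (Y k 1) \<le> K \<and> cmod (V k 1) \<le> K \<and> cmod (W k 1) \<le> K"
    "(\<lambda>k. (X k 1 * W k 1 - Y k 1 * V k 1) - of_real r * (X k 0 * W k 0 - Y k 0 * V k 0)) \<longlonglongrightarrow> 0"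
    "(\<lambda>k. Im (X k 1 * cnj (Y k 1)) - r * Im (X k 0 * cnj (Y k 0))) \<longlonglongrightarrow> 0"
    "(\<lambda>k. Im (V k 1 * cnj (W k 1)) - r * Im (V k 0 * cnj (W k 0))) \<longlonglongrightarrow> 0"
    by (rule linear_flow_asymptotics[OF cont cont cont cont real real real real zc zseq_tendsto XY(4) VW(4), of B])
      (use B in \<open>auto simp: XY VW\<close>)
  show ?thesis
    by (rule boundary_det_step[OF rK(1) \<delta> B rK(2) XY(3) VW(3) rK(3-5)[unfolded XY(1,2) VW(1,2)] c])
qed

section \<open>Shifts\<close>

lemma shift_coeffs [simp]: "coeff_a (shift k J) n = coeff_a J (n - k)" "coeff_b (shift k J) n = coeff_b J (n - k)"
  by (simp_all add: shift_def)

lemma shift_shift: "shift j (shift k J) = shift (j + k) J"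
  by (simp add: shift_def algebra_simps)

lemma bounded_jacobi_shift: "bounded_jacobi J \<Longrightarrow> bounded_jacobi (shift k J)"
  unfolding bounded_jacobi_def by (auto intro: bounded_subset)

lemma jacobi_op_shift: "jacobi_op (shift k J) (\<lambda>n. f (n - k)) n = jacobi_op J f (n - k)"
  by (simp add: jacobi_op_def algebra_simps)

lemma l2_plus_shift:
  assumes "l2_plus J z f" shows "l2_plus (shift k J) z (\<lambda>n. f (n - k))"
proof -
  obtain m where m: "f m \<noteq> 0" and eq: "\<And>n. jacobi_op J f n = z * f n"
    using assms by (auto simp: l2_plus_def eigen_solution_def)
  have "bij_betw (\<lambda>n. n - k) {0..} {-k..}"
    by (rule bij_betw_byWitness[where f' = "\<lambda>n. n + k"]) auto
  then have "(\<lambda>n. (cmod (f (n - k)))\<^sup>2) summable_on {0..}"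
    using summable_on_reindex_bij_betw[of "\<lambda>n. n - k" "{0..}" "{-k..}" "\<lambda>n. (cmod (f n))\<^sup>2"] l2_plus_ray[OF assms] by simp
  moreover have "eigen_solution (shift k J) z (\<lambda>n. f (n - k))"
    unfolding eigen_solution_def jacobi_op_shift using m eq by (auto intro!: exI[of _ "m + k"])
  ultimately show ?thesis by (simp add: l2_plus_def)
qed

lemma l2_minus_shift:
  assumes "l2_minus J z f" shows "l2_minus (shift k J) z (\<lambda>n. f (n - k))"
proof -
  obtain m where m: "f m \<noteq> 0" and eq: "\<And>n. jacobi_op J f n = z * f n"
    using assms by (auto simp: l2_minus_def eigen_solution_def)
  have "bij_betw (\<lambda>n. n - k) {..0} {..-k}"
    by (rule bij_betw_byWitness[where f' = "\<lambda>n. n + k"]) auto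
  then have "(\<lambda>n. (cmod (f (n - k)))\<^sup>2) summable_on {..0}"
    using summable_on_reindex_bij_betw[of "\<lambda>n. n - k" "{..0}" "{..-k}" "\<lambda>n. (cmod (f n))\<^sup>2"] l2_minus_ray[OF assms] by simp
  moreover have "eigen_solution (shift k J) z (\<lambda>n. f (n - k))"
    unfolding eigen_solution_def jacobi_op_shift using m eq by (auto intro!: exI[of _ "m + k"])
  ultimately show ?thesis by (simp add: l2_minus_def)
qed

lemma weyl_vec_shift_right:
  assumes J: "bounded_jacobi J" and r: "weyl_vec s J z P Q"
  shows "weyl_vec s (shift 1 J) z Q (((z - of_real (coeff_b J 0)) * Q - of_real (coeff_a J 0) * P) / of_real (coeff_a J (- 1)))"
proof -
  obtain f where f: "if s then l2_plus J z f else l2_minus J z f" "f 1 = P" "f 0 = Q" using r by (auto simp: weyl_vec_def)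
  have "jacobi_op J f 0 = z * f 0" using f(1) by (cases s) (auto simp: l2_plus_def l2_minus_def eigen_solution_def)
  then have "f (-1) = ((z - of_real (coeff_b J 0)) * Q - of_real (coeff_a J 0) * P) / of_real (coeff_a J (- 1))"
    using f coeff_a_pos[OF J, of "-1"] by (simp add: jacobi_op_def field_simps)
  then show ?thesis unfolding weyl_vec_def using f l2_plus_shift[of J z f 1] l2_minus_shift[of J z f 1]
    by (intro exI[of _ "\<lambda>n. f (n - 1)"]) auto
qed

lemma weyl_vec_shift_left:
  assumes J: "bounded_jacobi J" and r: "weyl_vec s J z P Q"
  shows "weyl_vec s (shift (- 1) J) z (((z - of_real (coeff_b J 1)) * P - of_real (coeff_a J 0) * Q) / of_real (coeff_a J 1)) P"
proof -
  obtain f where f: "if s then l2_plus J z f else l2_minus J z f" "f 1 = P" "f 0 = Q" using r by (auto simp: weyl_vec_def)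
  have "jacobi_op J f 1 = z * f 1" using f(1) by (cases s) (auto simp: l2_plus_def l2_minus_def eigen_solution_def)
  then have "f 2 = ((z - of_real (coeff_b J 1)) * P - of_real (coeff_a J 0) * Q) / of_real (coeff_a J 1)"
    using f coeff_a_pos[OF J, of 1] by (simp add: jacobi_op_def field_simps)
  then show ?thesis unfolding weyl_vec_def using f l2_plus_shift[of J z f "-1"] l2_minus_shift[of J z f "-1"]
    by (intro exI[of _ "\<lambda>n. f (n + 1)"]) auto
qed

lemma zseq_bounded: "cmod (zseq x k) \<le> \<bar>x\<bar> + 1"
proof -
  have "\<bar>1 / real (Suc k)\<bar> \<le> 1" by simp
  then show ?thesis using cmod_le[of "zseq x k"] unfolding complex.sel by linarith
qed

lemma shift_term_bound:
  assumes "cmod P \<le> B" "cmod Q \<le> B" "a > 0"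
  shows "cmod (((zseq x k - of_real b) * P - of_real a0 * Q) / of_real a) \<le> ((\<bar>x\<bar> + 1 + \<bar>b\<bar>) * B + \<bar>a0\<bar> * B) / a"
proof -
  have "cmod (zseq x k - of_real b) \<le> \<bar>x\<bar> + 1 + \<bar>b\<bar>"
    using norm_triangle_ineq4[of "zseq x k" "of_real b"] zseq_bounded[of x k] by simp
  then have "cmod ((zseq x k - of_real b) * P) \<le> (\<bar>x\<bar> + 1 + \<bar>b\<bar>) * B"
    unfolding norm_mult using assms by (intro mult_mono) auto
  moreover have "cmod (of_real a0 * Q) \<le> \<bar>a0\<bar> * B" using assms by (simp add: norm_mult mult_left_mono)
  ultimately have "cmod ((zseq x k - of_real b) * P - of_real a0 * Q) \<le> (\<bar>x\<bar> + 1 + \<bar>b\<bar>) * B + \<bar>a0\<bar> * B"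
    using norm_triangle_ineq4[of "(zseq x k - of_real b) * P" "of_real a0 * Q"] by linarith
  then show ?thesis using assms(3) by (simp add: norm_divide divide_right_mono)
qed

lemma Im_shift_null:
  assumes "\<And>k. cmod (P k) \<le> B"
  shows "(\<lambda>k. 1 / real (Suc k) * ((cmod (P k))\<^sup>2 * C)) \<longlonglongrightarrow> 0"
proof (rule null_times_bounded[OF inverse_Suc_LIMSEQ])
  show "\<forall>\<^sub>F k in sequentially. \<bar>(cmod (P k))\<^sup>2 * C\<bar> \<le> B\<^sup>2 * \<bar>C\<bar>"
    using assms by (intro always_eventually) (auto simp: abs_mult intro!: mult_right_mono power_mono)
qed

text \<open>The transfer matrix has determinant \<open>a0 / a\<close>, so the Wronskian of the two
  solutions is multiplied by it exactly. It is real up to the imaginary part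
  \<open>1 / (k + 1)\<close> of the spectral parameter, which is the only source of error in the
  other two brackets.\<close>

lemma boundary_det_shift_right:
  assumes J: "bounded_jacobi J" and g: "boundary_det J x c"
  shows "boundary_det (shift 1 J) x c"
using g
proof (rule boundary_detE)
  fix P Q P' Q' :: "nat \<Rightarrow> complex" and B \<delta> :: real
  assume \<delta>: "\<delta> > 0" "\<forall>\<^sub>F k in sequentially. \<delta> \<le> cmod (P k * Q' k - Q k * P' k)"
    and weyl_vec: "\<And>k. weyl_vec True J (zseq x k) (P k) (Q k)" "\<And>k. weyl_vec False J (zseq x k) (P' k) (Q' k)"
    and B: "\<And>k. cmod (P k) \<le> B \<and> cmod (Q k) \<le> B \<and> cmod (P' k) \<le> B \<and> cmod (Q' k) \<le> B"
    and c: "(\<lambda>k. Im (P k * cnj (Q k)) * Im (P' k * cnj (Q' k)) / (cmod (P k * Q' k - Q k * P' k))\<^sup>2) \<longlonglongrightarrow> c"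
  define a0 a b where "a0 = coeff_a J 0" and "a = coeff_a J (- 1)" and "b = coeff_b J 0"
  have a: "a0 > 0" "a > 0" using coeff_a_pos[OF J] by (auto simp: a0_def a_def)
  define N where "N k P Q = ((zseq x k - of_real b) * Q - of_real a0 * P) / of_real a" for k P Q
  have im: "Im (Q * cnj (N k P Q)) - a0 / a * Im (P * cnj Q) = 1 / real (Suc k) * ((cmod Q)\<^sup>2 * (- 1 / a))" for k P Q
  proof -
    define y I where "y = 1 / real (Suc k)" and "I = Im (P * cnj Q)"
    have cq: "(cmod Q)\<^sup>2 = Re Q * Re Q + Im Q * Im Q" unfolding cmod_power2 by (simp add: power2_eq_square)
    have "Im (Q * ((cnj (Complex x y) - of_real b) * cnj Q - of_real a0 * cnj P)) = - y * (cmod Q)\<^sup>2 + a0 * I"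
      by (simp add: cq I_def algebra_simps)
    moreover have "Q * cnj (N k P Q) = of_real (1 / a) * (Q * ((cnj (Complex x y) - of_real b) * cnj Q - of_real a0 * cnj P))"
      by (simp add: N_def y_def)
    moreover have "Im (of_real (1 / a) * w) = (1 / a) * Im w" for w by simp
    ultimately have "Im (Q * cnj (N k P Q)) = (1 / a) * (- y * (cmod Q)\<^sup>2 + a0 * I)" by metis
    then have "Im (Q * cnj (N k P Q)) - a0 / a * I = y * ((cmod Q)\<^sup>2 * (- 1 / a))" using a by (simp only:) (simp add: field_simps)
    then show ?thesis by (simp only: y_def I_def)
  qed
  define K where "K = max B (((\<bar>x\<bar> + 1 + \<bar>b\<bar>) * B + \<bar>a0\<bar> * B) / a)"
  show ?thesis
  proof (rule boundary_det_step[where r = "a0 / a" and K = K and P = P and Q = Q and P' = P' and Q' = Q' and R = Q and R' = Q'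
        and S = "\<lambda>k. N k (P k) (Q k)" and S' = "\<lambda>k. N k (P' k) (Q' k)", OF _ \<delta> B])
    show "a0 / a > 0" using a by simp
    show "cmod (Q k) \<le> K \<and> cmod (N k (P k) (Q k)) \<le> K \<and> cmod (Q' k) \<le> K \<and> cmod (N k (P' k) (Q' k)) \<le> K" for k
      using B[of k] shift_term_bound[OF _ _ a(2), of "Q k" B "P k" x k b a0] shift_term_bound[OF _ _ a(2), of "Q' k" B "P' k" x k b a0]
      unfolding N_def K_def by (simp add: max.coboundedI1 max.coboundedI2)
    show "weyl_vec True (shift 1 J) (zseq x k) (Q k) (N k (P k) (Q k))" for k
      unfolding N_def a0_def a_def b_def by (rule weyl_vec_shift_right[OF J weyl_vec(1)])
    show "weyl_vec False (shift 1 J) (zseq x k) (Q' k) (N k (P' k) (Q' k))" for k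
      unfolding N_def a0_def a_def b_def by (rule weyl_vec_shift_right[OF J weyl_vec(2)])
    have "Q k * N k (P' k) (Q' k) - N k (P k) (Q k) * Q' k - of_real (a0 / a) * (P k * Q' k - Q k * P' k) = 0" for k
      using a by (simp add: N_def field_simps)
    then show "(\<lambda>k. Q k * N k (P' k) (Q' k) - N k (P k) (Q k) * Q' k - of_real (a0 / a) * (P k * Q' k - Q k * P' k)) \<longlonglongrightarrow> 0"
      by simp
    show "(\<lambda>k. Im (Q k * cnj (N k (P k) (Q k))) - a0 / a * Im (P k * cnj (Q k))) \<longlonglongrightarrow> 0"
      unfolding im using B by (intro Im_shift_null) auto
    show "(\<lambda>k. Im (Q' k * cnj (N k (P' k) (Q' k))) - a0 / a * Im (P' k * cnj (Q' k))) \<longlonglongrightarrow> 0"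
      unfolding im using B by (intro Im_shift_null) auto
  qed (rule c)
qed

text \<open>The same with the transfer matrix across site 1, again of determinant
  \<open>a0 / a\<close>, where \<open>a\<close> is now the coefficient to the right of that
  site.\<close>

lemma boundary_det_shift_left:
  assumes J: "bounded_jacobi J" and g: "boundary_det J x c"
  shows "boundary_det (shift (- 1) J) x c"
using g
proof (rule boundary_detE)
  fix P Q P' Q' :: "nat \<Rightarrow> complex" and B \<delta> :: real
  assume \<delta>: "\<delta> > 0" "\<forall>\<^sub>F k in sequentially. \<delta> \<le> cmod (P k * Q' k - Q k * P' k)"
    and weyl_vec: "\<And>k. weyl_vec True J (zseq x k) (P k) (Q k)" "\<And>k. weyl_vec False J (zseq x k) (P' k) (Q' k)"
    and B: "\<And>k. cmod (P k) \<le> B \<and> cmod (Q k) \<le> B \<and> cmod (P' k) \<le> B \<and> cmod (Q' k) \<le> B"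
    and c: "(\<lambda>k. Im (P k * cnj (Q k)) * Im (P' k * cnj (Q' k)) / (cmod (P k * Q' k - Q k * P' k))\<^sup>2) \<longlonglongrightarrow> c"
  define a0 a b where "a0 = coeff_a J 0" and "a = coeff_a J 1" and "b = coeff_b J 1"
  have a: "a0 > 0" "a > 0" using coeff_a_pos[OF J] by (auto simp: a0_def a_def)
  define N where "N k P Q = ((zseq x k - of_real b) * P - of_real a0 * Q) / of_real a" for k P Q
  have im: "Im (N k P Q * cnj P) - a0 / a * Im (P * cnj Q) = 1 / real (Suc k) * ((cmod P)\<^sup>2 * (1 / a))" for k P Q
  proof -
    define y I where "y = 1 / real (Suc k)" and "I = Im (P * cnj Q)"
    have cq: "(cmod P)\<^sup>2 = Re P * Re P + Im P * Im P" unfolding cmod_power2 by (simp add: power2_eq_square)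
    have "Im (((Complex x y - of_real b) * P - of_real a0 * Q) * cnj P) = y * (cmod P)\<^sup>2 + a0 * I"
      by (simp add: cq I_def algebra_simps)
    moreover have "N k P Q * cnj P = of_real (1 / a) * (((Complex x y - of_real b) * P - of_real a0 * Q) * cnj P)"
      by (simp add: N_def y_def)
    moreover have "Im (of_real (1 / a) * w) = (1 / a) * Im w" for w by simp
    ultimately have "Im (N k P Q * cnj P) = (1 / a) * (y * (cmod P)\<^sup>2 + a0 * I)" by metis
    then have "Im (N k P Q * cnj P) - a0 / a * I = y * ((cmod P)\<^sup>2 * (1 / a))" using a by (simp only:) (simp add: field_simps)
    then show ?thesis by (simp only: y_def I_def)
  qed
  define K where "K = max B (((\<bar>x\<bar> + 1 + \<bar>b\<bar>) * B + \<bar>a0\<bar> * B) / a)"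
  show ?thesis
  proof (rule boundary_det_step[where r = "a0 / a" and K = K and P = P and Q = Q and P' = P' and Q' = Q' and S = P and S' = P'
        and R = "\<lambda>k. N k (P k) (Q k)" and R' = "\<lambda>k. N k (P' k) (Q' k)", OF _ \<delta> B])
    show "a0 / a > 0" using a by simp
    show "cmod (N k (P k) (Q k)) \<le> K \<and> cmod (P k) \<le> K \<and> cmod (N k (P' k) (Q' k)) \<le> K \<and> cmod (P' k) \<le> K" for k
      using B[of k] shift_term_bound[OF _ _ a(2), of "P k" B "Q k" x k b a0] shift_term_bound[OF _ _ a(2), of "P' k" B "Q' k" x k b a0]
      unfolding N_def K_def by (simp add: max.coboundedI1 max.coboundedI2)
    show "weyl_vec True (shift (- 1) J) (zseq x k) (N k (P k) (Q k)) (P k)" for k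
      unfolding N_def a0_def a_def b_def by (rule weyl_vec_shift_left[OF J weyl_vec(1)])
    show "weyl_vec False (shift (- 1) J) (zseq x k) (N k (P' k) (Q' k)) (P' k)" for k
      unfolding N_def a0_def a_def b_def by (rule weyl_vec_shift_left[OF J weyl_vec(2)])
    have "N k (P k) (Q k) * P' k - P k * N k (P' k) (Q' k) - of_real (a0 / a) * (P k * Q' k - Q k * P' k) = 0" for k
      using a by (simp add: N_def field_simps)
    then show "(\<lambda>k. N k (P k) (Q k) * P' k - P k * N k (P' k) (Q' k) - of_real (a0 / a) * (P k * Q' k - Q k * P' k)) \<longlonglongrightarrow> 0"
      by simp
    show "(\<lambda>k. Im (N k (P k) (Q k) * cnj (P k)) - a0 / a * Im (P k * cnj (Q k))) \<longlonglongrightarrow> 0"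
      unfolding im using B by (intro Im_shift_null) auto
    show "(\<lambda>k. Im (N k (P' k) (Q' k) * cnj (P' k)) - a0 / a * Im (P' k * cnj (Q' k))) \<longlonglongrightarrow> 0"
      unfolding im using B by (intro Im_shift_null) auto
  qed (rule c)
qed

lemma boundary_det_shift:
  assumes J: "bounded_jacobi J" and g: "boundary_det J x c"
  shows "boundary_det (shift k J) x c"
proof (induction k rule: int_induct[of _ 0])
  case base
  have "shift 0 J = J" by (cases J) (simp add: shift_def)
  then show ?case using g by simp
next
  case (step1 k)
  from boundary_det_shift_right[OF bounded_jacobi_shift[OF J] step1(2)] show ?case by (simp add: shift_shift add.commute)
next
  case (step2 k)
  from boundary_det_shift_left[OF bounded_jacobi_shift[OF J] step2(2)] show ?case by (simp add: shift_shift)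
qed


section \<open>Semicontinuity\<close>

lemma ell2_inner_unit_seq: "ell2_inner (unit_seq n) v = v n"
proof -
  have "ell2_inner (unit_seq n) v = (\<Sum>\<^sub>\<infinity>k\<in>{n}. v k)"
    unfolding ell2_inner_def by (rule infsum_cong_neutral) (auto simp: unit_seq_def)
  then show ?thesis by simp
qed

lemma wot_tendsto_coeffs:
  assumes "wot_tendsto Js J"
  shows "(\<lambda>k. coeff_a (Js k) n) \<longlonglongrightarrow> coeff_a J n" "(\<lambda>k. coeff_b (Js k) n) \<longlonglongrightarrow> coeff_b J n"
proof -
  have lim: "(\<lambda>k. Re (jacobi_op (Js k) (unit_seq m) n)) \<longlonglongrightarrow> Re (jacobi_op J (unit_seq m) n)" for m
  proof -
    have "(\<lambda>k. ell2_inner (unit_seq n) (jacobi_op (Js k) (unit_seq m))) \<longlonglongrightarrow> ell2_inner (unit_seq n) (jacobi_op J (unit_seq m))"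
      using assms unit_seq_ell2 by (simp add: wot_tendsto_def)
    then show ?thesis unfolding ell2_inner_unit_seq by (rule tendsto_Re)
  qed
  show "(\<lambda>k. coeff_a (Js k) n) \<longlonglongrightarrow> coeff_a J n" "(\<lambda>k. coeff_b (Js k) n) \<longlonglongrightarrow> coeff_b J n"
    using lim[of "n + 1"] lim[of n] by (simp_all add: jacobi_op_def unit_seq_def)
qed

text \<open>If \<open>R\<close> denotes the reflection coefficient, the pseudohyperbolic distance of \<open>m_plus\<close> and
  \<open>- cnj m_minus\<close>, then \<open>det_Im_m\<close> is \<open>(1 - |R|^2) / 4\<close>.\<close>

definition det_Im_m :: "jacobi \<Rightarrow> complex \<Rightarrow> real" where
  "det_Im_m J z = Im (m_plus J z) * Im (m_minus J z) / (cmod (m_plus J z + m_minus J z))\<^sup>2"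

lemma det_Im_m_nonneg: "bounded_jacobi J \<Longrightarrow> Im z > 0 \<Longrightarrow> det_Im_m J z \<ge> 0"
  unfolding det_Im_m_def using Im_m_plus_pos[of J z] Im_m_minus_pos[of J z] by (simp add: less_imp_le)

text \<open>The expression is homogeneous of degree 0 in each of the two vectors, so it depends only
  on the quotients \<open>P / Q\<close> and \<open>P' / Q'\<close>. The minus sign is the one in the
  definition of \<open>m_plus\<close>.\<close>

lemma weyl_vec_det_Im_m:
  assumes J: "bounded_jacobi J" and z: "Im z > 0" and r: "weyl_vec True J z P Q" "weyl_vec False J z P' Q'"
  shows "Im (P * cnj Q) * Im (P' * cnj Q') / (cmod (P * Q' - Q * P'))\<^sup>2 = - det_Im_m J z"
proof -
  define a where "a = coeff_a J 0"
  have a: "a > 0" unfolding a_def by (rule coeff_a_pos[OF J])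
  have nz: "Q \<noteq> 0" "Q' \<noteq> 0" using weyl_vec_nonzero[OF J z r(1)] weyl_vec_nonzero[OF J z r(2)] by auto
  have im: "Im (P / Q) = Im (P * cnj Q) / (cmod Q)\<^sup>2" for P Q :: complex
    by (simp add: Im_divide cmod_power2 algebra_simps)
  have p: "m_plus J z = of_real (- a) * (P / Q)" using weyl_vec_m_plus[OF J z r(1)] by (simp add: a_def)
  have m: "m_minus J z = of_real a * (P' / Q')" using weyl_vec_m_minus[OF J z r(2)] by (simp add: a_def)
  have R: "Im (of_real t * w) = t * Im w" for t w by simp
  have "m_plus J z + m_minus J z = of_real (- a) * ((P * Q' - Q * P') / (Q * Q'))"
    unfolding p m using nz by (simp add: field_simps)
  then have s: "cmod (m_plus J z + m_minus J z) = a * (cmod (P * Q' - Q * P') / (cmod Q * cmod Q'))"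
    using a by (simp only: norm_mult norm_divide norm_of_real)
  define u v where "u = Im (P * cnj Q)" and "v = Im (P' * cnj Q')"
  define D where "D = cmod (P * Q' - Q * P')"
  define q q' where "q = cmod Q" and "q' = cmod Q'"
  have q: "q > 0" "q' > 0" using nz by (auto simp: q_def q'_def)
  have "det_Im_m J z = ((- a) * (u / q\<^sup>2)) * (a * (v / q'\<^sup>2)) / (a * (D / (q * q')))\<^sup>2"
    unfolding det_Im_m_def s unfolding p m R im u_def v_def D_def q_def q'_def by simp
  also have "\<dots> = - (u * v / D\<^sup>2)"
    using a q by (simp add: power2_eq_square)
  finally show ?thesis by (simp add: u_def v_def D_def)
qed

lemma boundary_det_det_Im_m_tendsto:
  assumes J: "bounded_jacobi J" and g: "boundary_det J x c"
  shows "(\<lambda>k. det_Im_m J (zseq x k)) \<longlonglongrightarrow> - c"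
using g
proof (rule boundary_detE)
  fix P Q P' Q' :: "nat \<Rightarrow> complex" and B \<delta> :: real
  assume "\<delta> > 0" "\<forall>\<^sub>F k in sequentially. \<delta> \<le> cmod (P k * Q' k - Q k * P' k)"
    and weyl_vec: "\<And>k. weyl_vec True J (zseq x k) (P k) (Q k)" "\<And>k. weyl_vec False J (zseq x k) (P' k) (Q' k)"
    and "\<And>k. cmod (P k) \<le> B \<and> cmod (Q k) \<le> B \<and> cmod (P' k) \<le> B \<and> cmod (Q' k) \<le> B"
    and c: "(\<lambda>k. Im (P k * cnj (Q k)) * Im (P' k * cnj (Q' k)) / (cmod (P k * Q' k - Q k * P' k))\<^sup>2) \<longlonglongrightarrow> c"
  have "(\<lambda>k. - det_Im_m J (zseq x k)) \<longlonglongrightarrow> c"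
    using c by (simp only: weyl_vec_det_Im_m[OF J zseq_Im weyl_vec])
  from tendsto_minus[OF this] show ?thesis by simp
qed

text \<open>With the normalisation \<open>f 0 = 1\<close> the vectors are bounded because both
  \<open>m\<close> functions have finite limits. The determinant stays away from 0 because the
  limits have imaginary parts of the same sign.\<close>

lemma Sigma_ac_boundary_det:
  assumes J: "bounded_jacobi J" and x: "x \<in> Sigma_ac J"
  obtains c where "c < 0" "boundary_det J x c"
proof -
  obtain wp wm where lim: "((\<lambda>y. m_plus J (Complex x y)) \<longlongrightarrow> wp) (at_right 0)" "((\<lambda>y. m_minus J (Complex x y)) \<longlongrightarrow> wm) (at_right 0)"
    and pos: "Im wp > 0" "Im wm > 0"
    using x unfolding Sigma_ac_def has_boundary_value_def by blast
  define a where "a = coeff_a J 0"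
  have a: "a > 0" unfolding a_def by (rule coeff_a_pos[OF J])
  define P where "P k = - m_plus J (zseq x k) / of_real a" for k
  define P' where "P' k = m_minus J (zseq x k) / of_real a" for k
  have P: "P \<longlonglongrightarrow> - wp / of_real a" unfolding P_def
    using a by (intro tendsto_intros boundary_value_sequence lim) auto
  have P': "P' \<longlonglongrightarrow> wm / of_real a" unfolding P'_def
    using a by (intro tendsto_intros boundary_value_sequence lim) auto
  obtain B1 where B1: "\<And>k. cmod (P k) \<le> B1" using convergent_imp_bounded[OF P] unfolding bounded_iff by auto
  obtain B2 where B2: "\<And>k. cmod (P' k) \<le> B2" using convergent_imp_bounded[OF P'] unfolding bounded_iff by auto
  \<comment> \<open>The 1 covers the normalised entries \<open>Q\<close> and
    \<open>Q'\<close>.\<close>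
  define B where "B = max 1 (max B1 B2)"
  define w where "w = - wp / of_real a - wm / of_real a"
  have w0: "w \<noteq> 0"
  proof
    assume "w = 0"
    then have "Im w = 0" by simp
    then have "Im wp + Im wm = 0" using a by (simp add: w_def Im_divide_of_real field_simps)
    then show False using pos by simp
  qed
  have w: "(\<lambda>k. P k * 1 - 1 * P' k) \<longlonglongrightarrow> w" unfolding w_def using tendsto_diff[OF P P'] by simp
  have rp: "weyl_vec True J (zseq x k) (P k) 1" for k
  proof -
    note f = f_plus_l2[OF J zseq_Im[of x k]]
    have nz: "f_plus J (zseq x k) 0 \<noteq> 0" by (rule l2_plus_nonzero[OF J zseq_Im f])
    then have "1 / f_plus J (zseq x k) 0 \<noteq> 0" by simp
    from l2_plus_scale[OF f this]
    have "weyl_vec True J (zseq x k) (1 / f_plus J (zseq x k) 0 * f_plus J (zseq x k) 1) (1 / f_plus J (zseq x k) 0 * f_plus J (zseq x k) 0)"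
      unfolding weyl_vec_def by auto
    moreover have "1 / f_plus J (zseq x k) 0 * f_plus J (zseq x k) 1 = P k"
      using a by (simp add: P_def m_plus_def a_def)
    ultimately show ?thesis using nz by simp
  qed
  have rm: "weyl_vec False J (zseq x k) (P' k) 1" for k
  proof -
    note f = f_minus_l2_minus[OF J zseq_Im[of x k]]
    have nz: "f_minus J (zseq x k) 0 \<noteq> 0" by (rule l2_minus_nonzero[OF J zseq_Im f])
    then have "1 / f_minus J (zseq x k) 0 \<noteq> 0" by simp
    from l2_minus_scale[OF f this]
    have "weyl_vec False J (zseq x k) (1 / f_minus J (zseq x k) 0 * f_minus J (zseq x k) 1) (1 / f_minus J (zseq x k) 0 * f_minus J (zseq x k) 0)"
      unfolding weyl_vec_def by auto
    moreover have "1 / f_minus J (zseq x k) 0 * f_minus J (zseq x k) 1 = P' k"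
      using a by (simp add: P'_def m_minus_def a_def)
    ultimately show ?thesis using nz by simp
  qed
  define c where "c = Im (- wp / of_real a) * Im (wm / of_real a) / (cmod w)\<^sup>2"
  have "boundary_det J x c"
  proof (rule boundary_detI[where P = P and Q = "\<lambda>_. 1" and P' = P' and Q' = "\<lambda>_. 1" and B = B and \<delta> = "cmod w / 2"])
    show "cmod w / 2 > 0" using w0 by simp
    show "cmod (P k) \<le> B \<and> cmod 1 \<le> B \<and> cmod (P' k) \<le> B \<and> cmod 1 \<le> B" for k
      using B1[of k] B2[of k] by (auto simp: B_def)
    have "\<forall>\<^sub>F k in sequentially. cmod w / 2 < cmod (P k * 1 - 1 * P' k)"
      using w0 by (intro order_tendstoD(1)[OF tendsto_norm[OF w]]) simp
    then show "\<forall>\<^sub>F k in sequentially. cmod w / 2 \<le> cmod (P k * 1 - 1 * P' k)"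
      by eventually_elim simp
    have "(\<lambda>k. Im (P k) * Im (P' k) / (cmod (P k * 1 - 1 * P' k))\<^sup>2) \<longlonglongrightarrow> c"
      unfolding c_def using w0 by (intro tendsto_intros P P' w) auto
    then show "(\<lambda>k. Im (P k * cnj 1) * Im (P' k * cnj 1) / (cmod (P k * 1 - 1 * P' k))\<^sup>2) \<longlonglongrightarrow> c" by simp
  qed (use rp rm in auto)
  moreover have "c < 0"
  proof -
    have "Im (- wp / of_real a) < 0" "Im (wm / of_real a) > 0" using a pos by (auto simp: Im_divide_of_real)
    then show ?thesis unfolding c_def using w0 by (intro divide_neg_pos mult_neg_pos) auto
  qed
  ultimately show thesis using that by blast
qed

text \<open>With \<open>p = m_plus\<close> and \<open>s = m_minus\<close> this is the combination of
  \<open>p s / (p + s)\<close>, \<open>(p - s) / (p + s)\<close> and \<open>- 1 / (p + s)\<close>,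
  the entries of the matrix \<open>m\<close> function, with coefficients 1, \<open>\<xi>\<close> and
  \<open>\<xi>^2 + \<eta>^2\<close>. Divided by \<open>\<eta>\<close>, these coefficients describe
  the positive matrix with diagonal \<open>\<xi>^2 + \<eta>^2\<close> and 1 and off-diagonal
  \<open>\<xi>\<close>, which then has determinant one.\<close>

definition trace_m :: "jacobi \<Rightarrow> real \<Rightarrow> real \<Rightarrow> complex \<Rightarrow> complex" where
  "trace_m J \<xi> \<eta> z = ((m_plus J z - of_real \<xi>) * (m_minus J z + of_real \<xi>) - of_real (\<eta>\<^sup>2)) / (m_plus J z + m_minus J z)"

lemma Im_product_over_sum:
  fixes p s :: complex
  assumes "p + s \<noteq> 0"
  shows "Im ((p * s - of_real (\<eta>\<^sup>2)) / (p + s)) =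
    ((cmod p)\<^sup>2 * Im s + (cmod s)\<^sup>2 * Im p + \<eta>\<^sup>2 * (Im p + Im s)) / (cmod (p + s))\<^sup>2"
proof -
  have "Im ((p * s - of_real (\<eta>\<^sup>2)) / (p + s)) = Im ((p * s - of_real (\<eta>\<^sup>2)) * cnj (p + s)) / (cmod (p + s))\<^sup>2"
    by (simp add: Im_divide cmod_power2 algebra_simps)
  also have "Im ((p * s - of_real (\<eta>\<^sup>2)) * cnj (p + s)) = (cmod p)\<^sup>2 * Im s + (cmod s)\<^sup>2 * Im p + \<eta>\<^sup>2 * (Im p + Im s)"
    unfolding cmod_power2 by (simp add: power2_eq_square algebra_simps)
  finally show ?thesis .
qed

text \<open>Up to scaling, \<open>Im trace_m / \<eta>\<close> is the trace of the product of the imaginary part of the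
  matrix \<open>m\<close> function with a positive matrix of determinant one. Its infimum over all such matrices
  is twice the square root of the determinant.\<close>

lemma trace_ge_sqrt_det:
  fixes p s :: complex
  assumes b: "Im p > 0" and d: "Im s > 0" and eta: "\<eta> > 0"
  shows "\<eta> * (2 * sqrt (Im p * Im s / (cmod (p + s))\<^sup>2)) \<le> Im ((p * s - of_real (\<eta>\<^sup>2)) / (p + s))"
proof -
  define b' d' where "b' = sqrt (Im p)" and "d' = sqrt (Im s)"
  have bd: "b' > 0" "d' > 0" "Im p = b'\<^sup>2" "Im s = d'\<^sup>2" using b d by (auto simp: b'_def d'_def)
  define P S where "P = cmod p" and "S = cmod s"
  have ps: "p + s \<noteq> 0" using b d by (auto simp: complex_eq_iff)
  then have c: "cmod (p + s) > 0" by simp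
  have tri: "cmod (p + s) \<le> P + S" unfolding P_def S_def by (rule norm_triangle_ineq)
  \<comment> \<open>Expanding the squares is the arithmetic-geometric mean inequality. Equality
    needs both squares to vanish, and the triangle inequality above to be sharp.\<close>
  have "0 \<le> (P * d' - \<eta> * b')\<^sup>2 + (S * b' - \<eta> * d')\<^sup>2" by simp
  then have "2 * \<eta> * (b' * d') * (P + S) \<le> P\<^sup>2 * d'\<^sup>2 + S\<^sup>2 * b'\<^sup>2 + \<eta>\<^sup>2 * (b'\<^sup>2 + d'\<^sup>2)"
    by (simp add: power2_eq_square algebra_simps)
  moreover have "2 * \<eta> * (b' * d') * cmod (p + s) \<le> 2 * \<eta> * (b' * d') * (P + S)"
    using tri eta bd by (intro mult_left_mono) auto
  ultimately have "2 * \<eta> * (b' * d') * cmod (p + s) \<le> P\<^sup>2 * d'\<^sup>2 + S\<^sup>2 * b'\<^sup>2 + \<eta>\<^sup>2 * (b'\<^sup>2 + d'\<^sup>2)" by linarith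
  then have "2 * \<eta> * (b' * d') * cmod (p + s) / (cmod (p + s))\<^sup>2 \<le> (P\<^sup>2 * d'\<^sup>2 + S\<^sup>2 * b'\<^sup>2 + \<eta>\<^sup>2 * (b'\<^sup>2 + d'\<^sup>2)) / (cmod (p + s))\<^sup>2"
    by (rule divide_right_mono) simp
  moreover have "sqrt (Im p * Im s / (cmod (p + s))\<^sup>2) = b' * d' / cmod (p + s)"
    by (simp add: b'_def d'_def real_sqrt_divide real_sqrt_mult)
  moreover have "2 * \<eta> * (b' * d') * cmod (p + s) / (cmod (p + s))\<^sup>2 = \<eta> * (2 * (b' * d' / cmod (p + s)))"
    using c by (simp add: power2_eq_square)
  ultimately show ?thesis unfolding Im_product_over_sum[OF ps] bd(3,4) P_def S_def by simp
qed

text \<open>The translation \<open>\<xi>\<close> makes \<open>p - \<xi>\<close> and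
  \<open>s + \<xi>\<close> positive multiples of one number \<open>\<kappa>\<close> with imaginary
  part 1, so the triangle inequality in \<open>trace_ge_sqrt_det\<close> is sharp. The value of
  \<open>\<eta>\<close> then makes both squares there vanish.\<close>

lemma trace_eq_sqrt_det:
  fixes p s :: complex
  assumes b: "Im p > 0" and d: "Im s > 0"
  obtains \<xi> \<eta> where "\<eta> > 0"
    "\<eta> * (2 * sqrt (Im p * Im s / (cmod (p + s))\<^sup>2)) = Im (((p - of_real \<xi>) * (s + of_real \<xi>) - of_real (\<eta>\<^sup>2)) / (p + s))"
proof -
  define \<xi> where "\<xi> = (Re p * Im s - Re s * Im p) / (Im p + Im s)"
  define \<kappa> where "\<kappa> = Complex ((Re p + Re s) / (Im p + Im s)) 1"
  have sum: "Im p + Im s > 0" using b d by simp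
  have p: "p - of_real \<xi> = of_real (Im p) * \<kappa>" and s: "s + of_real \<xi> = of_real (Im s) * \<kappa>"
    using sum by (auto simp: complex_eq_iff \<xi>_def \<kappa>_def field_simps)
  have "1 \<le> cmod \<kappa>" using abs_Im_le_cmod[of \<kappa>] by (simp add: \<kappa>_def)
  then have k: "cmod \<kappa> > 0" by linarith
  define \<eta> where "\<eta> = cmod \<kappa> * sqrt (Im p * Im s)"
  have eta: "\<eta> > 0" unfolding \<eta>_def using b d k by simp
  have ps: "(p - of_real \<xi>) + (s + of_real \<xi>) = p + s" by simp
  have ps': "p + s = of_real (Im p + Im s) * \<kappa>" using ps unfolding p s by (simp add: distrib_right)
  have nz: "p + s \<noteq> 0"
  proof
    assume "p + s = 0"
    then have "Im (p + s) = 0" by simp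
    with sum show False by simp
  qed
  have c: "cmod (p + s) = (Im p + Im s) * cmod \<kappa>" unfolding ps' norm_mult norm_of_real using sum by simp
  define r where "r = sqrt (Im p * Im s)"
  have r2: "r\<^sup>2 = Im p * Im s" unfolding r_def using b d by simp
  have "Im (((p - of_real \<xi>) * (s + of_real \<xi>) - of_real (\<eta>\<^sup>2)) / (p + s)) =
     ((cmod (p - of_real \<xi>))\<^sup>2 * Im s + (cmod (s + of_real \<xi>))\<^sup>2 * Im p + \<eta>\<^sup>2 * (Im p + Im s)) / (cmod (p + s))\<^sup>2"
    using Im_product_over_sum[of "p - of_real \<xi>" "s + of_real \<xi>" \<eta>] nz unfolding ps by simp
  also have "\<dots> = ((Im p * cmod \<kappa>)\<^sup>2 * Im s + (Im s * cmod \<kappa>)\<^sup>2 * Im p + (cmod \<kappa> * r)\<^sup>2 * (Im p + Im s)) / ((Im p + Im s) * cmod \<kappa>)\<^sup>2"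
    unfolding p s c norm_mult norm_of_real \<eta>_def r_def using b d by simp
  also have "(Im p * cmod \<kappa>)\<^sup>2 * Im s + (Im s * cmod \<kappa>)\<^sup>2 * Im p + (cmod \<kappa> * r)\<^sup>2 * (Im p + Im s)
     = 2 * (cmod \<kappa>)\<^sup>2 * r\<^sup>2 * (Im p + Im s)"
    unfolding power_mult_distrib r2 by (simp add: power2_eq_square algebra_simps)
  also have "2 * (cmod \<kappa>)\<^sup>2 * r\<^sup>2 * (Im p + Im s) / ((Im p + Im s) * cmod \<kappa>)\<^sup>2 = (cmod \<kappa> * r) * (2 * (r / ((Im p + Im s) * cmod \<kappa>)))"
    using sum k by (simp add: power2_eq_square)
  also have "\<dots> = \<eta> * (2 * sqrt (Im p * Im s / (cmod (p + s))\<^sup>2))"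
    unfolding \<eta>_def c r_def using sum k by (simp add: real_sqrt_divide)
  finally show thesis using eta that by metis
qed

text \<open>The translation by \<open>\<xi>\<close> changes neither the imaginary parts nor the sum
  of the two \<open>m\<close> functions, so it reduces to the case \<open>\<xi> = 0\<close>.\<close>

lemma trace_m_lower:
  assumes J: "bounded_jacobi J" and z: "Im z > 0" and "\<eta> > 0"
  shows "\<eta> * (2 * sqrt (det_Im_m J z)) \<le> Im (trace_m J \<xi> \<eta> z)"
  using trace_ge_sqrt_det[of "m_plus J z - of_real \<xi>" "m_minus J z + of_real \<xi>" \<eta>] assms(3)
    Im_m_plus_pos[OF J z] Im_m_minus_pos[OF J z]
  by (simp add: trace_m_def det_Im_m_def)

lemma trace_m_attained:
  assumes J: "bounded_jacobi J" and z: "Im z > 0"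
  obtains \<xi> \<eta> where "\<eta> > 0" "\<eta> * (2 * sqrt (det_Im_m J z)) = Im (trace_m J \<xi> \<eta> z)"
  using trace_eq_sqrt_det[OF Im_m_plus_pos[OF J z] Im_m_minus_pos[OF J z]] unfolding trace_m_def det_Im_m_def by metis

lemma trace_m_holomorphic:
  assumes J: "bounded_jacobi J" shows "trace_m J \<xi> \<eta> holomorphic_on {w. Im w > 0}"
  unfolding trace_m_def[abs_def] using m_sum_nonzero[OF J]
  by (intro holomorphic_intros m_plus_holomorphic m_minus_holomorphic J) auto

lemma norm_inverse_m_sum:
  assumes J: "bounded_jacobi J" and z: "Im z \<ge> e" "e > 0"
  shows "cmod (1 / (m_plus J z + m_minus J z)) \<le> 1 / e"
proof -
  have z0: "Im z > 0" using z by simp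
  have "e \<le> Im (m_plus J z + m_minus J z)"
    using Im_m_plus_pos[OF J z0] Im_m_minus_ge[OF J z0] z by simp
  also have "\<dots> \<le> cmod (m_plus J z + m_minus J z)" using abs_Im_le_cmod[of "m_plus J z + m_minus J z"] by linarith
  finally show ?thesis using z by (simp add: norm_divide frac_le)
qed

lemma m_plus_bounded:
  assumes J: "bounded_jacobi J" and z: "Im z \<ge> e" "e > 0"
  shows "cmod (m_plus J z) \<le> (coeff_a J 0)\<^sup>2 / e"
proof -
  have "cmod (m_plus J z) \<le> (coeff_a J 0)\<^sup>2 / Im z" using z by (intro m_plus_bound[OF J]) simp
  also have "\<dots> \<le> (coeff_a J 0)\<^sup>2 / e" using z by (intro divide_left_mono mult_pos_pos) auto
  finally show ?thesis .
qed

lemma trace_m_bounded: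
  assumes J: "bounded_jacobi J" and e: "e > 0"
  shows "\<exists>B. \<forall>w. Im w \<ge> e \<longrightarrow> norm (trace_m J \<xi> \<eta> w) \<le> B"
proof (intro exI allI impI)
  fix w assume w: "Im w \<ge> e"
  then have w0: "Im w > 0" using e by simp
  define A where "A = (coeff_a J 0)\<^sup>2 / e + \<bar>\<xi>\<bar>"
  define p where "p = m_plus J w - of_real \<xi>"
  have p: "cmod p \<le> A" unfolding p_def A_def
    using norm_triangle_ineq4[of "m_plus J w" "of_real \<xi>"] m_plus_bounded[OF J w e] by simp
  \<comment> \<open>\<open>m_minus\<close> is unbounded on this half plane, so it is eliminated in
    favour of \<open>m_plus\<close> and the reciprocal of the sum, both of which are
    bounded.\<close>
  have "(p * ((m_plus J w + m_minus J w) - p) - of_real (\<eta>\<^sup>2)) / (m_plus J w + m_minus J w) =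
     p - (p * p + of_real (\<eta>\<^sup>2)) * (1 / (m_plus J w + m_minus J w))"
    using m_sum_nonzero[OF J w0] by (simp add: field_simps)
  then have "trace_m J \<xi> \<eta> w = p - (p * p + of_real (\<eta>\<^sup>2)) * (1 / (m_plus J w + m_minus J w))"
    by (simp add: trace_m_def p_def algebra_simps)
  also have "norm \<dots> \<le> cmod p + cmod (p * p + of_real (\<eta>\<^sup>2)) * cmod (1 / (m_plus J w + m_minus J w))"
    using norm_triangle_ineq4 by (simp only: norm_mult[symmetric])
  also have "\<dots> \<le> A + (A * A + \<eta>\<^sup>2) * (1 / e)"
  proof (intro add_mono p mult_mono norm_inverse_m_sum[OF J w e])
    show "cmod (p * p + of_real (\<eta>\<^sup>2)) \<le> A * A + \<eta>\<^sup>2"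
    proof (rule norm_triangle_le, rule add_mono)
      show "cmod (p * p) \<le> A * A" unfolding norm_mult using p order_trans[OF norm_ge_zero p] by (intro mult_mono) auto
    qed (unfold norm_of_real, simp)
    show "0 \<le> A * A + \<eta>\<^sup>2" by simp
  qed auto
  finally show "norm (trace_m J \<xi> \<eta> w) \<le> ((coeff_a J 0)\<^sup>2 / e + \<bar>\<xi>\<bar>) + (((coeff_a J 0)\<^sup>2 / e + \<bar>\<xi>\<bar>) * ((coeff_a J 0)\<^sup>2 / e + \<bar>\<xi>\<bar>) + \<eta>\<^sup>2) * (1 / e)"
    unfolding A_def .
qed

text \<open>\<open>\<xi>\<close> and \<open>\<eta>\<close> are fitted to the limit \<open>J\<close>
  at the single point \<open>z\<close>, where they give equality, and the same pair is used for
  every \<open>Js n\<close>, where an inequality suffices. With the pair fixed,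
  \<open>trace_m\<close> converges at \<open>z\<close>.\<close>

lemma semicontinuity_Poisson:
  fixes Js :: "nat \<Rightarrow> jacobi"
  assumes Js: "\<And>n. bounded_jacobi (Js n)" and J: "bounded_jacobi J" and wot: "wot_tendsto Js J"
    and E: "E \<in> sets borel" and kap: "\<kappa> > 0" and y: "y > 0"
    and lower: "\<And>x n. x \<in> E \<Longrightarrow> \<forall>\<^sub>F k in sequentially. \<kappa> \<le> 2 * sqrt (det_Im_m (Js n) (zseq x k))"
  shows "ennreal \<kappa> * pmass E x y \<le> ennreal (2 * sqrt (det_Im_m J (Complex x y)))"
proof -
  define z where "z = Complex x y"
  have z: "Im z > 0" using y by (simp add: z_def)
  obtain \<xi> \<eta> where eta: "\<eta> > 0" "\<eta> * (2 * sqrt (det_Im_m J z)) = Im (trace_m J \<xi> \<eta> z)" using trace_m_attained[OF J z] by blast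
  have n: "ennreal (\<kappa> * \<eta>) * pmass E x y \<le> ennreal (Im (trace_m (Js n) \<xi> \<eta> z))" for n
    unfolding z_def
  proof (rule poisson_lower_bound[OF trace_m_holomorphic[OF Js] _ trace_m_bounded[OF Js] E y])
    fix w :: complex assume "Im w > 0"
    have "0 \<le> \<eta> * (2 * sqrt (det_Im_m (Js n) w))" using eta det_Im_m_nonneg[OF Js \<open>Im w > 0\<close>] by simp
    also have "\<dots> \<le> Im (trace_m (Js n) \<xi> \<eta> w)" by (rule trace_m_lower[OF Js \<open>Im w > 0\<close> eta(1)])
    finally show "0 \<le> Im (trace_m (Js n) \<xi> \<eta> w)" .
  next
    fix x assume "x \<in> E"
    from lower[OF this, of n] show "\<forall>\<^sub>F k in sequentially. \<kappa> * \<eta> \<le> Im (trace_m (Js n) \<xi> \<eta> (zseq x k))"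
    proof eventually_elim
      case (elim k)
      have "\<kappa> * \<eta> \<le> \<eta> * (2 * sqrt (det_Im_m (Js n) (zseq x k)))" using elim eta by (simp add: mult.commute)
      also have "\<dots> \<le> Im (trace_m (Js n) \<xi> \<eta> (zseq x k))" by (rule trace_m_lower[OF Js zseq_Im eta(1)])
      finally show ?case .
    qed
  qed
  have "(\<lambda>n. trace_m (Js n) \<xi> \<eta> z) \<longlonglongrightarrow> trace_m J \<xi> \<eta> z"
    unfolding trace_m_def using m_sum_nonzero[OF J z]
    by (intro tendsto_intros m_plus_tendsto m_minus_tendsto Js J z wot_tendsto_coeffs[OF wot])
  then have "(\<lambda>n. ennreal (Im (trace_m (Js n) \<xi> \<eta> z))) \<longlonglongrightarrow> ennreal (Im (trace_m J \<xi> \<eta> z))"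
    by (intro tendsto_ennrealI tendsto_Im)
  then have "ennreal (\<kappa> * \<eta>) * pmass E x y \<le> ennreal (Im (trace_m J \<xi> \<eta> z))"
    by (rule LIMSEQ_le_const) (use n in blast)
  then have le: "ennreal (\<kappa> * \<eta>) * pmass E x y \<le> ennreal (\<eta> * (2 * sqrt (det_Im_m J z)))" by (simp only: eta(2))
  obtain q where q: "pmass E x y = ennreal q" "q \<ge> 0"
    using pmass_le_1[OF E y, of x] by (cases "pmass E x y") (auto simp: top_unique)
  have r: "sqrt (det_Im_m J z) \<ge> 0" using det_Im_m_nonneg[OF J z] by simp
  have "ennreal (\<kappa> * \<eta> * q) \<le> ennreal (\<eta> * (2 * sqrt (det_Im_m J z)))"
    using le unfolding q(1) by (subst (asm) ennreal_mult[symmetric]) (use q kap eta in auto)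
  then have "\<kappa> * \<eta> * q \<le> \<eta> * (2 * sqrt (det_Im_m J z))"
    by (subst (asm) ennreal_le_iff) (use eta(1) r in auto)
  then have "\<eta> * (\<kappa> * q) \<le> \<eta> * (2 * sqrt (det_Im_m J z))" by (simp add: mult_ac)
  then have "\<kappa> * q \<le> 2 * sqrt (det_Im_m J z)" using eta(1) by simp
  then show ?thesis using q kap by (simp add: z_def ennreal_mult[symmetric] ennreal_leI)
qed

lemma det_Im_m_horizontal_measurable:
  assumes J: "bounded_jacobi J"
  shows "(\<lambda>x. det_Im_m J (zseq x k)) \<in> borel_measurable borel"
  unfolding det_Im_m_def
  using borel_measurable_horizontal[OF m_plus_holomorphic[OF J], of k] borel_measurable_horizontal[OF m_minus_holomorphic[OF J], of k]
  by measurable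

text \<open>The case of infinite \<open>m_minus\<close> at the boundary. In terms of
  \<open>F = 1 / (m_minus + i)\<close> the determinant is at most of the order of \<open>F\<close>
  when \<open>m_plus\<close> stays finite.\<close>

lemma det_Im_m_tendsto_0:
  assumes J: "bounded_jacobi J" and p: "(\<lambda>k. m_plus J (zseq x k)) \<longlonglongrightarrow> wp"
    and F: "(\<lambda>k. 1 / (m_minus J (zseq x k) + \<i>)) \<longlonglongrightarrow> 0"
  shows "(\<lambda>k. det_Im_m J (zseq x k)) \<longlonglongrightarrow> 0"
proof -
  define F where "F k = 1 / (m_minus J (zseq x k) + \<i>)" for k
  define p where "p k = m_plus J (zseq x k)" for k
  have Fnz: "F k \<noteq> 0" for k
  proof -
    have "Im (m_minus J (zseq x k) + \<i>) > 0" using Im_m_minus_pos[OF J zseq_Im, of x k] by simp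
    then have "m_minus J (zseq x k) + \<i> \<noteq> 0" by (metis less_irrefl zero_complex.sel(2))
    then show ?thesis by (simp add: F_def)
  qed
  have m: "m_minus J (zseq x k) = (1 - \<i> * F k) / F k" for k
    using Fnz[of k] by (simp add: F_def field_simps)
  have s: "m_plus J (zseq x k) + m_minus J (zseq x k) = (1 + F k * (p k - \<i>)) / F k" for k
    unfolding m p_def using Fnz[of k] by (simp add: field_simps)
  have "(\<lambda>k. cmod (p k) * cmod (F k) * cmod (1 - \<i> * F k) / (cmod (1 + F k * (p k - \<i>)))\<^sup>2)
     \<longlonglongrightarrow> cmod wp * cmod 0 * cmod (1 - \<i> * 0) / (cmod (1 + 0 * (wp - \<i>)))\<^sup>2"
    by (intro tendsto_intros assms[folded F_def p_def]) auto
  then have "(\<lambda>k. cmod (p k) * cmod (F k) * cmod (1 - \<i> * F k) / (cmod (1 + F k * (p k - \<i>)))\<^sup>2) \<longlonglongrightarrow> 0" by simp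
  then show ?thesis
  proof (rule Lim_null_comparison[rotated], intro always_eventually allI)
    fix k
    have "\<bar>det_Im_m J (zseq x k)\<bar> = \<bar>Im (p k)\<bar> * \<bar>Im (m_minus J (zseq x k))\<bar> / (cmod (m_plus J (zseq x k) + m_minus J (zseq x k)))\<^sup>2"
      by (simp add: det_Im_m_def p_def abs_mult)
    also have "\<dots> \<le> cmod (p k) * cmod (m_minus J (zseq x k)) / (cmod (m_plus J (zseq x k) + m_minus J (zseq x k)))\<^sup>2"
      by (intro divide_right_mono mult_mono abs_Im_le_cmod) auto
    also have "\<dots> = cmod (p k) * (cmod (1 - \<i> * F k) / cmod (F k)) / (cmod (1 + F k * (p k - \<i>)) / cmod (F k))\<^sup>2"
      unfolding s unfolding m norm_divide ..
    also have "\<dots> = cmod (p k) * cmod (F k) * cmod (1 - \<i> * F k) / (cmod (1 + F k * (p k - \<i>)))\<^sup>2"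
      using Fnz[of k] by (simp add: power2_eq_square)
    finally show "norm (det_Im_m J (zseq x k)) \<le> cmod (p k) * cmod (F k) * cmod (1 - \<i> * F k) / (cmod (1 + F k * (p k - \<i>)))\<^sup>2"
      by simp
  qed
qed

text \<open>The points with a common \<open>c\<close> are captured by the sets \<open>A j\<close>,
  which are defined through the determinants themselves and are therefore Borel. Where the
  determinant of \<open>J\<close> tends to 0, the bound of \<open>semicontinuity_Poisson\<close>
  forces the harmonic measure of \<open>B j M\<close> to tend to 0, so \<open>B j M\<close> is null;
  the cut at \<open>M\<close> makes its measure finite.\<close>

lemma Sigma_ac_semicontinuous:
  fixes Js :: "nat \<Rightarrow> jacobi"
  assumes Js: "\<And>n. bounded_jacobi (Js n)" and J: "bounded_jacobi J" and wot: "wot_tendsto Js J"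
  shows "AE x in lborel. (\<exists>c<0. \<forall>n. boundary_det (Js n) x c) \<longrightarrow> x \<in> Sigma_ac J"
proof -
  define A where "A j = {x. \<forall>n. \<exists>N. \<forall>k\<ge>N. 1 / real (Suc j) \<le> 2 * sqrt (det_Im_m (Js n) (zseq x k))}" for j
  have [measurable]: "A j \<in> sets borel" for j
  proof -
    note [measurable] = det_Im_m_horizontal_measurable[OF Js]
    have "A j = {x \<in> space borel. \<forall>n. \<exists>N. \<forall>k\<ge>N. 1 / real (Suc j) \<le> 2 * sqrt (det_Im_m (Js n) (zseq x k))}" by (simp add: A_def)
    also have "\<dots> \<in> sets borel" by measurable
    finally show ?thesis .
  qed
  define Z where "Z = {x. (\<lambda>k. det_Im_m J (zseq x k)) \<longlonglongrightarrow> 0}"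
  have [measurable]: "Z \<in> sets borel" unfolding Z_def
    using det_Im_m_horizontal_measurable[OF J] by (intro sets_Collect_tendsto) auto
  define B where "B j M = A j \<inter> Z \<inter> {- real M..real M}" for j M
  have BM: "B j M \<in> sets borel" for j M unfolding B_def by measurable
  have null: "B j M \<in> null_sets lborel" for j M
  proof (rule null_set_if_pmass_tendsto_0[OF BM])
    have "emeasure lborel (B j M) \<le> emeasure lborel {- real M..real M}"
      unfolding B_def by (intro emeasure_mono) auto
    also have "\<dots> < \<infinity>" by simp
    finally show "emeasure lborel (B j M) < \<infinity>" .
    fix x assume x: "x \<in> B j M"
    define q where "q k = pmass (B j M) x (1 / real (Suc k))" for k
    have le: "q k \<le> ennreal (real (Suc j) * (2 * sqrt (det_Im_m J (zseq x k))))" for k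
    proof -
      have "ennreal (1 / real (Suc j)) * q k \<le> ennreal (2 * sqrt (det_Im_m J (zseq x k)))"
        unfolding q_def
      proof (rule semicontinuity_Poisson[OF Js J wot BM])
        show "\<forall>\<^sub>F k in sequentially. 1 / real (Suc j) \<le> 2 * sqrt (det_Im_m (Js n) (zseq x k))" if "x \<in> B j M" for x n
          using that unfolding B_def A_def eventually_sequentially by blast
      qed auto
      then have "ennreal (real (Suc j)) * (ennreal (1 / real (Suc j)) * q k) \<le> ennreal (real (Suc j)) * ennreal (2 * sqrt (det_Im_m J (zseq x k)))"
        by (rule mult_left_mono) simp
      moreover have "ennreal (real (Suc j)) * ennreal (1 / real (Suc j)) = 1"
        by (simp add: ennreal_mult[symmetric] del: of_nat_Suc)
      then have "ennreal (real (Suc j)) * (ennreal (1 / real (Suc j)) * q k) = q k" by (simp only: mult.assoc[symmetric] mult_1)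
      moreover have "ennreal (real (Suc j)) * ennreal (2 * sqrt (det_Im_m J (zseq x k))) = ennreal (real (Suc j) * (2 * sqrt (det_Im_m J (zseq x k))))"
        by (rule ennreal_mult[symmetric]) (use det_Im_m_nonneg[OF J zseq_Im] in auto)
      ultimately show ?thesis by simp
    qed
    have "(\<lambda>k. det_Im_m J (zseq x k)) \<longlonglongrightarrow> 0" using x by (simp add: B_def Z_def)
    then have "(\<lambda>k. real (Suc j) * (2 * sqrt (det_Im_m J (zseq x k)))) \<longlonglongrightarrow> real (Suc j) * (2 * sqrt 0)"
      by (intro tendsto_intros)
    then have "(\<lambda>k. ennreal (real (Suc j) * (2 * sqrt (det_Im_m J (zseq x k))))) \<longlonglongrightarrow> ennreal (real (Suc j) * (2 * sqrt 0))"
      by (rule tendsto_ennrealI)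
    then have lim: "(\<lambda>k. ennreal (real (Suc j) * (2 * sqrt (det_Im_m J (zseq x k))))) \<longlonglongrightarrow> 0" by simp
    show "(\<lambda>k. pmass (B j M) x (1 / real (Suc k))) \<longlonglongrightarrow> 0"
      unfolding q_def[symmetric] by (rule tendsto_sandwich[OF _ _ tendsto_const lim]) (use le in auto)
  qed
  have 1: "AE x in lborel. \<forall>j M. x \<notin> B j M"
    unfolding AE_all_countable using null by (auto intro: AE_not_in)
  have 2: "AE x in lborel. \<exists>L. ((\<lambda>y. m_plus J (Complex x y)) \<longlongrightarrow> L) (at_right 0)"
  proof (rule Herglotz_boundary_value[OF m_plus_holomorphic[OF J]])
    show "Im (m_plus J w) \<ge> 0" if "Im w > 0" for w using Im_m_plus_pos[OF J that] by simp
    show "\<exists>B. \<forall>w. e \<le> Im w \<longrightarrow> cmod (m_plus J w) \<le> B" if "e > 0" for e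
      using m_plus_bounded[OF J _ that] by blast
  qed
  \<comment> \<open>A finite limit of this Herglotz function excludes that the boundary values of
    \<open>m_plus\<close> and \<open>m_minus\<close> cancel.\<close>
  have 3: "AE x in lborel. \<exists>L. ((\<lambda>y. - (1 / (m_plus J (Complex x y) + m_minus J (Complex x y)))) \<longlongrightarrow> L) (at_right 0)"
  proof (rule Herglotz_boundary_value)
    show "(\<lambda>z. - (1 / (m_plus J z + m_minus J z))) holomorphic_on {w. 0 < Im w}"
      using m_sum_nonzero[OF J] by (intro holomorphic_intros m_plus_holomorphic m_minus_holomorphic J) auto
    show "0 \<le> Im (- (1 / (m_plus J w + m_minus J w)))" if "0 < Im w" for w
      using Im_m_plus_pos[OF J that] Im_m_minus_pos[OF J that] by (auto simp: Im_divide intro!: divide_nonpos_nonneg)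
    show "\<exists>B. \<forall>w. e \<le> Im w \<longrightarrow> cmod (- (1 / (m_plus J w + m_minus J w))) \<le> B" if "e > 0" for e
      using norm_inverse_m_sum[OF J _ that] by (auto simp: norm_minus_cancel)
  qed
  \<comment> \<open>The growth of \<open>m_minus\<close> rules out the bound required by
    \<open>Herglotz_boundary_value\<close>, so Fatou's theorem is applied to the bounded transform.
    Its limit 0 is excluded below by \<open>det_Im_m_tendsto_0\<close>.\<close>
  have 4: "AE x in lborel. \<exists>L. ((\<lambda>y. 1 / (m_minus J (Complex x y) + \<i>)) \<longlongrightarrow> L) (at_right 0)"
  proof (rule Fatou_bounded[where B = 1])
    have ge: "1 \<le> cmod (m_minus J w + \<i>)" if "0 < Im w" for w
      using abs_Im_le_cmod[of "m_minus J w + \<i>"] Im_m_minus_pos[OF J that] by simp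
    then have "m_minus J w + \<i> \<noteq> 0" if "0 < Im w" for w using that by fastforce
    then show "(\<lambda>z. 1 / (m_minus J z + \<i>)) holomorphic_on {w. 0 < Im w}"
      by (intro holomorphic_intros m_minus_holomorphic J) auto
    show "cmod (1 / (m_minus J w + \<i>)) \<le> 1" if "0 < Im w" for w
      using ge[OF that] by (simp add: norm_divide divide_le_eq)
  qed
  show ?thesis using 1 2 3 4
  proof eventually_elim
    case (elim x)
    show ?case
    proof
      assume "\<exists>c<0. \<forall>n. boundary_det (Js n) x c"
      then obtain c where c: "c < 0" "\<And>n. boundary_det (Js n) x c" by blast
      obtain j where j: "1 / real (Suc j) < 2 * sqrt (- c)" using nat_approx_posE[of "2 * sqrt (- c)"] c(1) by auto
      have "x \<in> A j" unfolding A_def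
      proof (intro CollectI allI)
        fix n
        have "(\<lambda>k. 2 * sqrt (det_Im_m (Js n) (zseq x k))) \<longlonglongrightarrow> 2 * sqrt (- c)"
          by (intro tendsto_intros boundary_det_det_Im_m_tendsto[OF Js c(2)])
        from order_tendstoD(1)[OF this j] show "\<exists>N. \<forall>k\<ge>N. 1 / real (Suc j) \<le> 2 * sqrt (det_Im_m (Js n) (zseq x k))"
          unfolding eventually_sequentially using less_imp_le by blast
      qed
      moreover obtain M where M: "\<bar>x\<bar> \<le> real M" using real_arch_simple by blast
      then have "x \<in> {- real M..real M}" by auto
      ultimately have "x \<notin> Z" using elim(1) unfolding B_def by blast
      then have nZ: "\<not> (\<lambda>k. det_Im_m J (zseq x k)) \<longlonglongrightarrow> 0" unfolding Z_def by blast
      obtain wp where wp: "((\<lambda>y. m_plus J (Complex x y)) \<longlongrightarrow> wp) (at_right 0)" using elim(2) by blast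
      obtain g where g: "((\<lambda>y. - (1 / (m_plus J (Complex x y) + m_minus J (Complex x y)))) \<longlongrightarrow> g) (at_right 0)" using elim(3) by blast
      obtain L where L: "((\<lambda>y. 1 / (m_minus J (Complex x y) + \<i>)) \<longlongrightarrow> L) (at_right 0)" using elim(4) by blast
      note sp = boundary_value_sequence[OF wp]
      have "L \<noteq> 0"
      proof
        assume "L = 0"
        with boundary_value_sequence[of "\<lambda>z. 1 / (m_minus J z + \<i>)", OF L] have "(\<lambda>k. det_Im_m J (zseq x k)) \<longlonglongrightarrow> 0"
          by (intro det_Im_m_tendsto_0[OF J sp]) simp
        with nZ show False by contradiction
      qed
      then have "((\<lambda>y. 1 / (1 / (m_minus J (Complex x y) + \<i>)) - \<i>) \<longlongrightarrow> 1 / L - \<i>) (at_right 0)"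
        by (intro tendsto_intros L)
      then have wm: "((\<lambda>y. m_minus J (Complex x y)) \<longlongrightarrow> 1 / L - \<i>) (at_right 0)" by simp
      define w where "w = 1 / L - \<i>"
      note sm = boundary_value_sequence[OF wm[folded w_def]]
      note sg = boundary_value_sequence[of "\<lambda>z. - (1 / (m_plus J z + m_minus J z))", OF g]
      have "(\<lambda>k. - (1 / (m_plus J (zseq x k) + m_minus J (zseq x k))) * (m_plus J (zseq x k) + m_minus J (zseq x k))) \<longlonglongrightarrow> g * (wp + w)"
        by (intro tendsto_mult tendsto_add sg sp sm)
      moreover have "- (1 / (m_plus J (zseq x k) + m_minus J (zseq x k))) * (m_plus J (zseq x k) + m_minus J (zseq x k)) = - 1" for k
        using m_sum_nonzero[OF J zseq_Im, of x k] by simp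
      ultimately have "g * (wp + w) = - 1" by (simp only: LIMSEQ_const_iff)
      then have nz: "wp + w \<noteq> 0" by auto
      have "(\<lambda>k. det_Im_m J (zseq x k)) \<longlonglongrightarrow> Im wp * Im w / (cmod (wp + w))\<^sup>2"
        unfolding det_Im_m_def using nz by (intro tendsto_intros sp sm) auto
      \<comment> \<open>A vanishing imaginary part would make the determinant tend to 0, contrary to
        \<open>nZ\<close>.\<close>
      with nZ have "Im wp * Im w \<noteq> 0" by auto
      moreover have "Im wp \<ge> 0"
        by (rule tendsto_lowerbound[OF tendsto_Im[OF sp]]) (use Im_m_plus_pos[OF J zseq_Im] in \<open>auto simp: less_imp_le intro!: always_eventually\<close>)
      moreover have "Im w \<ge> 0"
        by (rule tendsto_lowerbound[OF tendsto_Im[OF sm]]) (use Im_m_minus_pos[OF J zseq_Im] in \<open>auto simp: less_imp_le intro!: always_eventually\<close>)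
      ultimately have "Im wp > 0" "Im w > 0" by auto
      then show "x \<in> Sigma_ac J" unfolding Sigma_ac_def has_boundary_value_def using wp wm w_def by blast
    qed
  qed
qed

theorem corollary1p5:
  fixes Js :: "nat \<Rightarrow> jacobi" and J :: jacobi
  assumes "\<And>n. n \<ge> 1 \<Longrightarrow> bounded_jacobi (Js n)"
    and "bounded_jacobi J"
    and "wot_tendsto Js J"
    and "\<And>n. n \<ge> 1 \<Longrightarrow>
           (\<exists>k. Js (Suc n) = shift k (Js n)) \<or> (\<exists>p t. toda_map p t (Js n) (Js (Suc n)))"
  shows "AE x in lebesgue. x \<in> Sigma_ac (Js 1) \<longrightarrow> x \<in> Sigma_ac J"
proof -
  \<comment> \<open>The sequence starts at 1 and nothing is known about \<open>Js 0\<close>, so it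
    is reindexed to start at 0.\<close>
  define Ks where "Ks n = Js (Suc n)" for n
  have Ks: "bounded_jacobi (Ks n)" for n unfolding Ks_def by (rule assms(1)) simp
  have wot: "wot_tendsto Ks J" unfolding wot_tendsto_def Ks_def
  proof (intro ballI)
    fix u v assume "u \<in> ell2" "v \<in> ell2"
    then have "(\<lambda>n. ell2_inner u (jacobi_op (Js n) v)) \<longlonglongrightarrow> ell2_inner u (jacobi_op J v)"
      using assms(3) unfolding wot_tendsto_def by blast
    then show "(\<lambda>n. ell2_inner u (jacobi_op (Js (Suc n)) v)) \<longlonglongrightarrow> ell2_inner u (jacobi_op J v)"
      by (rule LIMSEQ_Suc)
  qed
  have step: "boundary_det (Ks (Suc n)) x c" if g: "boundary_det (Ks n) x c" for n x c
  proof -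
    have "(\<exists>k. Ks (Suc n) = shift k (Ks n)) \<or> (\<exists>p t. toda_map p t (Ks n) (Ks (Suc n)))"
      using assms(4)[of "Suc n"] by (simp add: Ks_def)
    then show ?thesis
    proof (elim disjE exE)
      fix k assume "Ks (Suc n) = shift k (Ks n)"
      then show ?thesis using boundary_det_shift[OF Ks g] by simp
    next
      fix p t assume "toda_map p t (Ks n) (Ks (Suc n))"
      then obtain F where F: "toda_solution p F" "F 0 = Ks n" "F t = Ks (Suc n)" by (auto simp: toda_map_def)
      have "boundary_det (F t) x c" by (rule boundary_det_toda[OF F(1)]) (simp add: F g)
      then show ?thesis by (simp add: F)
    qed
  qed
  \<comment> \<open>The value \<open>c\<close> is found once, for the first matrix, and transported
    unchanged; this is the uniformity in \<open>n\<close> that the limit requires.\<close>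
  have boundary_det: "\<exists>c<0. \<forall>n. boundary_det (Ks n) x c" if x: "x \<in> Sigma_ac (Js 1)" for x
  proof -
    obtain c where c: "c < 0" "boundary_det (Ks 0) x c"
      using Sigma_ac_boundary_det[OF Ks[of 0], of x] x by (auto simp: Ks_def)
    have "boundary_det (Ks n) x c" for n by (induction n) (auto intro: c step)
    with c(1) show ?thesis by blast
  qed
  have "AE x in lborel. x \<in> Sigma_ac (Js 1) \<longrightarrow> x \<in> Sigma_ac J"
    using Sigma_ac_semicontinuous[OF Ks assms(2) wot] by eventually_elim (use boundary_det in blast)
  then show ?thesis by (rule AE_completion)
qed

end
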